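(* Let $(M=M_1\times_f M_2,g^f,\Pi)$ be a Riemannian Poisson warped product space and suppose that $f$ is a Casimir function on $M_1$. Let $\eta=\eta_1^h+\eta_2^v\in\Omega^1(M)$ with $\eta_1\in\Omega^1(M_1)$, $\eta_2\in\Omega^1(M_2)$. Then $\eta$ is a Killing 1-form on $M$ if and only if the following two conditions hold: (1) $\eta_1$ is a Killing 1-form on $M_1$; (2) $\eta_2$ is a Killing 1-form on $M_2$.
   Context: Poisson notation. For a manifold $N$ with a Poisson tensor $\Pi$ (bivector field with $[\Pi,\Pi]_S=0$), the sharp map $\sharp_\Pi:T^*N\to TN$ is defined by $\eta(\sharp_\Pi(\omega))=\Pi(\omega,\eta)$, and the Koszul bracket on 1-forms is $[\omega,\eta]_\Pi=\mathcal{L}_{\sharp_\Pi(\omega)}\eta-\mathcal{L}_{\sharp_\Pi(\eta)}\omega-d(\Pi(\omega,\eta))$. The cometric $g$ of a pseudo-Riemannian metric $\tilde g$ is the induced metric on $T^*N$. The contravariant Levi-Civita connection $\mathcal{D}$ of $(\Pi,g)$ is the unique contravariant connection on 1-forms ($\mathcal{D}_{\phi\omega}\eta=\phi\mathcal{D}_\omega\eta$, $\mathcal{D}_\omega(\phi\eta)=\phi\mathcal{D}_\omega\eta+\sharp_\Pi(\omega)(\phi)\eta$) with $\mathcal{D}_\omega\eta-\mathcal{D}_\eta\omega=[\omega,\eta]_\Pi$ and $\sharp_\Pi(\omega)g(\eta,\gamma)=g(\mathcal{D}_\omega\eta,\gamma)+g(\eta,\mathcal{D}_\omega\gamma)$.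 $(N,g,\Pi)$ is a Riemannian Poisson manifold if $\mathcal{D}\Pi=0$, i.e. $\sharp_\Pi(\omega)\Pi(\eta,\gamma)=\Pi(\mathcal{D}_\omega\eta,\gamma)+\Pi(\eta,\mathcal{D}_\omega\gamma)$ for all 1-forms. Killing 1-forms. $(\mathcal{L}_\eta g)(\alpha,\beta)=\sharp_\Pi(\eta)(g(\alpha,\beta))-g([\eta,\alpha]_\Pi,\beta)-g(\alpha,[\eta,\beta]_\Pi)$; $\eta$ is a Killing 1-form (for the given cometric and Poisson tensor) if $\mathcal{L}_\eta g=0$. Warped product. $(M_1,\tilde g_1)$, $(M_2,\tilde g_2)$ are pseudo-Riemannian manifolds with cometrics $g_1,g_2$ and Poisson tensors $\Pi_1,\Pi_2$; $f:M_1\to\mathbb{R}^+$ is smooth; $\pi_1,\pi_2$ are the projections of $M=M_1\times M_2$. Lifts: $\phi^h=\phi\circ\pi_1$, $\omega_1^h=\pi_1^*\omega_1$ for functions/1-forms on $M_1$, and $\phi^v=\phi\circ\pi_2$, $\omega_2^v=\pi_2^*\omega_2$ for those on $M_2$. The cometric $g^f$ of the warped metric $\tilde g^f=\pi_1^*\tilde g_1+(f^h)^2\pi_2^*\tilde g_2$ satisfies $g^f(\omega_1^h,\eta_1^h)=g_1(\omega_1,\eta_1)^h$, $g^f(\omega_1^h,\eta_2^v)=0$, $g^f(\omega_2^v,\eta_2^v)=\frac{1}{(f^h)^2}g_2(\omega_2,\eta_2)^v$. $\Pi=\Pi_1+\Pi_2$ is the product Poisson tensor: $\Pi(\omega_1^h,\eta_1^h)=\Pi_1(\omega_1,\eta_1)^h$,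 $\Pi(\omega_1^h,\eta_2^v)=0$, $\Pi(\omega_2^v,\eta_2^v)=\Pi_2(\omega_2,\eta_2)^v$. $(M_1\times_f M_2,g^f,\Pi)$ is a Riemannian Poisson warped product space if it is a Riemannian Poisson manifold. $f$ is a Casimir function on $M_1$ if $\Pi_1(d\phi,df)=0$ for all $\phi\in\mathcal{C}^\infty(M_1)$. Killing 1-forms on $M_i$ are with respect to $(g_i,\Pi_i)$, and on $M$ with respect to $(g^f,\Pi)$. *)

theory Defs
  imports "HOL-Analysis.Analysis" "HOL-Library.Function_Algebras"
begin

text \<open>
  A manifold is a Hausdorff, second countable type together with a smooth atlas; its smooth
  structure enters only through the algebra of smooth real functions.  Vector fields are the
  derivations of that algebra, 1-forms the linear maps (over that algebra) from vector fields to
  smooth functions, and tensor fields are multilinear maps.  Sums, differences and products of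
  functions, fields and forms are the pointwise ones of Function Algebras.

  Vector fields and 1-forms are required to vanish outside their intended domain, so that
  equality of HOL functions is equality of fields and of forms.
\<close>

section \<open>Smooth manifolds\<close>

primrec C_k_on ::
  "nat \<Rightarrow> 'e::real_normed_vector set \<Rightarrow> ('e \<Rightarrow> 'f::real_normed_vector) \<Rightarrow> bool" where
  "C_k_on 0 S f \<longleftrightarrow> continuous_on S f"
| "C_k_on (Suc k) S f \<longleftrightarrow>
     (\<forall>x\<in>S. f differentiable (at x)) \<and> (\<forall>v. C_k_on k S (\<lambda>x. frechet_derivative f (at x) v))"

text \<open>Only used for open sets in Euclidean spaces.\<close>
definition smooth_on :: "'e::real_normed_vector set \<Rightarrow> ('e \<Rightarrow> 'f::real_normed_vector) \<Rightarrow> bool" where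
  "smooth_on S f \<longleftrightarrow> (\<forall>k. C_k_on k S f)"

text \<open>A chart is a pair of its domain and its coordinate map.\<close>
type_synonym ('a, 'e) atlas = "('a set \<times> ('a \<Rightarrow> 'e)) set"

definition smooth_atlas ::
  "('a::{t2_space,second_countable_topology}, 'e::euclidean_space) atlas \<Rightarrow> bool" where
  "smooth_atlas A \<longleftrightarrow>
     (\<Union>(U, c)\<in>A. U) = UNIV \<and>
     (\<forall>(U, c)\<in>A. open U \<and> open (c ` U) \<and> homeomorphism U (c ` U) c (inv_into U c)) \<and>
     (\<forall>(U, c)\<in>A. \<forall>(V, d)\<in>A. smooth_on (c ` (U \<inter> V)) (d \<circ> inv_into U c))"

definition smooth_functions :: "('a, 'e::euclidean_space) atlas \<Rightarrow> ('a \<Rightarrow> real) set" where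
  "smooth_functions A = {\<phi>. \<forall>(U, c)\<in>A. smooth_on (c ` U) (\<phi> \<circ> inv_into U c)}"

definition prod_atlas :: "('a, 'e) atlas \<Rightarrow> ('b, 'f) atlas \<Rightarrow> ('a \<times> 'b, 'e \<times> 'f) atlas" where
  "prod_atlas A B = {(U \<times> V, map_prod c d) | U c V d. (U, c) \<in> A \<and> (V, d) \<in> B}"

section \<open>Vector fields and 1-forms\<close>

type_synonym 'a vector_field = "('a \<Rightarrow> real) \<Rightarrow> 'a \<Rightarrow> real"
type_synonym 'a form = "'a vector_field \<Rightarrow> 'a \<Rightarrow> real"
type_synonym 'a two_tensor = "'a vector_field \<Rightarrow> 'a vector_field \<Rightarrow> 'a \<Rightarrow> real"
type_synonym 'a co_two_tensor = "'a form \<Rightarrow> 'a form \<Rightarrow> 'a \<Rightarrow> real"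

definition fscale :: "('a \<Rightarrow> real) \<Rightarrow> ('z \<Rightarrow> 'a \<Rightarrow> real) \<Rightarrow> 'z \<Rightarrow> 'a \<Rightarrow> real" (infixr "\<odot>" 75) where
  "\<phi> \<odot> T = (\<lambda>z. \<phi> * T z)"

definition vector_fields :: "('a, 'e::euclidean_space) atlas \<Rightarrow> 'a vector_field set" where
  "vector_fields A = {X.
     (\<forall>\<phi>\<in>smooth_functions A. X \<phi> \<in> smooth_functions A) \<and>
     (\<forall>\<phi>. \<phi> \<notin> smooth_functions A \<longrightarrow> X \<phi> = 0) \<and>
     (\<forall>\<phi>\<in>smooth_functions A. \<forall>\<psi>\<in>smooth_functions A. X (\<phi> + \<psi>) = X \<phi> + X \<psi>) \<and>
     (\<forall>r. \<forall>\<phi>\<in>smooth_functions A. X ((\<lambda>_. r) * \<phi>) = (\<lambda>_. r) * X \<phi>) \<and>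
     (\<forall>\<phi>\<in>smooth_functions A. \<forall>\<psi>\<in>smooth_functions A. X (\<phi> * \<psi>) = \<phi> * X \<psi> + \<psi> * X \<phi>)}"

definition one_forms :: "('a, 'e::euclidean_space) atlas \<Rightarrow> 'a form set" where
  "one_forms A = {\<omega>.
     (\<forall>X\<in>vector_fields A. \<omega> X \<in> smooth_functions A) \<and>
     (\<forall>X. X \<notin> vector_fields A \<longrightarrow> \<omega> X = 0) \<and>
     (\<forall>X\<in>vector_fields A. \<forall>Y\<in>vector_fields A. \<omega> (X + Y) = \<omega> X + \<omega> Y) \<and>
     (\<forall>\<phi>\<in>smooth_functions A. \<forall>X\<in>vector_fields A. \<omega> (\<phi> \<odot> X) = \<phi> * \<omega> X)}"

definition ext_d :: "('a, 'e::euclidean_space) atlas \<Rightarrow> ('a \<Rightarrow> real) \<Rightarrow> 'a form" where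
  "ext_d A \<phi> = (\<lambda>X. if X \<in> vector_fields A then X \<phi> else 0)"

definition lie_bracket :: "'a vector_field \<Rightarrow> 'a vector_field \<Rightarrow> 'a vector_field" where
  "lie_bracket X Y = (\<lambda>\<phi>. X (Y \<phi>) - Y (X \<phi>))"

definition lie_form :: "('a, 'e::euclidean_space) atlas \<Rightarrow> 'a vector_field \<Rightarrow> 'a form \<Rightarrow> 'a form" where
  "lie_form A X \<omega> = (\<lambda>Y. if Y \<in> vector_fields A then X (\<omega> Y) - \<omega> (lie_bracket X Y) else 0)"

section \<open>Pseudo-Riemannian metrics and cometrics\<close>

text \<open>
  Every tangent vector extends to a global vector field, so the last clause says that the
  bilinear form on each tangent space is nondegenerate.
\<close>
definition pseudo_riemannian :: "('a, 'e::euclidean_space) atlas \<Rightarrow> 'a two_tensor \<Rightarrow> bool" where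
  "pseudo_riemannian A g \<longleftrightarrow>
     (\<forall>X\<in>vector_fields A. \<forall>Y\<in>vector_fields A. g X Y \<in> smooth_functions A \<and> g X Y = g Y X) \<and>
     (\<forall>X\<in>vector_fields A. \<forall>Y\<in>vector_fields A. \<forall>Z\<in>vector_fields A.
        g (X + Y) Z = g X Z + g Y Z) \<and>
     (\<forall>\<phi>\<in>smooth_functions A. \<forall>X\<in>vector_fields A. \<forall>Y\<in>vector_fields A.
        g (\<phi> \<odot> X) Y = \<phi> * g X Y) \<and>
     (\<forall>p. \<forall>X\<in>vector_fields A. (\<forall>Y\<in>vector_fields A. g X Y p = 0) \<longrightarrow>
        (\<forall>\<phi>\<in>smooth_functions A. X \<phi> p = 0))"

definition metric_sharp ::
  "('a, 'e::euclidean_space) atlas \<Rightarrow> 'a two_tensor \<Rightarrow> 'a form \<Rightarrow> 'a vector_field" where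
  "metric_sharp A g \<omega> =
     (THE X. X \<in> vector_fields A \<and> (\<forall>Y\<in>vector_fields A. g X Y = \<omega> Y))"

definition cometric :: "('a, 'e::euclidean_space) atlas \<Rightarrow> 'a two_tensor \<Rightarrow> 'a co_two_tensor" where
  "cometric A g = (\<lambda>\<omega> \<eta>. g (metric_sharp A g \<omega>) (metric_sharp A g \<eta>))"

section \<open>Poisson tensors\<close>

definition bivector_field :: "('a, 'e::euclidean_space) atlas \<Rightarrow> 'a co_two_tensor \<Rightarrow> bool" where
  "bivector_field A P \<longleftrightarrow>
     (\<forall>\<omega>\<in>one_forms A. \<forall>\<eta>\<in>one_forms A. P \<omega> \<eta> \<in> smooth_functions A \<and> P \<omega> \<eta> = - P \<eta> \<omega>) \<and>
     (\<forall>\<omega>\<in>one_forms A. \<forall>\<eta>\<in>one_forms A. \<forall>\<gamma>\<in>one_forms A. P (\<omega> + \<eta>) \<gamma> = P \<omega> \<gamma> + P \<eta> \<gamma>) \<and>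
     (\<forall>\<phi>\<in>smooth_functions A. \<forall>\<omega>\<in>one_forms A. \<forall>\<eta>\<in>one_forms A. P (\<phi> \<odot> \<omega>) \<eta> = \<phi> * P \<omega> \<eta>)"

text \<open>
  The Schouten bracket of two bivector fields is the trivector field whose value on
  d \<phi>, d \<psi>, d \<theta> is the following sum (the sum over (2,1)-shuffles, written
  cyclically using antisymmetry); exact forms span every cotangent space.
\<close>
definition schouten_bracket ::
  "('a, 'e::euclidean_space) atlas \<Rightarrow> 'a co_two_tensor \<Rightarrow> 'a co_two_tensor \<Rightarrow>
   ('a \<Rightarrow> real) \<Rightarrow> ('a \<Rightarrow> real) \<Rightarrow> ('a \<Rightarrow> real) \<Rightarrow> 'a \<Rightarrow> real" where
  "schouten_bracket A P Q \<phi> \<psi> \<theta> =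
     (let d = ext_d A; PQ = (\<lambda>u v w. P (d (Q (d u) (d v))) (d w) + Q (d (P (d u) (d v))) (d w))
      in PQ \<phi> \<psi> \<theta> + PQ \<psi> \<theta> \<phi> + PQ \<theta> \<phi> \<psi>)"

definition poisson_tensor :: "('a, 'e::euclidean_space) atlas \<Rightarrow> 'a co_two_tensor \<Rightarrow> bool" where
  "poisson_tensor A P \<longleftrightarrow> bivector_field A P \<and>
     (\<forall>\<phi>\<in>smooth_functions A. \<forall>\<psi>\<in>smooth_functions A. \<forall>\<theta>\<in>smooth_functions A.
        schouten_bracket A P P \<phi> \<psi> \<theta> = 0)"

definition poisson_sharp ::
  "('a, 'e::euclidean_space) atlas \<Rightarrow> 'a co_two_tensor \<Rightarrow> 'a form \<Rightarrow> 'a vector_field" where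
  "poisson_sharp A P \<omega> = (THE X. X \<in> vector_fields A \<and> (\<forall>\<eta>\<in>one_forms A. \<eta> X = P \<omega> \<eta>))"

definition koszul_bracket ::
  "('a, 'e::euclidean_space) atlas \<Rightarrow> 'a co_two_tensor \<Rightarrow> 'a form \<Rightarrow> 'a form \<Rightarrow> 'a form" where
  "koszul_bracket A P \<omega> \<eta> =
     lie_form A (poisson_sharp A P \<omega>) \<eta> - lie_form A (poisson_sharp A P \<eta>) \<omega> - ext_d A (P \<omega> \<eta>)"

definition casimir :: "('a, 'e::euclidean_space) atlas \<Rightarrow> 'a co_two_tensor \<Rightarrow> ('a \<Rightarrow> real) \<Rightarrow> bool" where
  "casimir A P f \<longleftrightarrow> f \<in> smooth_functions A \<and>
     (\<forall>\<phi>\<in>smooth_functions A. P (ext_d A \<phi>) (ext_d A f) = 0)"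

section \<open>Riemannian Poisson manifolds and Killing 1-forms\<close>

text \<open>In this section g denotes a cometric.\<close>

definition contravariant_connection ::
  "('a, 'e::euclidean_space) atlas \<Rightarrow> 'a co_two_tensor \<Rightarrow> ('a form \<Rightarrow> 'a form \<Rightarrow> 'a form) \<Rightarrow> bool" where
  "contravariant_connection A P D \<longleftrightarrow>
     (\<forall>\<omega>\<in>one_forms A. \<forall>\<eta>\<in>one_forms A. D \<omega> \<eta> \<in> one_forms A) \<and>
     (\<forall>\<omega>\<in>one_forms A. \<forall>\<eta>\<in>one_forms A. \<forall>\<gamma>\<in>one_forms A.
        D (\<omega> + \<eta>) \<gamma> = D \<omega> \<gamma> + D \<eta> \<gamma> \<and> D \<omega> (\<eta> + \<gamma>) = D \<omega> \<eta> + D \<omega> \<gamma>) \<and>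
     (\<forall>\<phi>\<in>smooth_functions A. \<forall>\<omega>\<in>one_forms A. \<forall>\<eta>\<in>one_forms A.
        D (\<phi> \<odot> \<omega>) \<eta> = \<phi> \<odot> D \<omega> \<eta> \<and>
        D \<omega> (\<phi> \<odot> \<eta>) = \<phi> \<odot> D \<omega> \<eta> + poisson_sharp A P \<omega> \<phi> \<odot> \<eta>)"

definition contravariant_levi_civita ::
  "('a, 'e::euclidean_space) atlas \<Rightarrow> 'a co_two_tensor \<Rightarrow> 'a co_two_tensor \<Rightarrow>
   ('a form \<Rightarrow> 'a form \<Rightarrow> 'a form) \<Rightarrow> bool" where
  "contravariant_levi_civita A g P D \<longleftrightarrow>
     contravariant_connection A P D \<and>
     (\<forall>\<omega>\<in>one_forms A. \<forall>\<eta>\<in>one_forms A. D \<omega> \<eta> - D \<eta> \<omega> = koszul_bracket A P \<omega> \<eta>) \<and>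
     (\<forall>\<omega>\<in>one_forms A. \<forall>\<eta>\<in>one_forms A. \<forall>\<gamma>\<in>one_forms A.
        poisson_sharp A P \<omega> (g \<eta> \<gamma>) = g (D \<omega> \<eta>) \<gamma> + g \<eta> (D \<omega> \<gamma>))"

text \<open>The connection D is unique, so the existential quantifier is a definite description.\<close>
definition riemannian_poisson ::
  "('a, 'e::euclidean_space) atlas \<Rightarrow> 'a co_two_tensor \<Rightarrow> 'a co_two_tensor \<Rightarrow> bool" where
  "riemannian_poisson A g P \<longleftrightarrow>
     (\<exists>D. contravariant_levi_civita A g P D \<and>
       (\<forall>\<omega>\<in>one_forms A. \<forall>\<eta>\<in>one_forms A. \<forall>\<gamma>\<in>one_forms A.
          poisson_sharp A P \<omega> (P \<eta> \<gamma>) = P (D \<omega> \<eta>) \<gamma> + P \<eta> (D \<omega> \<gamma>)))"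

definition lie_cometric ::
  "('a, 'e::euclidean_space) atlas \<Rightarrow> 'a co_two_tensor \<Rightarrow> 'a co_two_tensor \<Rightarrow> 'a form \<Rightarrow> 'a co_two_tensor"
  where
  "lie_cometric A g P \<eta> \<alpha> \<beta> =
     poisson_sharp A P \<eta> (g \<alpha> \<beta>)
       - g (koszul_bracket A P \<eta> \<alpha>) \<beta> - g \<alpha> (koszul_bracket A P \<eta> \<beta>)"

definition killing_form ::
  "('a, 'e::euclidean_space) atlas \<Rightarrow> 'a co_two_tensor \<Rightarrow> 'a co_two_tensor \<Rightarrow> 'a form \<Rightarrow> bool" where
  "killing_form A g P \<eta> \<longleftrightarrow> \<eta> \<in> one_forms A \<and>
     (\<forall>\<alpha>\<in>one_forms A. \<forall>\<beta>\<in>one_forms A. lie_cometric A g P \<eta> \<alpha> \<beta> = 0)"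

section \<open>Warped products\<close>

text \<open>
  For a vector field X on the product and a fixed q, the vectors
  d (fst) (X at (p, q)), as p varies, form a vector field on the first factor; similarly for
  snd with p fixed.
\<close>
definition slice1 :: "'b \<Rightarrow> ('a \<times> 'b) vector_field \<Rightarrow> 'a vector_field" where
  "slice1 q X = (\<lambda>\<phi> p. X (\<phi> \<circ> fst) (p, q))"

definition slice2 :: "'a \<Rightarrow> ('a \<times> 'b) vector_field \<Rightarrow> 'b vector_field" where
  "slice2 p X = (\<lambda>\<phi> q. X (\<phi> \<circ> snd) (p, q))"

text \<open>
  The pullbacks of 1-forms under fst and snd: the value on X at (p, q) is the given form at p
  (at q) applied to the image of X at (p, q) under the differential of the projection.
\<close>
definition hlift :: "('a, 'e::euclidean_space) atlas \<Rightarrow> ('b, 'f::euclidean_space) atlas \<Rightarrow>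
    'a form \<Rightarrow> ('a \<times> 'b) form" where
  "hlift A B \<omega> = (\<lambda>X. if X \<in> vector_fields (prod_atlas A B)
     then (\<lambda>(p, q). \<omega> (slice1 q X) p) else 0)"

definition vlift :: "('a, 'e::euclidean_space) atlas \<Rightarrow> ('b, 'f::euclidean_space) atlas \<Rightarrow>
    'b form \<Rightarrow> ('a \<times> 'b) form" where
  "vlift A B \<omega> = (\<lambda>X. if X \<in> vector_fields (prod_atlas A B)
     then (\<lambda>(p, q). \<omega> (slice2 p X) q) else 0)"

definition warped_metric ::
  "('a \<Rightarrow> real) \<Rightarrow> 'a two_tensor \<Rightarrow> 'b two_tensor \<Rightarrow> ('a \<times> 'b) two_tensor" where
  "warped_metric f g1 g2 = (\<lambda>X Y (p, q).
     g1 (slice1 q X) (slice1 q Y) p + (f p)\<^sup>2 * g2 (slice2 p X) (slice2 p Y) q)"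

text \<open>The lifts span every cotangent space of the product, so these equations determine the tensor.\<close>
definition product_bivector ::
  "('a, 'e::euclidean_space) atlas \<Rightarrow> ('b, 'f::euclidean_space) atlas \<Rightarrow>
   'a co_two_tensor \<Rightarrow> 'b co_two_tensor \<Rightarrow> ('a \<times> 'b) co_two_tensor \<Rightarrow> bool" where
  "product_bivector A B P1 P2 P \<longleftrightarrow>
     bivector_field (prod_atlas A B) P \<and>
     (\<forall>\<omega>\<in>one_forms A. \<forall>\<eta>\<in>one_forms A. P (hlift A B \<omega>) (hlift A B \<eta>) = P1 \<omega> \<eta> \<circ> fst) \<and>
     (\<forall>\<omega>\<in>one_forms A. \<forall>\<eta>\<in>one_forms B. P (hlift A B \<omega>) (vlift A B \<eta>) = 0) \<and>
     (\<forall>\<omega>\<in>one_forms B. \<forall>\<eta>\<in>one_forms B. P (vlift A B \<omega>) (vlift A B \<eta>) = P2 \<omega> \<eta> \<circ> snd)"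

end

theory Submission
  imports Defs
begin

text \<open>
  Why the theorem holds. The Lie derivative of a cometric along a 1-form \<open>\<eta>\<close> is bilinear over the smooth
  functions in its two arguments: in the Leibniz rule for the Koszul bracket (\<open>koszul_leibniz\<close>) the
  unwanted terms cancel against the derivative of the scaling factor (\<open>lie_cometric_module_map\<close>). A form on
  the product agrees at a given point with a sum of a horizontal and a vertical lift (\<open>form_split\<close>), so the
  Lie derivative vanishes as soon as it vanishes on lifts.

  On lifts everything is computed in the factors. The sharp of a horizontal lift differentiates in the
  first argument only (\<open>horizontal_sharp\<close>); hence brackets of lifts from the same factor are lifts of
  brackets, and brackets of lifts from different factors vanish (\<open>koszul_hh\<close>, \<open>koszul_vv\<close>, \<open>koszul_hv\<close>).
  The warped cometric is the lifted one on horizontal forms, zero on mixed pairs, and the lifted one divided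
  by \<open>f\<^sup>2\<close> on vertical forms (\<open>cometric_hh\<close>, \<open>cometric_hv\<close>, \<open>cometric_vv\<close>). So for \<open>\<eta> = \<eta>1 + \<eta>2\<close> the Lie
  derivative is that of the first factor on horizontal pairs and zero on mixed pairs. On vertical pairs it is
  that of the second factor divided by \<open>f\<^sup>2\<close>, plus the derivative of \<open>1/f\<^sup>2\<close> along the sharp of \<open>\<eta>1\<close>; the last
  term is zero because \<open>f\<close> is a Casimir function (\<open>casimir_quotient\<close>, \<open>lie_cometric_vv\<close>).

  The analytic work is to see that the sharp maps exist. Vector fields are derivations and forms are module
  maps, so one has to prove that they are given by their values at points: with Hadamard's lemma and cut-off
  functions, the coordinate fields of a chart are a frame near every point, whose dual frame is made up of
  differentials (\<open>coordinate_frame\<close>, \<open>dual_frame_exists\<close>), and every module map on fields or on forms can be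
  expanded in it (\<open>module_map_VF_expand\<close>, \<open>module_map_FM_expand\<close>). The vector field that represents a bivector
  field contracted with a form is then its action on differentials (\<open>poisson_sharp\<close>); the one that represents
  a form with respect to a metric comes from Cramer's rule near each point, and uniqueness glues the local
  solutions (\<open>metric_sharp\<close>).
\<close>

section \<open>Calculus of smooth functions on open sets\<close>

lemma C_k_on_cong:
  assumes "open S" "\<And>x. x \<in> S \<Longrightarrow> f x = g x" "C_k_on k S f"
  shows "C_k_on k S g"
  using assms(2,3)
proof (induction k arbitrary: f g)
  case 0
  then show ?case using continuous_on_cong[OF refl, of S f g] by simp
next
  case (Suc k)
  have dg: "(g has_derivative frechet_derivative f (at x)) (at x)" if "x \<in> S" for x
  proof (rule has_derivative_transform_within_open[OF _ assms(1) that])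
    show "(f has_derivative frechet_derivative f (at x)) (at x)"
      using Suc.prems(2) that by (simp add: frechet_derivative_works)
  qed (rule Suc.prems(1))
  have "frechet_derivative f (at x) = frechet_derivative g (at x)" if "x \<in> S" for x
    using dg[OF that] by (rule frechet_derivative_at)
  then have "C_k_on k S (\<lambda>x. frechet_derivative g (at x) v)" for v
    using Suc.prems(2) by (intro Suc.IH[of "\<lambda>x. frechet_derivative f (at x) v" "\<lambda>x. frechet_derivative g (at x) v"]) auto
  with differentiableI[OF dg] show ?case by simp
qed

text \<open>The derivative may be given by any formula, so that the calculus rules below apply the rules for derivatives.\<close>
lemma C_k_on_SucI:
  assumes "open S" "\<And>x. x \<in> S \<Longrightarrow> (f has_derivative f' x) (at x)"
    and "\<And>v. C_k_on k S (\<lambda>x. f' x v)"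
  shows "C_k_on (Suc k) S f"
proof -
  have "f' x = frechet_derivative f (at x)" if "x \<in> S" for x
    using assms(2)[OF that] by (rule frechet_derivative_at)
  then have "C_k_on k S (\<lambda>x. frechet_derivative f (at x) v)" for v
    using assms by (intro C_k_on_cong[of S "\<lambda>x. f' x v" "\<lambda>x. frechet_derivative f (at x) v"]) auto
  with differentiableI[OF assms(2)] show ?thesis by simp
qed

lemma C_k_on_SucD:
  assumes "C_k_on (Suc k) S f"
  shows "x \<in> S \<Longrightarrow> (f has_derivative frechet_derivative f (at x)) (at x)"
    and "C_k_on k S (\<lambda>x. frechet_derivative f (at x) v)"
  using assms by (auto simp: frechet_derivative_works)

text \<open>The definition asks for continuity only at the top order; below it, differentiability gives continuity.\<close>
lemma C_k_on_lower: "C_k_on (Suc k) S f \<Longrightarrow> C_k_on k S f"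
proof (induction k arbitrary: f)
  case 0
  then show ?case
    by (auto intro!: continuous_at_imp_continuous_on differentiable_imp_continuous_within)
next
  case (Suc k)
  from Suc.prems have "\<forall>x\<in>S. f differentiable at x"
    and "\<And>v. C_k_on (Suc k) S (\<lambda>x. frechet_derivative f (at x) v)" by simp_all
  with Suc.IH show ?case unfolding C_k_on.simps(2)[of k S f] by blast
qed

lemma C_k_on_subset: "C_k_on k S f \<Longrightarrow> T \<subseteq> S \<Longrightarrow> C_k_on k T f"
  by (induction k arbitrary: f) (auto intro: continuous_on_subset)

lemma C_k_on_local:
  assumes "\<And>x. x \<in> S \<Longrightarrow> \<exists>T. open T \<and> x \<in> T \<and> C_k_on k T f"
  shows "C_k_on k S f"
  using assms
proof (induction k arbitrary: f)
  case 0
  show ?case unfolding C_k_on.simps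
  proof (intro continuous_at_imp_continuous_on ballI)
    fix x assume "x \<in> S"
    then obtain T where "open T" "x \<in> T" "continuous_on T f" using 0 by force
    then show "isCont f x" by (simp add: continuous_on_eq_continuous_at)
  qed
next
  case (Suc k)
  have "C_k_on k S (\<lambda>x. frechet_derivative f (at x) v)" for v
    using Suc.prems by (intro Suc.IH) force
  moreover have "f differentiable at x" if "x \<in> S" for x
    using Suc.prems[OF that] by auto
  ultimately show ?case by simp
qed

lemma C_k_on_const: "open S \<Longrightarrow> C_k_on k S (\<lambda>_. c)"
  by (induction k arbitrary: c) (auto intro!: C_k_on_SucI[where f'="\<lambda>_ _. 0"] simp del: C_k_on.simps(2))

lemma C_k_on_bounded_linear:
  assumes "open S" "C_k_on k S f" "bounded_linear L"
  shows "C_k_on k S (\<lambda>x. L (f x))"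
  using assms(2)
proof (induction k arbitrary: f)
  case 0
  then show ?case by (auto intro: bounded_linear.continuous_on assms)
next
  case (Suc k)
  note D = C_k_on_SucD[OF Suc.prems]
  show ?case
    by (rule C_k_on_SucI[where f'="\<lambda>x v. L (frechet_derivative f (at x) v)"])
      (auto intro!: assms Suc.IH D bounded_linear.has_derivative[OF assms(3)])
qed

lemma C_k_on_linear:
  assumes "open S" "bounded_linear L"
  shows "C_k_on k S L"
proof (cases k)
  case 0
  then show ?thesis using assms by (simp add: linear_continuous_on)
next
  case (Suc m)
  then show ?thesis using assms
    by (auto intro!: C_k_on_SucI[where f'="\<lambda>x. L"] C_k_on_const bounded_linear_imp_has_derivative
        simp del: C_k_on.simps)
qed

lemma C_k_on_add:
  assumes "open S" "C_k_on k S f" "C_k_on k S g"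
  shows "C_k_on k S (\<lambda>x. f x + g x)"
  using assms(2,3)
proof (induction k arbitrary: f g)
  case 0
  then show ?case by (auto intro: continuous_intros)
next
  case (Suc k)
  note D = C_k_on_SucD[OF Suc.prems(1)] C_k_on_SucD[OF Suc.prems(2)]
  show ?case
    by (rule C_k_on_SucI[OF assms(1) has_derivative_add[OF D(1) D(3)]]) (auto intro!: Suc.IH D)
qed

lemma C_k_on_scaleR:
  fixes f :: "'e::real_normed_vector \<Rightarrow> real"
  assumes "open S" "C_k_on k S f" "C_k_on k S g"
  shows "C_k_on k S (\<lambda>x. f x *\<^sub>R g x)"
  using assms(2,3)
proof (induction k arbitrary: f g)
  case 0
  then show ?case by (auto intro: continuous_intros)
next
  case (Suc k)
  note D = C_k_on_SucD[OF Suc.prems(1)] C_k_on_SucD[OF Suc.prems(2)]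
  show ?case
    by (rule C_k_on_SucI[OF assms(1) has_derivative_scaleR[OF D(1) D(3)]])
      (assumption | rule C_k_on_add Suc.IH D(2,4) Suc.prems[THEN C_k_on_lower] assms(1))+
qed

lemma C_k_on_sum:
  assumes "open S" "\<And>i. i \<in> I \<Longrightarrow> C_k_on k S (f i)"
  shows "C_k_on k S (\<lambda>x. \<Sum>i\<in>I. f i x)"
  using assms(2)
  by (induction I rule: infinite_finite_induct) (auto intro!: C_k_on_const C_k_on_add assms(1))

lemma C_k_on_Pair:
  assumes "open S" "C_k_on k S f" "C_k_on k S g"
  shows "C_k_on k S (\<lambda>x. (f x, g x))"
  using assms(2,3)
proof (induction k arbitrary: f g)
  case 0
  then show ?case by (auto intro: continuous_intros)
next
  case (Suc k)
  note D = C_k_on_SucD[OF Suc.prems(1)] C_k_on_SucD[OF Suc.prems(2)]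
  show ?case
    by (rule C_k_on_SucI[OF assms(1) has_derivative_Pair[OF D(1) D(3)]]) (auto intro!: Suc.IH D)
qed

text \<open>The partial derivatives of a composition are, by the chain rule, sums of products of
  functions to which the induction hypothesis applies.\<close>
lemma C_k_on_compose:
  fixes h :: "'e::euclidean_space \<Rightarrow> 'f::euclidean_space"
  assumes "open S" "open T" "h ` S \<subseteq> T" "C_k_on k S h" "C_k_on k T F"
  shows "C_k_on k S (\<lambda>x. F (h x))"
  using assms(4,5)
proof (induction k arbitrary: F)
  case 0
  then show ?case using assms(3) by (auto intro: continuous_on_compose2)
next
  case (Suc k)
  note D = C_k_on_SucD[OF Suc.prems(1)] C_k_on_SucD[OF Suc.prems(2)]
  let ?f' = "\<lambda>x v. \<Sum>b\<in>Basis. (frechet_derivative h (at x) v \<bullet> b) *\<^sub>R frechet_derivative F (at (h x)) b"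
  show ?case
  proof (rule C_k_on_SucI[where f'="?f'"])
    show "open S" by fact
    fix x assume x: "x \<in> S"
    then have DF: "(F has_derivative frechet_derivative F (at (h x))) (at (h x))"
      using assms(3) by (intro D) auto
    then have lin: "linear (frechet_derivative F (at (h x)))"
      by (simp add: bounded_linear.linear has_derivative_bounded_linear)
    have "frechet_derivative F (at (h x)) (frechet_derivative h (at x) v) = ?f' x v" for v
    proof -
      have "frechet_derivative F (at (h x)) (frechet_derivative h (at x) v) =
        frechet_derivative F (at (h x)) (\<Sum>b\<in>Basis. (frechet_derivative h (at x) v \<bullet> b) *\<^sub>R b)"
        by (simp add: euclidean_representation)
      then show ?thesis by (simp add: linear_sum[OF lin] linear_scale[OF lin])
    qed
    then show "((\<lambda>x. F (h x)) has_derivative ?f' x) (at x)"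
      using has_derivative_compose[OF D(1)[OF x] DF] by simp
  next
    fix v
    have "C_k_on k S (\<lambda>x. frechet_derivative h (at x) v \<bullet> b)" for b
      by (rule C_k_on_bounded_linear[OF assms(1) D(2) bounded_linear_inner_left])
    moreover have "C_k_on k S (\<lambda>x. frechet_derivative F (at (h x)) b)" for b
      by (rule Suc.IH[OF C_k_on_lower[OF Suc.prems(1)] D(4)])
    ultimately show "C_k_on k S (\<lambda>x. ?f' x v)"
      by (intro C_k_on_sum C_k_on_scaleR assms(1))
  qed
qed

lemma smooth_on_cong:
  "open S \<Longrightarrow> (\<And>x. x \<in> S \<Longrightarrow> f x = g x) \<Longrightarrow> smooth_on S f \<Longrightarrow> smooth_on S g"
  unfolding smooth_on_def using C_k_on_cong by blast

lemma smooth_on_subset: "smooth_on S f \<Longrightarrow> T \<subseteq> S \<Longrightarrow> smooth_on T f"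
  unfolding smooth_on_def using C_k_on_subset by blast

lemma smooth_on_local:
  assumes "\<And>x. x \<in> S \<Longrightarrow> \<exists>T. open T \<and> x \<in> T \<and> smooth_on T f"
  shows "smooth_on S f"
  unfolding smooth_on_def
proof (intro allI C_k_on_local)
  fix k x assume "x \<in> S"
  with assms show "\<exists>T. open T \<and> x \<in> T \<and> C_k_on k T f" unfolding smooth_on_def by meson
qed

lemma smooth_on_const: "open S \<Longrightarrow> smooth_on S (\<lambda>_. c)"
  by (simp add: smooth_on_def C_k_on_const)

lemma smooth_on_linear: "open S \<Longrightarrow> bounded_linear L \<Longrightarrow> smooth_on S L"
  by (simp add: smooth_on_def C_k_on_linear)

lemma smooth_on_add:
  "open S \<Longrightarrow> smooth_on S f \<Longrightarrow> smooth_on S g \<Longrightarrow> smooth_on S (\<lambda>x. f x + g x)"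
  by (simp add: smooth_on_def C_k_on_add)

lemma smooth_on_scaleR:
  "open S \<Longrightarrow> smooth_on S f \<Longrightarrow> smooth_on S g \<Longrightarrow> smooth_on S (\<lambda>x. f x *\<^sub>R g x)"
  by (simp add: smooth_on_def C_k_on_scaleR)

lemma smooth_on_mult:
  fixes f g :: "'e::real_normed_vector \<Rightarrow> real"
  shows "open S \<Longrightarrow> smooth_on S f \<Longrightarrow> smooth_on S g \<Longrightarrow> smooth_on S (\<lambda>x. f x * g x)"
  using smooth_on_scaleR[of S f g] by simp

lemma smooth_on_diff:
  assumes "open S" "smooth_on S f" "smooth_on S g"
  shows "smooth_on S (\<lambda>x. f x - g x)"
  using smooth_on_add[OF assms(1,2) smooth_on_scaleR[OF assms(1) smooth_on_const[OF assms(1)] assms(3)],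
      of "-1"] by simp

lemma smooth_on_sum:
  "open S \<Longrightarrow> (\<And>i. i \<in> I \<Longrightarrow> smooth_on S (f i)) \<Longrightarrow> smooth_on S (\<lambda>x. \<Sum>i\<in>I. f i x)"
  by (simp add: smooth_on_def C_k_on_sum)

lemma smooth_on_Pair:
  "open S \<Longrightarrow> smooth_on S f \<Longrightarrow> smooth_on S g \<Longrightarrow> smooth_on S (\<lambda>x. (f x, g x))"
  by (simp add: smooth_on_def C_k_on_Pair)

lemma smooth_on_compose:
  fixes h :: "'e::euclidean_space \<Rightarrow> 'f::euclidean_space"
  assumes "open S" "open T" "h ` S \<subseteq> T" "smooth_on S h" "smooth_on T F"
  shows "smooth_on S (\<lambda>x. F (h x))"
  using C_k_on_compose[OF assms(1-3)] assms(4,5) unfolding smooth_on_def by blast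

lemma smooth_on_has_derivative:
  assumes "smooth_on S f" "x \<in> S"
  shows "(f has_derivative frechet_derivative f (at x)) (at x)"
  using assms C_k_on_SucD(1) unfolding smooth_on_def by blast

lemma smooth_on_frechet_derivative:
  assumes "smooth_on S f"
  shows "smooth_on S (\<lambda>x. frechet_derivative f (at x) v)"
  using assms C_k_on_SucD(2) unfolding smooth_on_def by blast

lemma smooth_on_continuous_on: "smooth_on S f \<Longrightarrow> continuous_on S f"
  unfolding smooth_on_def using C_k_on.simps(1) by blast

lemma smooth_on_inverse: "smooth_on (- {0::real}) inverse"
proof -
  have op: "open (- {0::real})" by auto
  have "C_k_on k (- {0::real}) inverse" for k
  proof (induction k)
    case 0
    then show ?case by (auto intro!: continuous_intros)
  next
    case (Suc k)
    have "C_k_on k (- {0}) (\<lambda>x::real. (-v) *\<^sub>R (inverse x *\<^sub>R inverse x))" for v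
      by (intro C_k_on_scaleR Suc C_k_on_const op)
    then show ?case
      by (intro C_k_on_SucI[where f'="\<lambda>x v. - (inverse x * v * inverse x)"] op has_derivative_inverse')
        (auto simp: mult_ac)
  qed
  then show ?thesis by (simp add: smooth_on_def)
qed

section \<open>Smooth cut-off functions on Euclidean spaces\<close>

text \<open>All powers are needed at once: the derivatives of \<open>exp (- 1 / t)\<close>, extended by zero, lie in the
  linear span of the family.\<close>
definition flat_exp :: "nat \<Rightarrow> real \<Rightarrow> real" where
  "flat_exp n t = (if t > 0 then inverse t ^ n * exp (- inverse t) else 0)"

text \<open>The exponential beats every power of \<open>1 / t\<close>; this is differentiability at the origin.\<close>
lemma flat_exp_quotient_tendsto_0: "((\<lambda>t. flat_exp n t / t) \<longlongrightarrow> 0) (at 0)"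
proof -
  have "((\<lambda>s::real. s ^ Suc n / exp s) \<longlongrightarrow> 0) at_top"
    by (rule tendsto_power_div_exp_0)
  then have "((\<lambda>t::real. inverse t ^ Suc n / exp (inverse t)) \<longlongrightarrow> 0) (at_right 0)"
    by (rule filterlim_compose[OF _ filterlim_inverse_at_top_right])
  then have r: "((\<lambda>t. flat_exp n t / t) \<longlongrightarrow> 0) (at_right 0)"
    by (rule Lim_transform_eventually)
      (auto simp: eventually_at_filter flat_exp_def exp_minus field_simps)
  have "((\<lambda>t. flat_exp n t / t) \<longlongrightarrow> 0) (at_left 0)"
    by (rule Lim_transform_eventually[OF tendsto_const])
      (auto simp: eventually_at_filter flat_exp_def)
  with r show ?thesis by (simp add: filterlim_split_at)
qed

lemma flat_exp_has_derivative:
  "(flat_exp n has_real_derivative (flat_exp (n + 2) t - n * flat_exp (n + 1) t)) (at t)"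
proof (cases t "0::real" rule: linorder_cases)
  case less
  have "((\<lambda>_. 0) has_real_derivative 0) (at t)" by simp
  then have "(flat_exp n has_real_derivative 0) (at t)"
    by (rule has_field_derivative_transform_within_open[where S="{..<0}"])
      (use less in \<open>auto simp: flat_exp_def\<close>)
  then show ?thesis using less by (simp add: flat_exp_def)
next
  case equal
  then show ?thesis using flat_exp_quotient_tendsto_0[of n]
    by (simp add: has_field_derivative_iff flat_exp_def)
next
  case greater
  have "((\<lambda>t. inverse t ^ n * exp (- inverse t)) has_real_derivative
     (flat_exp (n + 2) t - n * flat_exp (n + 1) t)) (at t)"
  proof -
    have i: "(inverse has_real_derivative - (inverse t ^ Suc (Suc 0))) (at t)"
      using greater by (intro DERIV_inverse) auto
    have "((\<lambda>t. exp (- inverse t)) has_real_derivative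
        exp (- inverse t) * - (- (inverse t ^ Suc (Suc 0)))) (at t)"
      by (rule DERIV_chain2[OF DERIV_exp DERIV_minus[OF i]])
    from DERIV_mult[OF DERIV_power[OF i, of n] this] show ?thesis
      by (rule DERIV_cong) (use greater in \<open>cases n; simp add: flat_exp_def algebra_simps\<close>)
  qed
  then show ?thesis
    by (rule has_field_derivative_transform_within_open[where S="{0<..}"])
      (use greater in \<open>auto simp: flat_exp_def\<close>)
qed

lemma smooth_on_flat_exp: "smooth_on UNIV (flat_exp n)"
proof -
  have "C_k_on k UNIV (flat_exp n)" for k
  proof (induction k arbitrary: n)
    case 0
    then show ?case
      by (auto intro!: continuous_at_imp_continuous_on DERIV_isCont flat_exp_has_derivative)
  next
    case (Suc k)
    have "C_k_on k UNIV (\<lambda>x. v *\<^sub>R (flat_exp (n + 2) x + (- real n) *\<^sub>R flat_exp (n + 1) x))" for v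
      by (intro C_k_on_scaleR C_k_on_add Suc C_k_on_const open_UNIV)
    then have "C_k_on k UNIV (\<lambda>x. (flat_exp (n + 2) x - n * flat_exp (n + 1) x) * v)" for v
      by (simp add: mult.commute)
    then show ?case
      using flat_exp_has_derivative[of n] unfolding has_field_derivative_def
      by (intro C_k_on_SucI[where f'="\<lambda>x v. (flat_exp (n + 2) x - n * flat_exp (n + 1) x) * v"]) auto
  qed
  then show ?thesis by (simp add: smooth_on_def)
qed

text \<open>The denominator is positive everywhere, because \<open>t\<close> and \<open>1 - t\<close> are not both negative or zero.\<close>
definition plateau :: "real \<Rightarrow> real" where
  "plateau t = flat_exp 0 t * inverse (flat_exp 0 t + flat_exp 0 (1 - t))"

lemma plateau_values: "t \<le> 0 \<Longrightarrow> plateau t = 0" "1 \<le> t \<Longrightarrow> plateau t = 1"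
  by (auto simp: plateau_def flat_exp_def)

lemma smooth_on_plateau: "smooth_on UNIV plateau"
proof -
  have "smooth_on UNIV (\<lambda>t::real. 1 - t)"
    by (intro smooth_on_diff smooth_on_const smooth_on_linear) auto
  then have 1: "smooth_on UNIV (\<lambda>t. flat_exp 0 t + flat_exp 0 (1 - t))"
    using smooth_on_compose[OF _ _ _ _ smooth_on_flat_exp[of 0], of UNIV "\<lambda>t. 1 - t"]
    by (auto intro!: smooth_on_add smooth_on_flat_exp)
  have "flat_exp 0 t + flat_exp 0 (1 - t) > 0" for t
    by (cases "t > 0") (auto simp: flat_exp_def add_pos_nonneg)
  then have "(\<lambda>t. flat_exp 0 t + flat_exp 0 (1 - t)) ` UNIV \<subseteq> - {0}"
    by (auto simp: less_le)
  with 1 have "smooth_on UNIV (\<lambda>t. inverse (flat_exp 0 t + flat_exp 0 (1 - t)))"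
    by (intro smooth_on_compose[OF _ _ _ _ smooth_on_inverse]) auto
  then show ?thesis
    unfolding plateau_def[abs_def] by (intro smooth_on_mult smooth_on_flat_exp) auto
qed

text \<open>Compose the plateau function with an affine function of the squared distance from \<open>a\<close>.\<close>
lemma euclidean_cutoff:
  fixes a :: "'e::euclidean_space"
  assumes "open T" "a \<in> T"
  obtains \<rho> :: "'e \<Rightarrow> real" and K N
  where "smooth_on UNIV \<rho>" "compact K" "K \<subseteq> T" "\<And>x. x \<notin> K \<Longrightarrow> \<rho> x = 0"
    "open N" "a \<in> N" "N \<subseteq> K" "\<And>x. x \<in> N \<Longrightarrow> \<rho> x = 1"
proof -
  obtain r where r: "r > 0" "cball a r \<subseteq> T" using assms unfolding open_contains_cball by blast
  \<comment> \<open>\<open>2 - q x\<close> is at least 1 for distances up to \<open>r / 2\<close> and at most 0 from distance \<open>r\<close> on.\<close>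
  define q where "q = (\<lambda>x. (x - a) \<bullet> (x - a) * (2 / r\<^sup>2))"
  define \<rho> where "\<rho> = (\<lambda>x. plateau (2 - q x))"
  have "q = (\<lambda>x. (\<Sum>b\<in>Basis. ((x \<bullet> b) - (a \<bullet> b)) * ((x \<bullet> b) - (a \<bullet> b))) * (2 / r\<^sup>2))"
    unfolding q_def by (subst euclidean_inner) (simp only: inner_diff_left)
  moreover have "smooth_on UNIV (\<lambda>x. (\<Sum>b\<in>Basis. ((x \<bullet> b) - (a \<bullet> b)) * ((x \<bullet> b) - (a \<bullet> b))) * (2 / r\<^sup>2))"
    by (rule smooth_on_mult smooth_on_sum smooth_on_diff smooth_on_const smooth_on_linear
        bounded_linear_inner_left open_UNIV)+
  ultimately have "smooth_on UNIV q" by simp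
  then have "smooth_on UNIV (\<lambda>x. 2 - q x)" by (intro smooth_on_diff smooth_on_const) auto
  then have 1: "smooth_on UNIV \<rho>"
    unfolding \<rho>_def by (intro smooth_on_compose[OF _ _ _ _ smooth_on_plateau]) auto
  have q: "q x = 2 * (dist a x / r)\<^sup>2" for x
    using r by (simp add: q_def dist_norm norm_minus_commute power_divide flip: power2_norm_eq_inner)
  have "\<rho> x = 0" if "x \<notin> cball a r" for x
  proof -
    have "1 \<le> dist a x / r" using that r by (simp add: field_simps)
    then have "1 \<le> (dist a x / r)\<^sup>2" by (simp add: one_le_power)
    then show ?thesis by (simp add: \<rho>_def q plateau_values)
  qed
  moreover have "\<rho> x = 1" if "x \<in> ball a (r / 2)" for x
  proof -
    have "dist a x / r \<le> 1 / 2" using that r by (simp add: field_simps)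
    then have "(dist a x / r)\<^sup>2 \<le> (1 / 2)\<^sup>2" using r by (intro power_mono) auto
    moreover have "(1 / 2 :: real)\<^sup>2 = 1 / 4" by (simp add: power2_eq_square)
    ultimately have "1 \<le> 2 - q x" unfolding q by linarith
    then show ?thesis by (simp add: \<rho>_def plateau_values)
  qed
  moreover have "ball a (r / 2) \<subseteq> cball a r" using r by auto
  ultimately show thesis using 1 r that[of \<rho> "cball a r" "ball a (r/2)"] by auto
qed

section \<open>First order Taylor expansion with smooth coefficients\<close>

text \<open>The weight makes the family stable under differentiation in the end point:
  each derivative raises the exponent by one.\<close>
definition ray_integral :: "nat \<Rightarrow> 'e::euclidean_space \<Rightarrow> ('e \<Rightarrow> real) \<Rightarrow> 'e \<Rightarrow> real" where
  "ray_integral n a G y = integral (cbox 0 1) (\<lambda>t. t ^ n * G (a + t *\<^sub>R (y - a)))"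

lemma ray_in_ball:
  fixes a :: "'e::real_normed_vector"
  assumes "y \<in> ball a r" "t \<in> cbox 0 (1::real)"
  shows "a + t *\<^sub>R (y - a) \<in> ball a r"
proof -
  have "norm (t *\<^sub>R (y - a)) \<le> 1 * norm (y - a)"
    using assms by (simp add: mult_left_le_one_le)
  then show ?thesis using assms(1) by (simp add: dist_norm norm_minus_commute)
qed

lemma ray_continuous_on:
  fixes G :: "'e::euclidean_space \<Rightarrow> real"
  assumes "continuous_on (ball a r) G"
  shows "continuous_on (ball a r \<times> cbox 0 1) (\<lambda>(y, t::real). t ^ n * G (a + t *\<^sub>R (y - a)))"
proof -
  have "continuous_on (ball a r \<times> cbox 0 1) (\<lambda>x. G (a + snd x *\<^sub>R (fst x - a)))"
    by (rule continuous_on_compose2[OF assms])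
      (force intro!: continuous_intros ray_in_ball simp del: mem_ball box_real)+
  then show ?thesis by (auto simp: split_beta intro!: continuous_intros)
qed

lemma ray_integrable:
  fixes G :: "'e::euclidean_space \<Rightarrow> real"
  assumes "continuous_on (ball a r) G" "y \<in> ball a r"
  shows "(\<lambda>t::real. t ^ n * G (a + t *\<^sub>R (y - a))) integrable_on cbox 0 1"
proof -
  have "continuous_on (cbox 0 1) (\<lambda>t::real. (\<lambda>(y, t). t ^ n * G (a + t *\<^sub>R (y - a))) (y, t))"
    by (rule continuous_on_compose2[OF ray_continuous_on[OF assms(1)]])
      (use assms(2) in \<open>auto intro!: continuous_intros\<close>)
  then show ?thesis by (intro integrable_continuous) simp
qed

text \<open>Differentiation under the integral sign; the chain rule brings out one more factor \<open>t\<close>.\<close>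
lemma ray_integral_has_derivative:
  fixes G :: "'e::euclidean_space \<Rightarrow> real"
  assumes G: "\<And>x. x \<in> ball a r \<Longrightarrow> (G has_derivative frechet_derivative G (at x)) (at x)"
    and cont: "\<And>v. continuous_on (ball a r) (\<lambda>x. frechet_derivative G (at x) v)"
    and y: "y \<in> ball a r"
  shows "(ray_integral n a G has_derivative
    (\<lambda>v. \<Sum>b\<in>Basis. (v \<bullet> b) * ray_integral (Suc n) a (\<lambda>x. frechet_derivative G (at x) b) y)) (at y)"
proof -
  let ?D = "\<lambda>b x. frechet_derivative G (at x) b"
  \<comment> \<open>The derivative of the integrand as a continuous family of bounded linear maps.\<close>
  define B where "B = (\<lambda>y t. \<Sum>b\<in>Basis. (t ^ Suc n * ?D b (a + t *\<^sub>R (y - a))) *\<^sub>R blinfun_inner_left (b::'e))"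
  have contG: "continuous_on (ball a r) G"
    using G by (intro continuous_at_imp_continuous_on ballI has_derivative_continuous) auto
  have contB: "continuous_on (ball a r \<times> cbox 0 1) (\<lambda>(y, t). B y t)"
    unfolding B_def split_beta
    by (intro continuous_intros ray_continuous_on[OF cont, unfolded split_beta])
  have B: "blinfun_apply (B y t) v = t ^ n * ?D (t *\<^sub>R v) (a + t *\<^sub>R (y - a))"
    if "y \<in> ball a r" "t \<in> cbox 0 1" for y t v
  proof -
    let ?x = "a + t *\<^sub>R (y - a)"
    have lin: "linear (frechet_derivative G (at ?x))"
      using G[OF ray_in_ball[OF that]] by (simp add: bounded_linear.linear has_derivative_bounded_linear)
    have "?D v ?x = ?D (\<Sum>b\<in>Basis. (v \<bullet> b) *\<^sub>R b) ?x" by (simp add: euclidean_representation)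
    also have "\<dots> = (\<Sum>b\<in>Basis. (v \<bullet> b) * ?D b ?x)" by (simp add: linear_sum[OF lin] linear_scale[OF lin])
    finally show ?thesis
      by (simp add: B_def blinfun.sum_left blinfun.scaleR_left linear_scale[OF lin] sum_distrib_left mult_ac)
  qed
  have der: "((\<lambda>y. t ^ n * G (a + t *\<^sub>R (y - a))) has_derivative blinfun_apply (B y t)) (at y within ball a r)"
    if "y \<in> ball a r" "t \<in> cbox 0 1" for y t
  proof -
    have "((\<lambda>y. G (a + t *\<^sub>R (y - a))) has_derivative (\<lambda>v. ?D (t *\<^sub>R v) (a + t *\<^sub>R (y - a)))) (at y)"
      by (rule has_derivative_compose[where f="\<lambda>y. a + t *\<^sub>R (y - a)", OF _ G[OF ray_in_ball[OF that]]])
        (auto intro!: derivative_eq_intros)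
    then have "((\<lambda>y. t ^ n * G (a + t *\<^sub>R (y - a))) has_derivative
        (\<lambda>v. t ^ n * ?D (t *\<^sub>R v) (a + t *\<^sub>R (y - a)))) (at y within ball a r)"
      by (rule has_derivative_at_withinI[OF has_derivative_mult_right])
    then show ?thesis by (rule has_derivative_eq_rhs) (use B that in auto)
  qed
  have int: "(\<lambda>t. t ^ n * G (a + t *\<^sub>R (y - a))) integrable_on cbox 0 1" if "y \<in> ball a r" for y
    by (rule ray_integrable[OF contG that])
  have intb: "(\<lambda>t. t ^ Suc n * ?D b (a + t *\<^sub>R (y - a))) integrable_on cbox 0 1" for b
    by (rule ray_integrable[OF cont y])
  have intB: "B y integrable_on cbox 0 1"
  proof -
    have "continuous_on (cbox 0 1) (\<lambda>t::real. (\<lambda>(y, t). B y t) (y, t))"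
      by (rule continuous_on_compose2[OF contB]) (use y in \<open>auto intro!: continuous_intros\<close>)
    then show ?thesis by (intro integrable_continuous) simp
  qed
  have "(ray_integral n a G has_derivative blinfun_apply (integral (cbox 0 1) (B y))) (at y within ball a r)"
    unfolding ray_integral_def[abs_def] by (rule leibniz_rule[OF der int contB y]) auto
  then have "(ray_integral n a G has_derivative blinfun_apply (integral (cbox 0 1) (B y))) (at y)"
    using y by (simp add: at_within_open[OF y open_ball])
  moreover have "blinfun_apply (integral (cbox 0 1) (B y)) v =
      (\<Sum>b\<in>Basis. (v \<bullet> b) * ray_integral (Suc n) a (?D b) y)" for v
  proof -
    have "blinfun_apply (integral (cbox 0 1) (B y)) v = integral (cbox 0 1) (\<lambda>t. blinfun_apply (B y t) v)"
      by (rule blinfun_apply_integral[OF intB])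
    also have "\<dots> = integral (cbox 0 1) (\<lambda>t. \<Sum>b\<in>Basis. (v \<bullet> b) * (t ^ Suc n * ?D b (a + t *\<^sub>R (y - a))))"
      by (simp add: B_def blinfun.sum_left blinfun.scaleR_left mult_ac)
    also have "\<dots> = (\<Sum>b\<in>Basis. integral (cbox 0 1) (\<lambda>t. (v \<bullet> b) * (t ^ Suc n * ?D b (a + t *\<^sub>R (y - a)))))"
      by (intro integral_sum finite_Basis integrable_on_mult_right intb)
    also have "\<dots> = (\<Sum>b\<in>Basis. (v \<bullet> b) * ray_integral (Suc n) a (?D b) y)"
      unfolding ray_integral_def by (intro sum.cong refl integral_mult_right)
    finally show ?thesis .
  qed
  then have "blinfun_apply (integral (cbox 0 1) (B y)) =
      (\<lambda>v. \<Sum>b\<in>Basis. (v \<bullet> b) * ray_integral (Suc n) a (?D b) y)" by (rule ext)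
  ultimately show ?thesis by (rule has_derivative_eq_rhs)
qed

lemma smooth_on_ray_integral:
  assumes "smooth_on (ball a r) G"
  shows "smooth_on (ball a r) (ray_integral n a G)"
proof -
  have "C_k_on k (ball a r) (ray_integral n a G)" for k
    using assms
  proof (induction k arbitrary: n G)
    case 0
    then show ?case unfolding ray_integral_def[abs_def] C_k_on.simps
      by (intro integral_continuous_on_param ray_continuous_on smooth_on_continuous_on)
  next
    case (Suc k)
    have "C_k_on k (ball a r)
        (\<lambda>x. \<Sum>b\<in>Basis. (v \<bullet> b) *\<^sub>R ray_integral (Suc n) a (\<lambda>x. frechet_derivative G (at x) b) x)" for v
      by (intro C_k_on_sum C_k_on_scaleR C_k_on_const Suc.IH smooth_on_frechet_derivative Suc.prems open_ball)
    then show ?case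
      by (intro C_k_on_SucI[OF open_ball ray_integral_has_derivative[OF smooth_on_has_derivative[OF Suc.prems]
          smooth_on_continuous_on[OF smooth_on_frechet_derivative[OF Suc.prems]]]]) auto
  qed
  then show ?thesis by (simp add: smooth_on_def)
qed

text \<open>Hadamard's lemma: integrate the derivative of G along the segment from the centre.\<close>
lemma hadamard:
  fixes G :: "'e::euclidean_space \<Rightarrow> real"
  assumes G: "smooth_on (ball a r) G"
  obtains g where "\<And>b. smooth_on (ball a r) (g b)"
    "\<And>b. g b a = frechet_derivative G (at a) b"
    "\<And>y. y \<in> ball a r \<Longrightarrow> G y = G a + (\<Sum>b\<in>Basis. ((y - a) \<bullet> b) * g b y)"
proof
  let ?D = "\<lambda>b x. frechet_derivative G (at x) b"
  let ?g = "\<lambda>b. ray_integral 0 a (?D b)"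
  show "smooth_on (ball a r) (?g b)" for b
    by (intro smooth_on_ray_integral smooth_on_frechet_derivative G)
  show "?g b a = ?D b a" for b by (simp add: ray_integral_def)
  fix y assume y: "y \<in> ball a r"
  let ?F = "\<lambda>t. \<Sum>b\<in>Basis. ((y - a) \<bullet> b) * (t ^ 0 * ?D b (a + t *\<^sub>R (y - a)))"
  have F: "((\<lambda>t. G (a + t *\<^sub>R (y - a))) has_vector_derivative ?F t) (at t within {0..1})"
    if "t \<in> {0..1}" for t
  proof -
    let ?x = "a + t *\<^sub>R (y - a)"
    have DG: "(G has_derivative (\<lambda>b. ?D b ?x)) (at ?x)"
      using smooth_on_has_derivative[OF G ray_in_ball[OF y]] that by auto
    then have lin: "linear (\<lambda>b. ?D b ?x)"
      by (simp add: bounded_linear.linear has_derivative_bounded_linear)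
    have "?D (y - a) ?x = ?D (\<Sum>b\<in>Basis. ((y - a) \<bullet> b) *\<^sub>R b) ?x"
      by (simp add: euclidean_representation)
    also have "\<dots> = ?F t" by (simp add: linear_sum[OF lin] linear_scale[OF lin])
    finally have *: "?D (s *\<^sub>R (y - a)) ?x = s *\<^sub>R ?F t" for s
      by (simp add: linear_scale[OF lin])
    have "((\<lambda>t. G (a + t *\<^sub>R (y - a))) has_derivative (\<lambda>s. ?D (s *\<^sub>R (y - a)) ?x)) (at t)"
      by (rule has_derivative_compose[where f="\<lambda>t. a + t *\<^sub>R (y - a)", OF _ DG]) (auto intro!: derivative_eq_intros)
    then show ?thesis
      unfolding has_vector_derivative_def * by (rule has_derivative_at_withinI)
  qed
  have intb: "(\<lambda>t. t ^ 0 * ?D b (a + t *\<^sub>R (y - a))) integrable_on cbox 0 1" for b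
    by (rule ray_integrable[OF smooth_on_continuous_on[OF smooth_on_frechet_derivative[OF G]] y])
  have "G y - G a = integral (cbox 0 1) ?F"
    using fundamental_theorem_of_calculus[OF _ F, THEN integral_unique] by simp
  also have "\<dots> = (\<Sum>b\<in>Basis. integral (cbox 0 1) (\<lambda>t. ((y - a) \<bullet> b) * (t ^ 0 * ?D b (a + t *\<^sub>R (y - a)))))"
    by (intro integral_sum finite_Basis integrable_on_mult_right intb)
  also have "\<dots> = (\<Sum>b\<in>Basis. ((y - a) \<bullet> b) * ?g b y)"
    unfolding ray_integral_def by (intro sum.cong refl integral_mult_right)
  finally show "G y = G a + (\<Sum>b\<in>Basis. ((y - a) \<bullet> b) * ?g b y)" by simp
qed

section \<open>The algebra of smooth functions\<close>

lemma sum_fun_apply: "sum F I x = (\<Sum>i\<in>I. F i x)"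
  by (induction I rule: infinite_finite_induct) auto

lemma prod_fun_apply: "prod F I x = (\<Prod>i\<in>I. F i x)"
  by (induction I rule: infinite_finite_induct) auto

locale smooth_manifold =
  fixes A :: "('a::{t2_space,second_countable_topology}, 'e::euclidean_space) atlas"
  assumes atlas: "smooth_atlas A"
begin

lemma chart_at: obtains U c where "(U, c) \<in> A" "p \<in> U"
proof -
  have "p \<in> (\<Union>(U, c)\<in>A. U)" using atlas by (simp add: smooth_atlas_def)
  then show thesis using that by auto
qed

lemma chart:
  assumes "(U, c) \<in> A"
  shows "open U" "open (c ` U)" "continuous_on U c" "continuous_on (c ` U) (inv_into U c)"
    "x \<in> U \<Longrightarrow> inv_into U c (c x) = x"
    "y \<in> c ` U \<Longrightarrow> inv_into U c y \<in> U" "y \<in> c ` U \<Longrightarrow> c (inv_into U c y) = y"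
proof -
  have "\<forall>(U, c)\<in>A. open U \<and> open (c ` U) \<and> homeomorphism U (c ` U) c (inv_into U c)"
    using atlas by (simp add: smooth_atlas_def)
  from bspec[OF this assms] have *: "open U" "open (c ` U)" "homeomorphism U (c ` U) c (inv_into U c)"
    by simp_all
  show "open U" "open (c ` U)" by fact+
  show "continuous_on U c" "continuous_on (c ` U) (inv_into U c)"
    using *(3) by (simp_all add: homeomorphism_def)
  show "x \<in> U \<Longrightarrow> inv_into U c (c x) = x" using *(3) by (simp add: homeomorphism_def)
  show "y \<in> c ` U \<Longrightarrow> inv_into U c y \<in> U" "y \<in> c ` U \<Longrightarrow> c (inv_into U c y) = y"
    by (auto intro: inv_into_into f_inv_into_f)
qed

lemma transition_smooth:
  assumes "(U, c) \<in> A" "(V, d) \<in> A"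
  shows "smooth_on (c ` (U \<inter> V)) (\<lambda>y. d (inv_into U c y))"
proof -
  have "\<forall>(U, c)\<in>A. \<forall>(V, d)\<in>A. smooth_on (c ` (U \<inter> V)) (d \<circ> inv_into U c)"
    using atlas by (simp add: smooth_atlas_def)
  from bspec[OF this assms(1)] assms(2) show ?thesis by (auto simp: comp_def)
qed

lemma open_chart_image:
  assumes "(U, c) \<in> A" "open W"
  shows "open (c ` (U \<inter> W))"
proof -
  note c = chart[OF assms(1)]
  have "c ` (U \<inter> W) = c ` U \<inter> inv_into U c -` W"
    using c(5-7) by (auto simp: image_iff)
  then show ?thesis using continuous_open_preimage[OF c(4,2) assms(2)] by simp
qed

lemma open_chart_preimage:
  assumes "(U, c) \<in> A" "open T"
  shows "open (U \<inter> c -` T)"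
  using chart[OF assms(1)] assms(2) by (auto intro: continuous_open_preimage)

abbreviation sm :: "('a \<Rightarrow> real) set" where "sm \<equiv> smooth_functions A"

lemma sm_chart: "\<phi> \<in> sm \<Longrightarrow> (U, c) \<in> A \<Longrightarrow> smooth_on (c ` U) (\<lambda>y. \<phi> (inv_into U c y))"
  by (auto simp: smooth_functions_def comp_def)

lemma smI: "(\<And>U c. (U, c) \<in> A \<Longrightarrow> smooth_on (c ` U) (\<lambda>y. \<phi> (inv_into U c y))) \<Longrightarrow> \<phi> \<in> sm"
  by (auto simp: smooth_functions_def comp_def)

lemma sm_const: "(\<lambda>_. r) \<in> sm"
  by (intro smI smooth_on_const chart(2))

lemma sm_zero: "0 \<in> sm" and sm_one: "1 \<in> sm"
  using sm_const[of 0] sm_const[of 1] by (simp_all add: zero_fun_def one_fun_def)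

lemma sm_add: "\<phi> \<in> sm \<Longrightarrow> \<psi> \<in> sm \<Longrightarrow> \<phi> + \<psi> \<in> sm"
  by (rule smI, simp only: plus_fun_apply) (assumption | rule smooth_on_add chart(2) sm_chart)+

lemma sm_mult: "\<phi> \<in> sm \<Longrightarrow> \<psi> \<in> sm \<Longrightarrow> \<phi> * \<psi> \<in> sm"
  by (rule smI, simp only: times_fun_apply) (assumption | rule smooth_on_mult chart(2) sm_chart)+

lemma sm_diff: "\<phi> \<in> sm \<Longrightarrow> \<psi> \<in> sm \<Longrightarrow> \<phi> - \<psi> \<in> sm"
  by (rule smI, simp only: minus_apply) (assumption | rule smooth_on_diff chart(2) sm_chart)+

lemma sm_uminus: "\<phi> \<in> sm \<Longrightarrow> - \<phi> \<in> sm"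
  using sm_diff[OF sm_zero] by force

lemma sm_sum: "(\<And>i. i \<in> I \<Longrightarrow> F i \<in> sm) \<Longrightarrow> (\<Sum>i\<in>I. F i) \<in> sm"
  by (induction I rule: infinite_finite_induct) (auto intro: sm_add sm_zero)

lemma sm_prod: "(\<And>i. i \<in> I \<Longrightarrow> F i \<in> sm) \<Longrightarrow> (\<Prod>i\<in>I. F i) \<in> sm"
  by (induction I rule: infinite_finite_induct) (auto intro: sm_mult sm_one)

lemmas sm_intros = sm_const sm_zero sm_one sm_add sm_mult sm_diff sm_uminus sm_sum sm_prod

text \<open>Smoothness is tested in charts near a point, so functions may be glued from local pieces.\<close>
lemma sm_local:
  assumes "\<And>p. \<exists>N \<psi>. open N \<and> p \<in> N \<and> \<psi> \<in> sm \<and> (\<forall>x\<in>N. \<phi> x = \<psi> x)"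
  shows "\<phi> \<in> sm"
proof (intro smI smooth_on_local)
  fix U c y assume U: "(U, c) \<in> A" and y: "y \<in> c ` U"
  note c = chart[OF U]
  obtain N \<psi> where N: "open N" "inv_into U c y \<in> N" "\<psi> \<in> sm" "\<forall>x\<in>N. \<phi> x = \<psi> x"
    using assms by blast
  let ?T = "c ` (U \<inter> N)"
  have T: "open ?T" by (rule open_chart_image[OF U N(1)])
  have "smooth_on ?T (\<lambda>y. \<psi> (inv_into U c y))"
    using sm_chart[OF N(3) U] by (rule smooth_on_subset) auto
  then have "smooth_on ?T (\<lambda>y. \<phi> (inv_into U c y))"
    by (rule smooth_on_cong[OF T, rotated]) (use c(5) N(4) in auto)
  moreover have "y \<in> ?T" using c(6,7)[OF y] N(2) by (auto simp: image_iff intro!: bexI[of _ "inv_into U c y"])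
  ultimately show "\<exists>T. open T \<and> y \<in> T \<and> smooth_on T (\<lambda>y. \<phi> (inv_into U c y))" using T by blast
qed

text \<open>Compactness of the support and the Hausdorff property make the support closed in the manifold, so
  that the function vanishes near every point outside the chart.\<close>
lemma sm_extend_by_zero:
  assumes U: "(U, c) \<in> A" and F: "smooth_on (c ` U) F"
    and K: "compact K" "K \<subseteq> c ` U" and F0: "\<And>y. y \<in> c ` U - K \<Longrightarrow> F y = 0"
  shows "(\<lambda>x. if x \<in> U then F (c x) else 0) \<in> sm" (is "?h \<in> sm")
proof (intro smI smooth_on_local)
  note c = chart[OF U]
  fix V d y assume V: "(V, d) \<in> A" and y: "y \<in> d ` V"
  note d = chart[OF V]
  let ?p = "inv_into V d y"
  show "\<exists>T. open T \<and> y \<in> T \<and> smooth_on T (\<lambda>y. ?h (inv_into V d y))"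
  proof (cases "?p \<in> U")
    case True
    let ?T = "d ` (V \<inter> U)"
    have T: "open ?T" by (rule open_chart_image[OF V c(1)])
    have "smooth_on ?T (\<lambda>y. F (c (inv_into V d y)))"
      by (rule smooth_on_compose[OF T c(2) _ transition_smooth[OF V U] F]) (use d(5) in auto)
    then have "smooth_on ?T (\<lambda>y. ?h (inv_into V d y))"
      by (rule smooth_on_cong[OF T, rotated]) (use d(5) in auto)
    moreover have "y \<in> ?T" using d(6,7)[OF y] True by (auto simp: image_iff intro!: bexI[of _ ?p])
    ultimately show ?thesis using T by blast
  next
    case False
    let ?W = "- (inv_into U c ` K)"
    have "compact (inv_into U c ` K)"
      using compact_continuous_image[OF continuous_on_subset[OF c(4) K(2)] K(1)] .
    then have W: "open ?W" by (simp add: compact_imp_closed open_Compl)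
    let ?T = "d ` (V \<inter> ?W)"
    have T: "open ?T" by (rule open_chart_image[OF V W])
    have h0: "F (c x) = 0" if "x \<in> ?W" "x \<in> U" for x
      using that F0[of "c x"] c(5)[of x] by (cases "c x \<in> K") (force simp: image_iff)+
    have "smooth_on ?T (\<lambda>y. ?h (inv_into V d y))"
    proof (rule smooth_on_cong[OF T _ smooth_on_const[OF T, of 0]])
      fix z assume "z \<in> ?T"
      then obtain x where "x \<in> V" "x \<in> ?W" "z = d x" by blast
      then show "0 = ?h (inv_into V d z)" using h0[of x] d(5)[of x] by simp
    qed
    moreover have "?p \<in> ?W" using False c(6) K(2) by auto
    then have "y \<in> ?T" using d(6,7)[OF y] by (auto simp: image_iff intro!: bexI[of _ ?p])
    ultimately show ?thesis using T by blast
  qed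
qed

lemma bump:
  assumes "open W" "p \<in> W"
  obtains \<beta> N where "\<beta> \<in> sm" "open N" "p \<in> N" "N \<subseteq> W" "\<And>x. x \<in> N \<Longrightarrow> \<beta> x = 1"
    "\<And>x. x \<notin> W \<Longrightarrow> \<beta> x = 0"
proof -
  obtain U c where U: "(U, c) \<in> A" and p: "p \<in> U" by (rule chart_at)
  note c = chart[OF U]
  have "open (c ` (U \<inter> W))" by (rule open_chart_image[OF U assms(1)])
  from euclidean_cutoff[OF this, of "c p"] p assms(2)
  obtain \<rho> K N where \<rho>: "smooth_on UNIV \<rho>" "compact K" "K \<subseteq> c ` (U \<inter> W)" "\<And>x. x \<notin> K \<Longrightarrow> \<rho> x = 0"
    and N: "open N" "c p \<in> N" "N \<subseteq> K" "\<And>x. x \<in> N \<Longrightarrow> \<rho> x = (1::real)" by blast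
  have K: "x \<in> W" if "x \<in> U" "c x \<in> K" for x
  proof -
    from that \<rho>(3) obtain x' where "x' \<in> U \<inter> W" "c x = c x'" by auto
    then show ?thesis using c(5) that(1) by (metis IntD1 IntD2)
  qed
  show thesis
  proof
    show "(\<lambda>x. if x \<in> U then \<rho> (c x) else 0) \<in> sm"
      using \<rho> by (intro sm_extend_by_zero[OF U, of _ K]) (auto intro: smooth_on_subset)
    show "open (U \<inter> c -` N)" by (rule open_chart_preimage[OF U N(1)])
  qed (use p N K \<rho>(4) in auto)
qed

text \<open>Near \<open>p\<close> every smooth function of the coordinates is the restriction of a global smooth function; this
  turns local constructions into arguments of derivations, which act on global functions only.\<close>
lemma sm_extend_germ:
  assumes U: "(U, c) \<in> A" and p: "p \<in> U"
    and T: "open T" "T \<subseteq> c ` U" "c p \<in> T" and G: "smooth_on T G"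
  obtains \<psi> N where "\<psi> \<in> sm" "open N" "p \<in> N" "N \<subseteq> U" "\<And>x. x \<in> N \<Longrightarrow> \<psi> x = G (c x)"
proof -
  note c = chart[OF U]
  from euclidean_cutoff[OF T(1,3)]
  obtain \<rho> K N where \<rho>: "smooth_on UNIV \<rho>" "compact K" "K \<subseteq> T" "\<And>x. x \<notin> K \<Longrightarrow> \<rho> x = 0"
    and N: "open N" "c p \<in> N" "N \<subseteq> K" "\<And>x. x \<in> N \<Longrightarrow> \<rho> x = (1::real)" by blast
  define F where "F = (\<lambda>y. if y \<in> T then \<rho> y * G y else 0)"
  have "smooth_on (c ` U) F"
  proof (rule smooth_on_local)
    fix y assume "y \<in> c ` U"
    show "\<exists>T. open T \<and> y \<in> T \<and> smooth_on T F"
    proof (cases "y \<in> T")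
      case True
      have "smooth_on T (\<lambda>y. \<rho> y * G y)"
        by (intro smooth_on_mult T G smooth_on_subset[OF \<rho>(1)]) auto
      then have "smooth_on T F" by (rule smooth_on_cong[OF T(1), rotated]) (auto simp: F_def)
      with T(1) True show ?thesis by blast
    next
      case False
      have K: "open (- K)" using \<rho>(2) by (simp add: compact_imp_closed open_Compl)
      have "smooth_on (- K) F"
        by (rule smooth_on_cong[OF K _ smooth_on_const[OF K, of 0]]) (auto simp: F_def \<rho>(4))
      with False \<rho>(3) K show ?thesis by blast
    qed
  qed
  then have "(\<lambda>x. if x \<in> U then F (c x) else 0) \<in> sm"
    using \<rho> T(2) by (intro sm_extend_by_zero[OF U, of _ K]) (auto simp: F_def)
  then show thesis
    by (rule that[of _ "U \<inter> c -` N"]) (use open_chart_preimage[OF U N(1)] p N \<rho>(3) in \<open>auto simp: F_def\<close>)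
qed

section \<open>Vector fields as derivations, and coordinate frames\<close>

abbreviation VF :: "'a vector_field set" where "VF \<equiv> vector_fields A"

lemma VF_D:
  assumes "X \<in> VF"
  shows "\<phi> \<in> sm \<Longrightarrow> X \<phi> \<in> sm"
    and "\<phi> \<notin> sm \<Longrightarrow> X \<phi> = 0"
    and "\<phi> \<in> sm \<Longrightarrow> \<psi> \<in> sm \<Longrightarrow> X (\<phi> + \<psi>) = X \<phi> + X \<psi>"
    and "\<phi> \<in> sm \<Longrightarrow> X ((\<lambda>_. r) * \<phi>) = (\<lambda>_. r) * X \<phi>"
    and "\<phi> \<in> sm \<Longrightarrow> \<psi> \<in> sm \<Longrightarrow> X (\<phi> * \<psi>) = \<phi> * X \<psi> + \<psi> * X \<phi>"
  using assms unfolding vector_fields_def by blast+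

lemma VF_I:
  assumes "\<And>\<phi>. \<phi> \<in> sm \<Longrightarrow> X \<phi> \<in> sm"
    and "\<And>\<phi>. \<phi> \<notin> sm \<Longrightarrow> X \<phi> = 0"
    and "\<And>\<phi> \<psi>. \<phi> \<in> sm \<Longrightarrow> \<psi> \<in> sm \<Longrightarrow> X (\<phi> + \<psi>) = X \<phi> + X \<psi>"
    and "\<And>\<phi> r. \<phi> \<in> sm \<Longrightarrow> X ((\<lambda>_. r) * \<phi>) = (\<lambda>_. r) * X \<phi>"
    and "\<And>\<phi> \<psi>. \<phi> \<in> sm \<Longrightarrow> \<psi> \<in> sm \<Longrightarrow> X (\<phi> * \<psi>) = \<phi> * X \<psi> + \<psi> * X \<phi>"
  shows "X \<in> VF"
  using assms unfolding vector_fields_def by blast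

lemma VF_eqI:
  assumes "X \<in> VF" "Y \<in> VF" "\<And>\<phi> p. \<phi> \<in> sm \<Longrightarrow> X \<phi> p = Y \<phi> p"
  shows "X = Y"
proof
  fix \<phi> show "X \<phi> = Y \<phi>"
    using assms VF_D(2)[OF assms(1)] VF_D(2)[OF assms(2)] by (cases "\<phi> \<in> sm") auto
qed

lemma VF_zero: "0 \<in> VF"
  by (rule VF_I) (auto intro: sm_intros)

lemma VF_add: "X \<in> VF \<Longrightarrow> Y \<in> VF \<Longrightarrow> X + Y \<in> VF"
  by (rule VF_I) (simp_all add: VF_D sm_intros, simp_all add: fun_eq_iff algebra_simps)

lemma VF_diff: "X \<in> VF \<Longrightarrow> Y \<in> VF \<Longrightarrow> X - Y \<in> VF"
  by (rule VF_I) (simp_all add: VF_D sm_intros, simp_all add: fun_eq_iff algebra_simps)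

lemma VF_scale: "\<phi> \<in> sm \<Longrightarrow> X \<in> VF \<Longrightarrow> \<phi> \<odot> X \<in> VF"
  by (rule VF_I) (simp_all add: VF_D fscale_def sm_intros, simp_all add: fun_eq_iff algebra_simps)

lemma VF_sum: "(\<And>i. i \<in> I \<Longrightarrow> F i \<in> VF) \<Longrightarrow> (\<Sum>i\<in>I. F i) \<in> VF"
  by (induction I rule: infinite_finite_induct) (auto intro: VF_zero VF_add)

lemma VF_const:
  assumes X: "X \<in> VF"
  shows "X (\<lambda>_. r) = 0"
proof -
  have "X (1 * 1) = 1 * X 1 + 1 * X 1" by (intro VF_D[OF X] sm_one)
  then have "X 1 = 0" by simp
  with VF_D(4)[OF X sm_one, of r] show ?thesis by (simp add: times_fun_def one_fun_def zero_fun_def)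
qed

lemma VF_fun_zero: "X \<in> VF \<Longrightarrow> X 0 = 0"
  using VF_const[of X 0] by (simp add: zero_fun_def)

lemma VF_fun_diff:
  assumes "X \<in> VF" "\<phi> \<in> sm" "\<psi> \<in> sm"
  shows "X (\<phi> - \<psi>) = X \<phi> - X \<psi>"
  using VF_D(3)[OF assms(1) sm_diff[OF assms(2,3)] assms(3)] by (simp add: algebra_simps)

lemma VF_fun_sum:
  assumes "X \<in> VF" "\<And>i. i \<in> I \<Longrightarrow> F i \<in> sm"
  shows "X (\<Sum>i\<in>I. F i) = (\<Sum>i\<in>I. X (F i))"
  using assms(2)
  by (induction I rule: infinite_finite_induct) (auto simp: VF_fun_zero VF_D(3) sm_sum assms(1))

text \<open>Derivations are local: multiply the difference of the two functions by a bump function and apply the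
  Leibniz rule.\<close>
lemma VF_germ:
  assumes X: "X \<in> VF" and sm: "\<phi> \<in> sm" "\<psi> \<in> sm"
    and N: "open N" "p \<in> N" "\<And>x. x \<in> N \<Longrightarrow> \<phi> x = \<psi> x"
  shows "X \<phi> p = X \<psi> p"
proof -
  obtain \<beta> N' where \<beta>: "\<beta> \<in> sm" "p \<in> N'" "\<And>x. x \<in> N' \<Longrightarrow> \<beta> x = 1" "\<And>x. x \<notin> N \<Longrightarrow> \<beta> x = 0"
    using bump[OF N(1,2)] by metis
  let ?d = "\<phi> - \<psi>"
  have "\<beta> * ?d = 0"
  proof
    fix x show "(\<beta> * ?d) x = 0 x" using N(3)[of x] \<beta>(4)[of x] by (cases "x \<in> N") auto
  qed
  then have "X 0 = \<beta> * X ?d + ?d * X \<beta>"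
    using VF_D(5)[OF X \<beta>(1) sm_diff[OF sm]] by simp
  from fun_cong[OF this, of p] have "X ?d p = 0"
    using VF_fun_zero[OF X] \<beta>(2,3) N(2,3) by simp
  then show ?thesis by (simp add: VF_fun_diff[OF X sm])
qed

text \<open>In a chart a derivation is a directional derivative at every point: expand a smooth function by
  Hadamard's lemma, and observe that the Leibniz rule kills everything but the linear part.\<close>
lemma coordinate_frame:
  assumes U: "(U, c) \<in> A" and p: "p \<in> U"
  obtains N x E where "open N" "p \<in> N" "N \<subseteq> U"
    and "\<And>b. x b \<in> sm" "\<And>b q. q \<in> N \<Longrightarrow> x b q = c q \<bullet> b"
    and "\<And>v. E v \<in> VF"
    and "\<And>v \<phi> q. \<phi> \<in> sm \<Longrightarrow> q \<in> N \<Longrightarrow>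
      E v \<phi> q = frechet_derivative (\<lambda>y. \<phi> (inv_into U c y)) (at (c q)) v"
    and "\<And>X \<phi> q. X \<in> VF \<Longrightarrow> \<phi> \<in> sm \<Longrightarrow> q \<in> N \<Longrightarrow>
      X \<phi> q = frechet_derivative (\<lambda>y. \<phi> (inv_into U c y)) (at (c q)) (\<Sum>b\<in>Basis. X (x b) q *\<^sub>R b)"
proof -
  note c = chart[OF U]
  from euclidean_cutoff[OF c(2), of "c p"] p
  obtain \<rho> K N where \<rho>: "smooth_on UNIV \<rho>" "compact K" "K \<subseteq> c ` U" "\<And>x. x \<notin> K \<Longrightarrow> \<rho> x = 0"
    and N: "open N" "c p \<in> N" "N \<subseteq> K" "\<And>x. x \<in> N \<Longrightarrow> \<rho> x = (1::real)" by blast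
  let ?N = "U \<inter> c -` N"
  have oN: "open ?N" by (rule open_chart_preimage[OF U N(1)])
  have \<rho>U: "smooth_on (c ` U) \<rho>" using \<rho>(1) by (rule smooth_on_subset) simp
  define x where "x = (\<lambda>b p. if p \<in> U then \<rho> (c p) * (c p \<bullet> b) else 0)"
  have x: "x b \<in> sm" for b
    unfolding x_def using \<rho> by (intro sm_extend_by_zero[OF U, of _ K] smooth_on_mult c \<rho>U
        smooth_on_linear bounded_linear_inner_left) auto
  have xN: "x b q = c q \<bullet> b" if "q \<in> ?N" for b q using that N by (auto simp: x_def)
  define D :: "'e \<Rightarrow> ('a \<Rightarrow> real) \<Rightarrow> 'a \<Rightarrow> real"
    where "D = (\<lambda>v \<phi> q. frechet_derivative (\<lambda>y. \<phi> (inv_into U c y)) (at (c q)) v)"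
  define E where "E = (\<lambda>v \<phi>. if \<phi> \<in> sm then (\<lambda>q. if q \<in> U then \<rho> (c q) * D v \<phi> q else 0) else 0)"
  have der: "((\<lambda>y. \<phi> (inv_into U c y)) has_derivative (\<lambda>v. D v \<phi> q)) (at (c q))"
    if "\<phi> \<in> sm" "q \<in> U" for \<phi> q
    unfolding D_def using smooth_on_has_derivative[OF sm_chart[OF that(1) U]] that by simp
  have D: "D v \<phi> q = D' v" if "q \<in> U" "((\<lambda>y. \<phi> (inv_into U c y)) has_derivative D') (at (c q))"
    for v \<phi> q D' unfolding D_def using frechet_derivative_at[OF that(2)] by simp
  have E: "E v \<in> VF" for v
  proof (rule VF_I)
    fix \<phi> \<psi> assume \<phi>: "\<phi> \<in> sm"
    show "E v \<phi> \<in> sm"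
    proof -
      have "(\<lambda>q. if q \<in> U then \<rho> (c q) * frechet_derivative (\<lambda>y. \<phi> (inv_into U c y)) (at (c q)) v else 0) \<in> sm"
        using \<rho> by (intro sm_extend_by_zero[OF U, of _ K] smooth_on_mult c \<rho>U smooth_on_frechet_derivative
            sm_chart \<phi> U) auto
      then show ?thesis using \<phi> unfolding E_def D_def by simp
    qed
    show "E v ((\<lambda>_. r) * \<phi>) = (\<lambda>_. r) * E v \<phi>" for r
    proof -
      have "D v ((\<lambda>_. r) * \<phi>) q = r * D v \<phi> q" if "q \<in> U" for q
        using has_derivative_mult_right[OF der[OF \<phi> that], of r] by (intro D that) simp
      then show ?thesis using \<phi> by (auto simp: E_def fun_eq_iff sm_intros)
    qed
    assume \<psi>: "\<psi> \<in> sm"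
    show "E v (\<phi> + \<psi>) = E v \<phi> + E v \<psi>"
    proof -
      have "D v (\<phi> + \<psi>) q = D v \<phi> q + D v \<psi> q" if "q \<in> U" for q
        using has_derivative_add[OF der[OF \<phi> that] der[OF \<psi> that]] by (intro D that) simp
      then show ?thesis using \<phi> \<psi> by (auto simp: E_def fun_eq_iff sm_intros algebra_simps)
    qed
    show "E v (\<phi> * \<psi>) = \<phi> * E v \<psi> + \<psi> * E v \<phi>"
    proof -
      have "D v (\<phi> * \<psi>) q = \<phi> q * D v \<psi> q + D v \<phi> q * \<psi> q" if "q \<in> U" for q
        using has_derivative_mult[OF der[OF \<phi> that] der[OF \<psi> that]] c(5)[OF that]
        by (intro D that) simp
      then show ?thesis using \<phi> \<psi> by (auto simp: E_def fun_eq_iff sm_intros algebra_simps)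
    qed
  qed (auto simp: E_def)
  have EN: "E v \<phi> q = D v \<phi> q" if "\<phi> \<in> sm" "q \<in> ?N" for v \<phi> q
    using that N by (auto simp: E_def)
  \<comment> \<open>The expansion around \<open>c q\<close> is carried over to the manifold with global functions in place of the
    coefficients; on the intersection of finitely many neighbourhoods it is an identity.\<close>
  have X: "X \<phi> q = D (\<Sum>b\<in>Basis. X (x b) q *\<^sub>R b) \<phi> q" if X: "X \<in> VF" and \<phi>: "\<phi> \<in> sm" and q: "q \<in> ?N"
    for X \<phi> q
  proof -
    let ?G = "\<lambda>y. \<phi> (inv_into U c y)"
    have "open (c ` U)" "c q \<in> c ` U" using c q by auto
    then obtain r where r: "r > 0" "ball (c q) r \<subseteq> c ` U" unfolding open_contains_ball by blast
    obtain g where g: "\<And>b. smooth_on (ball (c q) r) (g b)"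
      "\<And>b. g b (c q) = frechet_derivative ?G (at (c q)) b"
      "\<And>y. y \<in> ball (c q) r \<Longrightarrow> ?G y = ?G (c q) + (\<Sum>b\<in>Basis. ((y - c q) \<bullet> b) * g b y)"
    proof (rule hadamard[OF smooth_on_subset[OF sm_chart[OF \<phi> U] r(2)]], goal_cases)
      case (1 g)
      show ?case by (rule 1(1)[OF 1(2-4)])
    qed
    have "\<exists>\<psi> W. \<psi> \<in> sm \<and> open W \<and> q \<in> W \<and> W \<subseteq> U \<and> (\<forall>x\<in>W. \<psi> x = g b (c x))" for b
    proof -
      have q': "q \<in> U" "c q \<in> ball (c q) r" using q r(1) by auto
      show ?thesis
        by (rule sm_extend_germ[OF U q'(1) open_ball r(2) q'(2) g(1)[of b]]) blast
    qed
    then obtain h W where h: "\<And>b. h b \<in> sm" and W: "\<And>b. open (W b)" "\<And>b. q \<in> W b"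
      "\<And>b z. z \<in> W b \<Longrightarrow> h b z = g b (c z)" by metis
    let ?W = "?N \<inter> (U \<inter> c -` ball (c q) r) \<inter> (\<Inter>b\<in>Basis. W b)"
    have oW: "open ?W" by (intro open_Int oN open_chart_preimage[OF U] open_ball open_INT ballI W finite_Basis)
    have qW: "q \<in> ?W" using q r W by auto
    let ?k = "(\<lambda>_. \<phi> q) + (\<Sum>b\<in>Basis. (x b - (\<lambda>_. x b q)) * h b)"
    have \<psi>: "?k \<in> sm" by (intro sm_intros x h)
    have "X \<phi> q = X ?k q"
    proof (rule VF_germ[OF X \<phi> \<psi> oW qW])
      fix z assume z: "z \<in> ?W"
      then have "\<phi> z = \<phi> q + (\<Sum>b\<in>Basis. ((c z - c q) \<bullet> b) * g b (c z))"
        using g(3)[of "c z"] c(5)[of z] c(5)[of q] q by auto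
      also have "\<dots> = ?k z"
        using z W(3) xN q by (simp add: sum_fun_apply inner_diff_left)
      finally show "\<phi> z = ?k z" .
    qed
    also have "X ?k = (\<Sum>b\<in>Basis. (x b - (\<lambda>_. x b q)) * X (h b) + h b * X (x b))"
      by (simp add: VF_D[OF X] VF_const[OF X] VF_fun_sum[OF X] VF_fun_diff[OF X] sm_intros x h)
    also have "\<dots> q = (\<Sum>b\<in>Basis. g b (c q) * X (x b) q)"
      using W by (simp add: sum_fun_apply)
    also have "\<dots> = (\<Sum>b\<in>Basis. X (x b) q *\<^sub>R D b \<phi> q)" by (simp add: g(2) D_def mult.commute)
    also have "\<dots> = D (\<Sum>b\<in>Basis. X (x b) q *\<^sub>R b) \<phi> q"
    proof -
      have lin: "linear (\<lambda>v. D v \<phi> q)"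
        using der[OF \<phi>] q by (auto intro: bounded_linear.linear has_derivative_bounded_linear)
      show ?thesis by (simp only: linear_sum[OF lin] linear_scale[OF lin])
    qed
    finally show ?thesis .
  qed
  show thesis
    by (rule that[of ?N x E]) (use oN p N x xN E EN X in \<open>auto simp: D_def\<close>)
qed

end

section \<open>Tensoriality: forms and tensors act point by point\<close>

lemma fscale_apply [simp]: "(\<phi> \<odot> T) z = \<phi> * T z"
  by (simp add: fscale_def)

text \<open>Linearity over a ring \<open>R\<close> of functions on a set \<open>M\<close> of fields or forms. One notion serves 1-forms, the
  partial maps of metrics and bivector fields, and the Lie derivative of a cometric.\<close>
definition module_map ::
  "('a \<Rightarrow> real) set \<Rightarrow> ('z \<Rightarrow> 'a \<Rightarrow> real) set \<Rightarrow> (('z \<Rightarrow> 'a \<Rightarrow> real) \<Rightarrow> 'a \<Rightarrow> real) \<Rightarrow> bool" where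
  "module_map R M T \<longleftrightarrow> (\<forall>u\<in>M. \<forall>v\<in>M. T (u + v) = T u + T v) \<and> (\<forall>\<phi>\<in>R. \<forall>u\<in>M. T (\<phi> \<odot> u) = \<phi> * T u)"

lemma module_mapD:
  assumes "module_map R M T"
  shows "u \<in> M \<Longrightarrow> v \<in> M \<Longrightarrow> T (u + v) = T u + T v"
    and "\<phi> \<in> R \<Longrightarrow> u \<in> M \<Longrightarrow> T (\<phi> \<odot> u) = \<phi> * T u"
  using assms by (auto simp: module_map_def)

lemma module_map_zero:
  assumes "module_map R M T" "0 \<in> R" "0 \<in> M"
  shows "T 0 = 0"
proof -
  have "(0::'a \<Rightarrow> real) \<odot> (0::'z \<Rightarrow> 'a \<Rightarrow> real) = 0" by (intro ext) simp
  then show ?thesis using module_mapD(2)[OF assms] by (metis mult_zero_left)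
qed

lemma module_map_sum:
  assumes "module_map R M T" "0 \<in> R" "0 \<in> M" "\<And>u v. u \<in> M \<Longrightarrow> v \<in> M \<Longrightarrow> u + v \<in> M"
    and "\<And>i. i \<in> I \<Longrightarrow> F i \<in> M"
  shows "(\<Sum>i\<in>I. F i) \<in> M \<and> T (\<Sum>i\<in>I. F i) = (\<Sum>i\<in>I. T (F i))"
  using assms(5)
proof (induction I rule: infinite_finite_induct)
  case (insert i I)
  then have "F i \<in> M" "sum F I \<in> M" "T (sum F I) = (\<Sum>i\<in>I. T (F i))" by blast+
  then show ?case
    using assms(4) module_mapD(1)[OF assms(1), of "F i" "sum F I"] by (simp only: sum.insert[OF insert(1,2)])
qed (simp_all add: assms(3) module_map_zero[OF assms(1-3)])

lemma module_map_diff: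
  assumes "module_map R M T" "u \<in> M" "v \<in> M" "u - v \<in> M"
  shows "T (u - v) = T u - T v"
  using module_mapD(1)[OF assms(1,4,3)] by (simp add: algebra_simps)

context smooth_manifold
begin

abbreviation FM :: "'a form set" where "FM \<equiv> one_forms A"

lemma FM_iff:
  "\<omega> \<in> FM \<longleftrightarrow> (\<forall>X\<in>VF. \<omega> X \<in> sm) \<and> (\<forall>X. X \<notin> VF \<longrightarrow> \<omega> X = 0) \<and> module_map sm VF \<omega>"
  unfolding one_forms_def module_map_def by blast

lemma FM_D:
  assumes "\<omega> \<in> FM"
  shows "X \<in> VF \<Longrightarrow> \<omega> X \<in> sm" "X \<notin> VF \<Longrightarrow> \<omega> X = 0" "module_map sm VF \<omega>"
  using assms by (auto simp: FM_iff)

lemma FM_eqI: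
  assumes "\<omega> \<in> FM" "\<eta> \<in> FM" "\<And>X p. X \<in> VF \<Longrightarrow> \<omega> X p = \<eta> X p"
  shows "\<omega> = \<eta>"
proof
  fix X show "\<omega> X = \<eta> X"
    using assms FM_D(2)[OF assms(1)] FM_D(2)[OF assms(2)] by (cases "X \<in> VF") auto
qed

lemma FM_zero: "0 \<in> FM"
  by (auto simp: FM_iff module_map_def sm_zero fun_eq_iff)

lemma FM_add: "\<omega> \<in> FM \<Longrightarrow> \<eta> \<in> FM \<Longrightarrow> \<omega> + \<eta> \<in> FM"
  unfolding FM_iff module_map_def
  by (auto simp: sm_add algebra_simps)

lemma FM_diff: "\<omega> \<in> FM \<Longrightarrow> \<eta> \<in> FM \<Longrightarrow> \<omega> - \<eta> \<in> FM"
  unfolding FM_iff module_map_def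
  by (auto simp: sm_diff algebra_simps)

lemma FM_scale: "\<phi> \<in> sm \<Longrightarrow> \<omega> \<in> FM \<Longrightarrow> \<phi> \<odot> \<omega> \<in> FM"
  unfolding FM_iff module_map_def
  by (auto simp: sm_mult algebra_simps)

lemma FM_sum: "(\<And>i. i \<in> I \<Longrightarrow> F i \<in> FM) \<Longrightarrow> (\<Sum>i\<in>I. F i) \<in> FM"
  by (induction I rule: infinite_finite_induct) (auto intro: FM_zero FM_add)

lemma FM_diff_arg: "\<omega> \<in> FM \<Longrightarrow> X \<in> VF \<Longrightarrow> Y \<in> VF \<Longrightarrow> \<omega> (X - Y) = \<omega> X - \<omega> Y"
  by (rule module_map_diff[OF FM_D(3)]) (auto intro: VF_diff)

lemma ext_d_apply: "X \<in> VF \<Longrightarrow> ext_d A \<phi> X = X \<phi>"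
  by (simp add: ext_d_def)

lemma ext_d_FM: "\<phi> \<in> sm \<Longrightarrow> ext_d A \<phi> \<in> FM"
  by (auto simp: FM_iff ext_d_def VF_D module_map_def VF_add VF_scale)

lemma ext_d_add: "\<phi> \<in> sm \<Longrightarrow> \<psi> \<in> sm \<Longrightarrow> ext_d A (\<phi> + \<psi>) = ext_d A \<phi> + ext_d A \<psi>"
  by (intro ext) (simp add: ext_d_def VF_D)

lemma ext_d_scale: "\<phi> \<in> sm \<Longrightarrow> ext_d A ((\<lambda>_. r) * \<phi>) = (\<lambda>_. r) \<odot> ext_d A \<phi>"
  by (intro ext) (simp add: ext_d_def VF_D)

lemma ext_d_mult: "\<phi> \<in> sm \<Longrightarrow> \<psi> \<in> sm \<Longrightarrow> ext_d A (\<phi> * \<psi>) = \<phi> \<odot> ext_d A \<psi> + \<psi> \<odot> ext_d A \<phi>"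
  by (intro ext) (simp add: ext_d_def VF_D)

lemma tangent_vector_coordinates:
  assumes "(U, c) \<in> A" "p \<in> U" "X \<in> VF"
  obtains v where "\<And>\<phi>. \<phi> \<in> sm \<Longrightarrow> X \<phi> p = frechet_derivative (\<lambda>y. \<phi> (inv_into U c y)) (at (c p)) v"
  by (rule coordinate_frame[OF assms(1,2)]) (use assms(3) that in blast)

lemma tangent_vector_exists:
  assumes "(U, c) \<in> A" "p \<in> U"
  obtains X where "X \<in> VF"
    "\<And>\<phi>. \<phi> \<in> sm \<Longrightarrow> X \<phi> p = frechet_derivative (\<lambda>y. \<phi> (inv_into U c y)) (at (c p)) v"
  by (rule coordinate_frame[OF assms(1,2)]) (use that in blast)

text \<open>The frame of coordinate fields near p together with the coordinate functions, whose differentials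
  make up the dual frame; the fields and functions are global, the duality holds on N.\<close>
definition dual_frame :: "'a \<Rightarrow> 'a set \<Rightarrow> ('e \<Rightarrow> 'a \<Rightarrow> real) \<Rightarrow> ('e \<Rightarrow> 'a vector_field) \<Rightarrow> bool" where
  "dual_frame p N x E \<longleftrightarrow> open N \<and> p \<in> N \<and> (\<forall>b. x b \<in> sm) \<and> (\<forall>b. E b \<in> VF) \<and>
     (\<forall>b\<in>Basis. \<forall>c\<in>Basis. \<forall>q\<in>N. E b (x c) q = (if b = c then 1 else 0)) \<and>
     (\<forall>X\<in>VF. \<forall>\<phi>\<in>sm. \<forall>q\<in>N. X \<phi> q = (\<Sum>b\<in>Basis. X (x b) q * E b \<phi> q))"

lemma dual_frameD:
  assumes "dual_frame p N x E"
  shows "open N" "p \<in> N" "x b \<in> sm" "E b \<in> VF"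
    "b \<in> Basis \<Longrightarrow> c \<in> Basis \<Longrightarrow> q \<in> N \<Longrightarrow> E b (x c) q = (if b = c then 1 else 0)"
    "X \<in> VF \<Longrightarrow> \<phi> \<in> sm \<Longrightarrow> q \<in> N \<Longrightarrow> X \<phi> q = (\<Sum>b\<in>Basis. X (x b) q * E b \<phi> q)"
  using assms unfolding dual_frame_def by blast+

lemma dual_frame_exists: obtains N x E where "dual_frame p N x E"
proof -
  obtain U c where U: "(U, c) \<in> A" and p: "p \<in> U" by (rule chart_at)
  note c = chart[OF U]
  show thesis
  proof (rule coordinate_frame[OF U p])
    fix N x E
    assume N: "open N" "p \<in> N" "N \<subseteq> U" and x: "\<And>b. x b \<in> sm" "\<And>b q. q \<in> N \<Longrightarrow> x b q = c q \<bullet> b"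
      and E: "\<And>v. E v \<in> VF" "\<And>v \<phi> q. \<phi> \<in> sm \<Longrightarrow> q \<in> N \<Longrightarrow>
        E v \<phi> q = frechet_derivative (\<lambda>y. \<phi> (inv_into U c y)) (at (c q)) v"
      and X: "\<And>X \<phi> q. X \<in> VF \<Longrightarrow> \<phi> \<in> sm \<Longrightarrow> q \<in> N \<Longrightarrow>
        X \<phi> q = frechet_derivative (\<lambda>y. \<phi> (inv_into U c y)) (at (c q)) (\<Sum>b\<in>Basis. X (x b) q *\<^sub>R b)"
    have "E b (x b') q = (if b = b' then 1 else 0)" if "b \<in> Basis" "b' \<in> Basis" "q \<in> N" for b b' q
    proof -
      let ?T = "c ` (U \<inter> N)"
      have T: "open ?T" by (rule open_chart_image[OF U N(1)])
      have "((\<lambda>y. y \<bullet> b') has_derivative (\<lambda>v. v \<bullet> b')) (at (c q))"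
        by (intro bounded_linear_imp_has_derivative bounded_linear_inner_left)
      then have "((\<lambda>y. x b' (inv_into U c y)) has_derivative (\<lambda>v. v \<bullet> b')) (at (c q))"
        by (rule has_derivative_transform_within_open[OF _ T])
          (use c(5) x(2) N(3) that(3) in \<open>auto simp: image_iff\<close>)
      from fun_cong[OF frechet_derivative_at[OF this], of b] E(2)[OF x(1) that(3)]
      have "E b (x b') q = b \<bullet> b'" by simp
      then show ?thesis using that by (simp add: inner_Basis)
    qed
    moreover have "X \<phi> q = (\<Sum>b\<in>Basis. X (x b) q * E b \<phi> q)" if "X \<in> VF" "\<phi> \<in> sm" "q \<in> N" for X \<phi> q
    proof -
      let ?D = "frechet_derivative (\<lambda>y. \<phi> (inv_into U c y)) (at (c q))"
      have "((\<lambda>y. \<phi> (inv_into U c y)) has_derivative ?D) (at (c q))"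
        using smooth_on_has_derivative[OF sm_chart[OF that(2) U]] that(3) N(3) by auto
      then have lin: "linear ?D" by (auto intro: bounded_linear.linear has_derivative_bounded_linear)
      show ?thesis using X[OF that] E(2)[OF that(2,3)]
        by (simp add: linear_sum[OF lin] linear_scale[OF lin])
    qed
    ultimately have "dual_frame p N x E" using N x E by (simp add: dual_frame_def)
    then show thesis by (rule that)
  qed
qed

lemma module_map_VF_sum:
  assumes "module_map sm VF T" "\<And>i. i \<in> I \<Longrightarrow> F i \<in> VF"
  shows "T (\<Sum>i\<in>I. F i) = (\<Sum>i\<in>I. T (F i))"
  by (rule module_map_sum[OF assms(1) sm_zero VF_zero VF_add assms(2), THEN conjunct2])

lemma module_map_FM_sum:
  assumes "module_map sm FM T" "\<And>i. i \<in> I \<Longrightarrow> F i \<in> FM"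
  shows "T (\<Sum>i\<in>I. F i) = (\<Sum>i\<in>I. T (F i))"
  by (rule module_map_sum[OF assms(1) sm_zero FM_zero FM_add assms(2), THEN conjunct2])

text \<open>After multiplication with a cut-off function the local expansion in the frame becomes an
  identity of global fields, to which the module map can be applied.\<close>
lemma module_map_VF_expand:
  assumes T: "module_map sm VF T" and F: "dual_frame p N x E" and X: "X \<in> VF" and q: "q \<in> N"
  shows "T X q = (\<Sum>b\<in>Basis. X (x b) q * T (E b) q)"
proof -
  note F = dual_frameD[OF F]
  obtain \<beta> N' where \<beta>: "\<beta> \<in> sm" "q \<in> N'" "\<And>z. z \<in> N' \<Longrightarrow> \<beta> z = 1" "\<And>z. z \<notin> N \<Longrightarrow> \<beta> z = 0"
    using bump[OF F(1) q] by metis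
  let ?Z = "\<Sum>b\<in>Basis. (\<beta> * X (x b)) \<odot> E b"
  have sm: "\<beta> * X (x b) \<in> sm" for b by (intro sm_mult \<beta> VF_D[OF X] F)
  have Z: "\<beta> \<odot> X = ?Z"
  proof (rule VF_eqI)
    fix \<phi> z assume "\<phi> \<in> sm"
    then show "(\<beta> \<odot> X) \<phi> z = ?Z \<phi> z"
      using F(6)[OF X, of \<phi> z] \<beta>(4)[of z]
      by (cases "z \<in> N") (simp_all add: sum_fun_apply sum_distrib_left mult_ac)
  qed (intro VF_scale VF_sum \<beta> X F sm)+
  have "\<beta> * T X = (\<Sum>b\<in>Basis. \<beta> * X (x b) * T (E b))"
    using arg_cong[OF Z, of T] module_mapD(2)[OF T \<beta>(1) X] module_mapD(2)[OF T sm F(4)]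
    by (simp add: module_map_VF_sum[OF T] VF_scale sm F(4))
  from fun_cong[OF this, of q] show ?thesis using \<beta>(2,3) by (simp add: sum_fun_apply)
qed

text \<open>Both values have the same expansion in a frame at \<open>p\<close>.\<close>
lemma module_map_VF_cong:
  assumes "module_map sm VF T" "X \<in> VF" "Y \<in> VF" "\<And>\<phi>. \<phi> \<in> sm \<Longrightarrow> X \<phi> p = Y \<phi> p"
  shows "T X p = T Y p"
proof -
  obtain N x E where F: "dual_frame p N x E" by (rule dual_frame_exists)
  note F' = dual_frameD[OF F]
  show ?thesis
    using module_map_VF_expand[OF assms(1) F assms(2) F'(2)]
      module_map_VF_expand[OF assms(1) F assms(3) F'(2)] assms(4)[OF F'(3)] by simp
qed

lemma module_map_FM_expand:
  assumes T: "module_map sm FM T" and F: "dual_frame p N x E" and \<omega>: "\<omega> \<in> FM" and q: "q \<in> N"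
  shows "T \<omega> q = (\<Sum>b\<in>Basis. \<omega> (E b) q * T (ext_d A (x b)) q)"
proof -
  note F' = dual_frameD[OF F]
  obtain \<beta> N' where \<beta>: "\<beta> \<in> sm" "q \<in> N'" "\<And>z. z \<in> N' \<Longrightarrow> \<beta> z = 1" "\<And>z. z \<notin> N \<Longrightarrow> \<beta> z = 0"
    using bump[OF F'(1) q] by metis
  let ?Z = "\<Sum>b\<in>Basis. (\<beta> * \<omega> (E b)) \<odot> ext_d A (x b)"
  have sm: "\<beta> * \<omega> (E b) \<in> sm" for b by (intro sm_mult \<beta> FM_D[OF \<omega>] F')
  have dx: "ext_d A (x b) \<in> FM" for b by (intro ext_d_FM F')
  have Z: "\<beta> \<odot> \<omega> = ?Z"
  proof (rule FM_eqI)
    fix X z assume X: "X \<in> VF"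
    show "(\<beta> \<odot> \<omega>) X z = ?Z X z"
      using module_map_VF_expand[OF FM_D(3)[OF \<omega>] F X, of z] \<beta>(4)[of z]
      by (cases "z \<in> N") (simp_all add: sum_fun_apply ext_d_apply[OF X] sum_distrib_left mult_ac)
  qed (intro FM_scale FM_sum \<beta> \<omega> dx sm)+
  have "\<beta> * T \<omega> = (\<Sum>b\<in>Basis. \<beta> * \<omega> (E b) * T (ext_d A (x b)))"
    using arg_cong[OF Z, of T] module_mapD(2)[OF T \<beta>(1) \<omega>] module_mapD(2)[OF T sm dx]
    by (simp add: module_map_FM_sum[OF T] FM_scale sm dx)
  from fun_cong[OF this, of q] show ?thesis using \<beta>(2,3) by (simp add: sum_fun_apply)
qed

text \<open>Both values have the same expansion in the dual of a frame at \<open>p\<close>.\<close>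
lemma module_map_FM_cong:
  assumes "module_map sm FM T" "\<omega> \<in> FM" "\<eta> \<in> FM" "\<And>X. X \<in> VF \<Longrightarrow> \<omega> X p = \<eta> X p"
  shows "T \<omega> p = T \<eta> p"
proof -
  obtain N x E where F: "dual_frame p N x E" by (rule dual_frame_exists)
  note F' = dual_frameD[OF F]
  show ?thesis
    using module_map_FM_expand[OF assms(1) F assms(2) F'(2)]
      module_map_FM_expand[OF assms(1) F assms(3) F'(2)] assms(4)[OF F'(4)] by simp
qed

section \<open>The sharp map of a bivector field\<close>

lemma bivector_D:
  assumes "bivector_field A P"
  shows "\<omega> \<in> FM \<Longrightarrow> \<eta> \<in> FM \<Longrightarrow> P \<omega> \<eta> \<in> sm"
    "\<omega> \<in> FM \<Longrightarrow> \<eta> \<in> FM \<Longrightarrow> P \<omega> \<eta> = - P \<eta> \<omega>"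
    "\<eta> \<in> FM \<Longrightarrow> module_map sm FM (\<lambda>\<omega>. P \<omega> \<eta>)"
    "\<omega> \<in> FM \<Longrightarrow> module_map sm FM (P \<omega>)"
proof -
  note P = assms[unfolded bivector_field_def]
  show 1: "\<omega> \<in> FM \<Longrightarrow> \<eta> \<in> FM \<Longrightarrow> P \<omega> \<eta> \<in> sm" for \<omega> \<eta> using P by blast
  show 2: "\<omega> \<in> FM \<Longrightarrow> \<eta> \<in> FM \<Longrightarrow> P \<omega> \<eta> = - P \<eta> \<omega>" for \<omega> \<eta> using P by blast
  show 3: "\<eta> \<in> FM \<Longrightarrow> module_map sm FM (\<lambda>\<omega>. P \<omega> \<eta>)" for \<eta> using P unfolding module_map_def by blast
  show "module_map sm FM (P \<omega>)" if \<omega>: "\<omega> \<in> FM"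
    unfolding module_map_def
  proof (intro conjI ballI)
    fix u v assume uv: "u \<in> FM" "v \<in> FM"
    show "P \<omega> (u + v) = P \<omega> u + P \<omega> v"
      unfolding 2[OF \<omega> FM_add[OF uv]] 2[OF \<omega> uv(1)] 2[OF \<omega> uv(2)] module_mapD(1)[OF 3[OF \<omega>] uv]
      by simp
    fix \<phi> assume \<phi>: "\<phi> \<in> sm"
    show "P \<omega> (\<phi> \<odot> u) = \<phi> * P \<omega> u"
      unfolding 2[OF \<omega> FM_scale[OF \<phi> uv(1)]] 2[OF \<omega> uv(1)] module_mapD(2)[OF 3[OF \<omega>] \<phi> uv(1)]
      by simp
  qed
qed

text \<open>The contraction of a bivector field with a form is a vector field because a module map on 1-forms is
  evaluation at the derivation that it induces on differentials.\<close>
lemma poisson_sharp: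
  assumes P: "bivector_field A P" and \<omega>: "\<omega> \<in> FM"
  shows "poisson_sharp A P \<omega> \<in> VF" "\<And>\<eta>. \<eta> \<in> FM \<Longrightarrow> \<eta> (poisson_sharp A P \<omega>) = P \<omega> \<eta>"
    "\<And>\<phi>. \<phi> \<in> sm \<Longrightarrow> poisson_sharp A P \<omega> \<phi> = P \<omega> (ext_d A \<phi>)"
proof -
  note PD = bivector_D[OF P]
  note T = module_mapD[OF PD(4)[OF \<omega>]]
  define X where "X = (\<lambda>\<phi>. if \<phi> \<in> sm then P \<omega> (ext_d A \<phi>) else 0)"
  have X: "X \<in> VF"
    by (rule VF_I) (simp_all add: X_def PD(1)[OF \<omega>] ext_d_FM sm_intros ext_d_add ext_d_scale ext_d_mult T FM_scale)
  have ev: "\<eta> X = P \<omega> \<eta>" if \<eta>: "\<eta> \<in> FM" for \<eta>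
  proof
    fix p
    obtain N x E where F: "dual_frame p N x E" by (rule dual_frame_exists)
    note F' = dual_frameD[OF F]
    show "\<eta> X p = P \<omega> \<eta> p"
      using module_map_VF_expand[OF FM_D(3)[OF \<eta>] F X F'(2)]
        module_map_FM_expand[OF PD(4)[OF \<omega>] F \<eta> F'(2)] by (simp add: X_def F'(3) mult.commute)
  qed
  have "poisson_sharp A P \<omega> = X"
    unfolding poisson_sharp_def
  proof (rule the_equality)
    show "X \<in> VF \<and> (\<forall>\<eta>\<in>FM. \<eta> X = P \<omega> \<eta>)" using X ev by blast
    fix Y assume Y: "Y \<in> VF \<and> (\<forall>\<eta>\<in>FM. \<eta> Y = P \<omega> \<eta>)"
    then have "Y \<phi> = X \<phi>" if "\<phi> \<in> sm" for \<phi>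
      using that ext_d_FM[OF that] ext_d_apply[of Y \<phi>] by (auto simp: X_def)
    then show "Y = X" using Y X by (auto intro!: VF_eqI)
  qed
  then show "poisson_sharp A P \<omega> \<in> VF" "\<And>\<eta>. \<eta> \<in> FM \<Longrightarrow> \<eta> (poisson_sharp A P \<omega>) = P \<omega> \<eta>"
    "\<And>\<phi>. \<phi> \<in> sm \<Longrightarrow> poisson_sharp A P \<omega> \<phi> = P \<omega> (ext_d A \<phi>)"
    using X ev by (auto simp: X_def)
qed

lemma poisson_sharp_add:
  assumes P: "bivector_field A P" and "\<omega> \<in> FM" "\<eta> \<in> FM"
  shows "poisson_sharp A P (\<omega> + \<eta>) = poisson_sharp A P \<omega> + poisson_sharp A P \<eta>"
  by (rule VF_eqI)
    (simp_all add: poisson_sharp[OF P] FM_add VF_add assms ext_d_FM module_mapD(1)[OF bivector_D(3)[OF P]])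

lemma poisson_sharp_scale:
  assumes P: "bivector_field A P" and "\<phi> \<in> sm" "\<omega> \<in> FM"
  shows "poisson_sharp A P (\<phi> \<odot> \<omega>) = \<phi> \<odot> poisson_sharp A P \<omega>"
  by (rule VF_eqI)
    (simp_all add: poisson_sharp[OF P] FM_scale VF_scale assms ext_d_FM module_mapD(2)[OF bivector_D(3)[OF P]])

end

section \<open>The sharp map of a pseudo-Riemannian metric\<close>

text \<open>An index type with as many elements as the model space has dimensions, so that the Gram matrix of a frame
  is a square matrix over a finite type and has a determinant.\<close>
typedef (overloaded) 'e basis_index = "Basis :: 'e::euclidean_space set"
  using nonempty_Basis by blast

instance basis_index :: (euclidean_space) finite
proof
  have "(UNIV :: 'a basis_index set) = Abs_basis_index ` Basis"
    by (auto intro: image_eqI[where x="Rep_basis_index _"] simp: Rep_basis_index_inverse Rep_basis_index)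
  then show "finite (UNIV :: 'a basis_index set)" by (metis finite_Basis finite_imageI)
qed

context smooth_manifold
begin

lemma sm_local_inverse:
  assumes s: "s \<in> sm" and p: "s p \<noteq> 0"
  obtains u N where "u \<in> sm" "open N" "p \<in> N" "\<And>q. q \<in> N \<Longrightarrow> u q * s q = 1"
proof -
  obtain U c where U: "(U, c) \<in> A" and pU: "p \<in> U" by (rule chart_at)
  note c = chart[OF U]
  let ?s = "\<lambda>y. s (inv_into U c y)"
  let ?T = "c ` U \<inter> ?s -` (- {0})"
  have ss: "smooth_on (c ` U) ?s" by (rule sm_chart[OF s U])
  have T: "open ?T" by (rule continuous_open_preimage[OF smooth_on_continuous_on[OF ss] c(2)]) auto
  have cp: "c p \<in> ?T" using pU p c(5)[OF pU] by simp
  have "smooth_on ?T (\<lambda>y. inverse (?s y))"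
    by (rule smooth_on_compose[OF T _ _ smooth_on_subset[OF ss] smooth_on_inverse]) auto
  then show thesis
  proof (rule sm_extend_germ[OF U pU T Int_lower1 cp], goal_cases)
    case (1 \<psi> N)
    have "\<psi> q * s q = 1" if "q \<in> N \<inter> (U \<inter> c -` ?T)" for q using that 1(5)[of q] c(5)[of q] by auto
    moreover have "open (N \<inter> (U \<inter> c -` ?T))" by (intro open_Int 1 open_chart_preimage[OF U T])
    moreover have "p \<in> N \<inter> (U \<inter> c -` ?T)" using 1(3) pU cp by blast
    ultimately show ?case using 1(1) that by blast
  qed
qed

text \<open>The determinant is a polynomial in the entries.\<close>
lemma sm_det:
  fixes M :: "'a \<Rightarrow> real ^ 'n ^ 'n"
  assumes "\<And>i j. (\<lambda>q. M q $ i $ j) \<in> sm"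
  shows "(\<lambda>q. det (M q)) \<in> sm"
proof -
  have "(\<lambda>q. det (M q)) = (\<Sum>s\<in>{s. s permutes (UNIV :: 'n set)}.
      (\<lambda>_. of_int (sign s)) * (\<Prod>i\<in>UNIV. (\<lambda>q. M q $ i $ s i)))"
    by (simp add: fun_eq_iff det_def sum_fun_apply prod_fun_apply)
  then show ?thesis by (simp only:) (intro sm_intros assms)
qed

lemma metric_D:
  assumes "pseudo_riemannian A g"
  shows "X \<in> VF \<Longrightarrow> Y \<in> VF \<Longrightarrow> g X Y \<in> sm"
    "X \<in> VF \<Longrightarrow> Y \<in> VF \<Longrightarrow> g X Y = g Y X"
    "Y \<in> VF \<Longrightarrow> module_map sm VF (\<lambda>X. g X Y)"
    "X \<in> VF \<Longrightarrow> module_map sm VF (g X)"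
    "X \<in> VF \<Longrightarrow> (\<And>Y. Y \<in> VF \<Longrightarrow> g X Y p = 0) \<Longrightarrow> \<phi> \<in> sm \<Longrightarrow> X \<phi> p = 0"
proof -
  note g = assms[unfolded pseudo_riemannian_def]
  show 1: "X \<in> VF \<Longrightarrow> Y \<in> VF \<Longrightarrow> g X Y \<in> sm" for X Y using g by blast
  show 2: "X \<in> VF \<Longrightarrow> Y \<in> VF \<Longrightarrow> g X Y = g Y X" for X Y using g by blast
  show 3: "Y \<in> VF \<Longrightarrow> module_map sm VF (\<lambda>X. g X Y)" for Y using g unfolding module_map_def by blast
  show "module_map sm VF (g X)" if X: "X \<in> VF"
    using 3[OF X] 2[OF X] unfolding module_map_def by (auto simp: VF_add VF_scale)
  show "X \<in> VF \<Longrightarrow> (\<And>Y. Y \<in> VF \<Longrightarrow> g X Y p = 0) \<Longrightarrow> \<phi> \<in> sm \<Longrightarrow> X \<phi> p = 0"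
    using g by blast
qed

text \<open>Nondegeneracy, applied to the difference of the two fields.\<close>
lemma metric_cancel:
  assumes g: "pseudo_riemannian A g" and X: "X \<in> VF" "X' \<in> VF"
    and eq: "\<And>Y. Y \<in> VF \<Longrightarrow> g X Y p = g X' Y p" and \<phi>: "\<phi> \<in> sm"
  shows "X \<phi> p = X' \<phi> p"
proof -
  have z: "g (X - X') Y p = 0" if Y: "Y \<in> VF" for Y
    using module_map_diff[OF metric_D(3)[OF g Y] X VF_diff[OF X]] eq[OF Y] by simp
  have "(X - X') \<phi> p = 0" by (rule metric_D(5)[OF g VF_diff[OF X] _ \<phi>]) (rule z)
  then show ?thesis by simp
qed

text \<open>In a frame the equation for the sharp is a linear system with the Gram matrix \<open>G\<close>. By nondegeneracy the
  determinant is nonzero at \<open>p\<close>, and where it is nonzero Cramer's rule gives a smooth solution.\<close>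
lemma metric_sharp_local:
  assumes g: "pseudo_riemannian A g" and \<omega>: "\<omega> \<in> FM"
  obtains X N where "X \<in> VF" "open N" "p \<in> N" "\<And>Y q. Y \<in> VF \<Longrightarrow> q \<in> N \<Longrightarrow> g X Y q = \<omega> Y q"
proof -
  obtain N x E where F: "dual_frame p N x E" by (rule dual_frame_exists)
  note F' = dual_frameD[OF F]
  note gD = metric_D[OF g]
  let ?E = "\<lambda>i :: 'e basis_index. E (Rep_basis_index i)"
  define G :: "'a \<Rightarrow> real ^ 'e basis_index ^ 'e basis_index" where "G = (\<lambda>q. \<chi> i j. g (?E i) (?E j) q)"
  have gsum: "g (\<Sum>i\<in>UNIV. a i \<odot> ?E i) (?E j) q = (G q *v (\<chi> i. a i q)) $ j"
    if "\<And>i. a i \<in> sm" for a j q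
  proof -
    have "g (\<Sum>i\<in>UNIV. a i \<odot> ?E i) (?E j) = (\<Sum>i\<in>UNIV. a i * g (?E i) (?E j))"
      using module_map_VF_sum[OF gD(3)[OF F'(4)[of "Rep_basis_index j"]], of UNIV "\<lambda>i. a i \<odot> ?E i"]
      by (simp add: VF_scale that F'(4) module_mapD(2)[OF gD(3)])
    then show ?thesis
      by (simp add: sum_fun_apply G_def matrix_vector_mult_def gD(2)[OF F'(4) F'(4)] mult.commute)
  qed
  have expand: "g X Y q = \<omega>' Y q" if X: "X \<in> VF" and \<omega>': "module_map sm VF \<omega>'"
    and eq: "\<And>j. g X (?E j) q = \<omega>' (?E j) q" and "Y \<in> VF" "q \<in> N" for X Y q \<omega>'
  proof -
    have "g X (E b) q = \<omega>' (E b) q" if "b \<in> Basis" for b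
      using eq[of "Abs_basis_index b"] that by (simp add: Abs_basis_index_inverse)
    then show ?thesis
      using module_map_VF_expand[OF gD(4)[OF X] F that(4,5)] module_map_VF_expand[OF \<omega>' F that(4,5)] by simp
  qed
  have "det (G p) \<noteq> 0"
  proof -
    have "a = 0" if a: "G p *v a = 0" for a
    proof -
      \<comment> \<open>A kernel vector of the Gram matrix is a tangent vector orthogonal to everything.\<close>
      let ?Z = "\<Sum>i\<in>UNIV. (\<lambda>_. a $ i) \<odot> ?E i"
      have Z: "?Z \<in> VF" by (intro VF_sum VF_scale sm_const F')
      have zero: "module_map sm VF 0" by (simp add: module_map_def)
      have "g ?Z Y p = 0 Y p" if "Y \<in> VF" for Y
        by (rule expand[OF Z zero _ that F'(2)]) (use gsum[of "\<lambda>i _. a $ i"] a in \<open>simp add: sm_const\<close>)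
      then have "?Z \<phi> p = 0" if "\<phi> \<in> sm" for \<phi> using that by (intro gD(5)[OF Z]) auto
      from this[OF F'(3)] have "(\<Sum>i\<in>UNIV. a $ i * ?E i (x (Rep_basis_index k)) p) = 0" for k
        by (simp add: sum_fun_apply)
      then have "(\<Sum>i\<in>UNIV. a $ i * (if i = k then 1 else 0)) = 0" for k
        using F'(5)[OF Rep_basis_index Rep_basis_index F'(2)]
        by (simp add: Rep_basis_index_inject)
      then show "a = 0" by (simp add: vec_eq_iff if_distrib cong: if_cong)
    qed
    then show ?thesis
      using matrix_left_invertible_ker[of "G p"] invertible_det_nz[of "G p"]
      by (metis invertible_left_inverse)
  qed
  have Gsm: "(\<lambda>q. G q $ i $ j) \<in> sm" for i j
    by (simp add: G_def gD(1) F'(4))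
  obtain u N' where u: "u \<in> sm" "open N'" "p \<in> N'" "\<And>q. q \<in> N' \<Longrightarrow> u q * det (G q) = 1"
    using sm_local_inverse[OF sm_det[OF Gsm] \<open>det (G p) \<noteq> 0\<close>] by metis
  define w :: "'a \<Rightarrow> real ^ 'e basis_index" where "w = (\<lambda>q. \<chi> i. \<omega> (?E i) q)"
  have wsm: "(\<lambda>q. w q $ i) \<in> sm" for i by (simp add: w_def FM_D(1)[OF \<omega>] F'(4))
  define a where "a = (\<lambda>k. u * (\<lambda>q. det (\<chi> i j. if j = k then w q $ i else G q $ i $ j)))"
  have "(\<lambda>q. (\<chi> i j. if j = k then w q $ i else G q $ i $ j) $ i $ j) \<in> sm" for i j k
    using wsm Gsm by (cases "j = k") simp_all
  then have asm: "a k \<in> sm" for k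
    unfolding a_def by (intro sm_mult u sm_det)
  let ?X = "\<Sum>i\<in>UNIV. a i \<odot> ?E i"
  have X: "?X \<in> VF" by (intro VF_sum VF_scale asm F')
  show thesis
  proof (rule that[OF X])
    show "open (N \<inter> N')" "p \<in> N \<inter> N'" using F'(1,2) u by auto
    fix Y q assume Y: "Y \<in> VF" and q: "q \<in> N \<inter> N'"
    then have d: "u q * det (G q) = 1" using u by auto
    then have "det (G q) \<noteq> 0" by auto
    moreover have "u q = 1 / det (G q)" using d calculation by (simp add: field_simps)
    ultimately have "G q *v (\<chi> k. a k q) = w q"
      by (subst cramer) (simp_all add: a_def)
    then have "g ?X (?E j) q = \<omega> (?E j) q" for j
      unfolding gsum[OF asm] by (simp add: w_def)
    then show "g ?X Y q = \<omega> Y q" by (rule expand[OF X FM_D(3)[OF \<omega>] _ Y]) (use q in auto)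
  qed
qed

text \<open>Nondegeneracy makes the local solutions agree wherever two of them are defined, so they glue to a vector field.\<close>
lemma metric_sharp:
  assumes g: "pseudo_riemannian A g" and \<omega>: "\<omega> \<in> FM"
  shows "metric_sharp A g \<omega> \<in> VF" "\<And>Y. Y \<in> VF \<Longrightarrow> g (metric_sharp A g \<omega>) Y = \<omega> Y"
proof -
  note gD = metric_D[OF g]
  have "\<exists>X N. X \<in> VF \<and> open N \<and> p \<in> N \<and> (\<forall>Y\<in>VF. \<forall>q\<in>N. g X Y q = \<omega> Y q)" for p
    by (rule metric_sharp_local[OF g \<omega>, of p]) blast
  then obtain X N where X: "\<And>p. X p \<in> VF" and N: "\<And>p. open (N p)" "\<And>p. p \<in> N p"
    and XN: "\<And>p Y q. Y \<in> VF \<Longrightarrow> q \<in> N p \<Longrightarrow> g (X p) Y q = \<omega> Y q" by metis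
  have agree: "X q \<phi> q = X p \<phi> q" if "\<phi> \<in> sm" "q \<in> N p" for p q \<phi>
    by (rule metric_cancel[OF g X X _ that(1)]) (simp add: XN N(2) that)
  define S where "S = (\<lambda>\<phi> q. if \<phi> \<in> sm then X q \<phi> q else 0)"
  have S: "S \<in> VF"
  proof (rule VF_I)
    fix \<phi> assume "\<phi> \<in> sm"
    then show "S \<phi> \<in> sm"
      using N agree VF_D(1)[OF X] unfolding S_def by (intro sm_local) metis
  qed (simp_all add: fun_eq_iff S_def sm_intros VF_D[OF X])
  have SX: "g S Y = \<omega> Y" if Y: "Y \<in> VF" for Y
  proof
    fix q
    have "g S Y q = g (X q) Y q"
      by (rule module_map_VF_cong[OF gD(3)[OF Y] S X]) (simp add: S_def)
    then show "g S Y q = \<omega> Y q" by (simp add: XN[OF Y N(2)])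
  qed
  have "metric_sharp A g \<omega> = S"
    unfolding metric_sharp_def
  proof (rule the_equality)
    show "S \<in> VF \<and> (\<forall>Y\<in>VF. g S Y = \<omega> Y)" using S SX by blast
    fix Z assume Z: "Z \<in> VF \<and> (\<forall>Y\<in>VF. g Z Y = \<omega> Y)"
    show "Z = S"
    proof (rule VF_eqI)
      fix \<phi> p assume "\<phi> \<in> sm"
      then show "Z \<phi> p = S \<phi> p" using Z S by (rule_tac metric_cancel[OF g, of Z S]) (auto simp: SX)
    qed (use Z S in auto)
  qed
  then show "metric_sharp A g \<omega> \<in> VF" "\<And>Y. Y \<in> VF \<Longrightarrow> g (metric_sharp A g \<omega>) Y = \<omega> Y"
    using S SX by auto
qed

lemma cometric_eq:
  assumes "pseudo_riemannian A g" "\<omega> \<in> FM" "\<eta> \<in> FM"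
  shows "cometric A g \<omega> \<eta> = \<omega> (metric_sharp A g \<eta>)"
  using assms by (simp add: cometric_def metric_sharp)

lemma cometric_D:
  assumes g: "pseudo_riemannian A g"
  shows "\<omega> \<in> FM \<Longrightarrow> \<eta> \<in> FM \<Longrightarrow> cometric A g \<omega> \<eta> \<in> sm"
    "\<omega> \<in> FM \<Longrightarrow> \<eta> \<in> FM \<Longrightarrow> cometric A g \<omega> \<eta> = cometric A g \<eta> \<omega>"
    "\<eta> \<in> FM \<Longrightarrow> module_map sm FM (\<lambda>\<omega>. cometric A g \<omega> \<eta>)"
proof -
  show "cometric A g \<omega> \<eta> \<in> sm" if "\<omega> \<in> FM" "\<eta> \<in> FM" for \<omega> \<eta>
    unfolding cometric_eq[OF g that] by (rule FM_D(1)[OF that(1) metric_sharp(1)[OF g that(2)]])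
  show "cometric A g \<omega> \<eta> = cometric A g \<eta> \<omega>" if "\<omega> \<in> FM" "\<eta> \<in> FM" for \<omega> \<eta>
    unfolding cometric_def
    by (rule metric_D(2)[OF g metric_sharp(1)[OF g that(1)] metric_sharp(1)[OF g that(2)]])
  show "module_map sm FM (\<lambda>\<omega>. cometric A g \<omega> \<eta>)" if "\<eta> \<in> FM" for \<eta>
    unfolding module_map_def by (simp add: cometric_eq[OF g _ that] FM_add FM_scale fun_eq_iff)
qed

section \<open>The Koszul bracket and the Lie derivative of the cometric\<close>

lemma lie_bracket_VF:
  assumes X: "X \<in> VF" and Y: "Y \<in> VF"
  shows "lie_bracket X Y \<in> VF"
proof (rule VF_I)
  note D = VF_D[OF X] VF_D[OF Y]
  show "lie_bracket X Y \<phi> = 0" if n: "\<phi> \<notin> sm" for \<phi>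
    unfolding lie_bracket_def D(2)[OF n] D(7)[OF n] VF_fun_zero[OF X] VF_fun_zero[OF Y] by (rule diff_self)
  fix \<phi> assume \<phi>: "\<phi> \<in> sm"
  show "lie_bracket X Y \<phi> \<in> sm" unfolding lie_bracket_def by (intro sm_diff D(1,6) \<phi>)
  show "lie_bracket X Y ((\<lambda>_. r) * \<phi>) = (\<lambda>_. r) * lie_bracket X Y \<phi>" for r
    unfolding lie_bracket_def by (simp only: D(1,4,6,9) \<phi> right_diff_distrib)
  fix \<psi> assume \<psi>: "\<psi> \<in> sm"
  show "lie_bracket X Y (\<phi> + \<psi>) = lie_bracket X Y \<phi> + lie_bracket X Y \<psi>"
    unfolding lie_bracket_def by (simp only: D(1,3,6,8) \<phi> \<psi> add_diff_add)
  show "lie_bracket X Y (\<phi> * \<psi>) = \<phi> * lie_bracket X Y \<psi> + \<psi> * lie_bracket X Y \<phi>"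
    unfolding lie_bracket_def
    by (simp only: D(1,3,5,6,8,10) \<phi> \<psi> sm_mult) (simp only: algebra_simps)
qed

lemma lie_bracket_add:
  assumes X: "X \<in> VF" and Y: "Y \<in> VF" and Z: "Z \<in> VF"
  shows "lie_bracket (X + Y) Z = lie_bracket X Z + lie_bracket Y Z"
    "lie_bracket X (Y + Z) = lie_bracket X Y + lie_bracket X Z"
proof -
  note VF = lie_bracket_VF VF_add X Y Z
  show "lie_bracket (X + Y) Z = lie_bracket X Z + lie_bracket Y Z"
  proof (rule VF_eqI)
    fix \<psi> p assume "\<psi> \<in> sm"
    then show "lie_bracket (X + Y) Z \<psi> p = (lie_bracket X Z + lie_bracket Y Z) \<psi> p"
      using VF_D(3)[OF Z VF_D(1)[OF X] VF_D(1)[OF Y], of \<psi> \<psi>] by (simp add: lie_bracket_def)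
  qed (intro VF)+
  show "lie_bracket X (Y + Z) = lie_bracket X Y + lie_bracket X Z"
  proof (rule VF_eqI)
    fix \<psi> p assume "\<psi> \<in> sm"
    then show "lie_bracket X (Y + Z) \<psi> p = (lie_bracket X Y + lie_bracket X Z) \<psi> p"
      using VF_D(3)[OF X VF_D(1)[OF Y] VF_D(1)[OF Z], of \<psi> \<psi>] by (simp add: lie_bracket_def)
  qed (intro VF)+
qed

lemma lie_bracket_scale_left:
  assumes \<phi>: "\<phi> \<in> sm" and X: "X \<in> VF" and Y: "Y \<in> VF"
  shows "lie_bracket (\<phi> \<odot> X) Y = \<phi> \<odot> lie_bracket X Y - Y \<phi> \<odot> X"
proof (rule VF_eqI)
  show "lie_bracket (\<phi> \<odot> X) Y \<in> VF" by (intro lie_bracket_VF VF_scale assms)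
  show "\<phi> \<odot> lie_bracket X Y - Y \<phi> \<odot> X \<in> VF"
    by (intro lie_bracket_VF VF_diff VF_scale assms VF_D(1)[OF Y])
  fix \<psi> p assume \<psi>: "\<psi> \<in> sm"
  show "lie_bracket (\<phi> \<odot> X) Y \<psi> p = (\<phi> \<odot> lie_bracket X Y - Y \<phi> \<odot> X) \<psi> p"
    using VF_D(5)[OF Y \<phi> VF_D(1)[OF X \<psi>]] by (simp add: lie_bracket_def algebra_simps)
qed

lemma lie_bracket_scale_right:
  assumes \<phi>: "\<phi> \<in> sm" and X: "X \<in> VF" and Y: "Y \<in> VF"
  shows "lie_bracket X (\<phi> \<odot> Y) = \<phi> \<odot> lie_bracket X Y + X \<phi> \<odot> Y"
proof (rule VF_eqI)
  show "lie_bracket X (\<phi> \<odot> Y) \<in> VF" by (intro lie_bracket_VF VF_scale assms)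
  show "\<phi> \<odot> lie_bracket X Y + X \<phi> \<odot> Y \<in> VF"
    by (intro lie_bracket_VF VF_add VF_scale assms VF_D(1)[OF X])
  fix \<psi> p assume \<psi>: "\<psi> \<in> sm"
  show "lie_bracket X (\<phi> \<odot> Y) \<psi> p = (\<phi> \<odot> lie_bracket X Y + X \<phi> \<odot> Y) \<psi> p"
    using VF_D(5)[OF X \<phi> VF_D(1)[OF Y \<psi>]] by (simp add: lie_bracket_def algebra_simps)
qed

lemma lie_form_FM:
  assumes X: "X \<in> VF" and \<omega>: "\<omega> \<in> FM"
  shows "lie_form A X \<omega> \<in> FM"
  unfolding FM_iff module_map_def
proof (intro conjI ballI allI impI)
  note mm = module_mapD[OF FM_D(3)[OF \<omega>]]
  note sm = FM_D(1)[OF \<omega>]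
  show "lie_form A X \<omega> Y = 0" if "Y \<notin> VF" for Y using that by (simp add: lie_form_def)
  fix Y assume Y: "Y \<in> VF"
  have br: "lie_bracket X Y \<in> VF" by (rule lie_bracket_VF[OF X Y])
  show "lie_form A X \<omega> Y \<in> sm"
    using sm_diff[OF VF_D(1)[OF X sm[OF Y]] sm[OF br]] Y by (simp add: lie_form_def)
  show "lie_form A X \<omega> (Y + Z) = lie_form A X \<omega> Y + lie_form A X \<omega> Z" if Z: "Z \<in> VF" for Z
    unfolding lie_form_def if_P[OF Y] if_P[OF Z] if_P[OF VF_add[OF Y Z]] lie_bracket_add(2)[OF X Y Z]
      mm(1)[OF Y Z] mm(1)[OF br lie_bracket_VF[OF X Z]] VF_D(3)[OF X sm[OF Y] sm[OF Z]]
    by (rule add_diff_add)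
  show "lie_form A X \<omega> (\<phi> \<odot> Y) = \<phi> * lie_form A X \<omega> Y" if \<phi>: "\<phi> \<in> sm" for \<phi>
    unfolding lie_form_def if_P[OF Y] if_P[OF VF_scale[OF \<phi> Y]] lie_bracket_scale_right[OF \<phi> X Y]
      mm(1)[OF VF_scale[OF \<phi> br] VF_scale[OF VF_D(1)[OF X \<phi>] Y]]
      mm(2)[OF \<phi> Y] mm(2)[OF \<phi> br] mm(2)[OF VF_D(1)[OF X \<phi>] Y] VF_D(5)[OF X \<phi> sm[OF Y]]
    by (simp only: algebra_simps)
qed

context
  fixes P :: "'a co_two_tensor"
  assumes P: "bivector_field A P"
begin

abbreviation ksz :: "'a form \<Rightarrow> 'a form \<Rightarrow> 'a form" where "ksz \<equiv> koszul_bracket A P"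
abbreviation sharp :: "'a form \<Rightarrow> 'a vector_field" where "sharp \<equiv> poisson_sharp A P"

lemma koszul_FM: "\<omega> \<in> FM \<Longrightarrow> \<eta> \<in> FM \<Longrightarrow> ksz \<omega> \<eta> \<in> FM"
  unfolding koszul_bracket_def
  by (intro FM_diff lie_form_FM ext_d_FM poisson_sharp[OF P] bivector_D[OF P])

lemma koszul_apply:
  assumes "Y \<in> VF"
  shows "ksz \<omega> \<eta> Y = sharp \<omega> (\<eta> Y) - \<eta> (lie_bracket (sharp \<omega>) Y)
     - (sharp \<eta> (\<omega> Y) - \<omega> (lie_bracket (sharp \<eta>) Y)) - Y (P \<omega> \<eta>)"
  using assms by (simp add: koszul_bracket_def lie_form_def ext_d_def)

lemma koszul_add_left:
  assumes "\<omega> \<in> FM" "\<omega>' \<in> FM" "\<eta> \<in> FM"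
  shows "ksz (\<omega> + \<omega>') \<eta> = ksz \<omega> \<eta> + ksz \<omega>' \<eta>"
proof (rule FM_eqI)
  fix Y p assume Y: "Y \<in> VF"
  note S = poisson_sharp(1)[OF P]
  show "ksz (\<omega> + \<omega>') \<eta> Y p = (ksz \<omega> \<eta> + ksz \<omega>' \<eta>) Y p"
    using Y by (simp add: koszul_apply poisson_sharp_add[OF P] assms lie_bracket_add S FM_D(1)
        module_mapD(1)[OF FM_D(3)] lie_bracket_VF VF_D module_mapD(1)[OF bivector_D(3)[OF P]] bivector_D(1)[OF P])
qed (intro koszul_FM FM_add assms)+

lemma koszul_add_right:
  assumes "\<omega> \<in> FM" "\<omega>' \<in> FM" "\<eta> \<in> FM"
  shows "ksz \<eta> (\<omega> + \<omega>') = ksz \<eta> \<omega> + ksz \<eta> \<omega>'"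
proof (rule FM_eqI)
  fix Y p assume Y: "Y \<in> VF"
  note S = poisson_sharp(1)[OF P]
  show "ksz \<eta> (\<omega> + \<omega>') Y p = (ksz \<eta> \<omega> + ksz \<eta> \<omega>') Y p"
    using Y by (simp add: koszul_apply poisson_sharp_add[OF P] assms lie_bracket_add S FM_D(1)
        module_mapD(1)[OF FM_D(3)] lie_bracket_VF VF_D module_mapD(1)[OF bivector_D(4)[OF P]] bivector_D(1)[OF P])
qed (intro koszul_FM FM_add assms)+

text \<open>The two terms with the differential of \<open>\<phi>\<close>, one from the Lie derivative along the sharp of \<open>\<phi> \<alpha>\<close> and
  one from the exact term, cancel by antisymmetry of the bivector field.\<close>
lemma koszul_leibniz:
  assumes \<phi>: "\<phi> \<in> sm" and \<eta>: "\<eta> \<in> FM" and \<alpha>: "\<alpha> \<in> FM"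
  shows "ksz \<eta> (\<phi> \<odot> \<alpha>) = \<phi> \<odot> ksz \<eta> \<alpha> + sharp \<eta> \<phi> \<odot> \<alpha>"
proof (rule FM_eqI)
  note S = poisson_sharp(1)[OF P \<eta>] poisson_sharp(1)[OF P \<alpha>]
  fix Y p assume Y: "Y \<in> VF"
  have br: "lie_bracket (sharp \<alpha>) Y \<in> VF" by (rule lie_bracket_VF[OF S(2) Y])
  have "\<eta> (lie_bracket (\<phi> \<odot> sharp \<alpha>) Y) = \<eta> (\<phi> \<odot> lie_bracket (sharp \<alpha>) Y) - \<eta> (Y \<phi> \<odot> sharp \<alpha>)"
    unfolding lie_bracket_scale_left[OF \<phi> S(2) Y]
    by (intro FM_diff_arg \<eta> VF_scale \<phi> br VF_D[OF Y] S)
  also have "\<dots> = \<phi> * \<eta> (lie_bracket (sharp \<alpha>) Y) - Y \<phi> * P \<alpha> \<eta>"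
    using module_mapD(2)[OF FM_D(3)[OF \<eta>] \<phi> br] module_mapD(2)[OF FM_D(3)[OF \<eta>] VF_D(1)[OF Y \<phi>] S(2)]
    by (simp add: poisson_sharp(2)[OF P \<alpha> \<eta>])
  also have "\<dots> = \<phi> * \<eta> (lie_bracket (sharp \<alpha>) Y) + Y \<phi> * P \<eta> \<alpha>"
    by (simp add: bivector_D(2)[OF P \<alpha> \<eta>])
  finally have 1: "\<eta> (lie_bracket (\<phi> \<odot> sharp \<alpha>) Y) = \<phi> * \<eta> (lie_bracket (sharp \<alpha>) Y) + Y \<phi> * P \<eta> \<alpha>" .
  have 2: "P \<eta> (\<phi> \<odot> \<alpha>) = \<phi> * P \<eta> \<alpha>" by (rule module_mapD(2)[OF bivector_D(4)[OF P \<eta>] \<phi> \<alpha>])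
  have "ksz \<eta> (\<phi> \<odot> \<alpha>) Y = \<phi> * ksz \<eta> \<alpha> Y + sharp \<eta> \<phi> * \<alpha> Y"
    unfolding koszul_apply[OF Y] fscale_apply poisson_sharp_scale[OF P \<phi> \<alpha>] 1 2
      VF_D(5)[OF S(1) \<phi> FM_D(1)[OF \<alpha> Y]] VF_D(5)[OF Y \<phi> bivector_D(1)[OF P \<eta> \<alpha>]]
    by (simp only: algebra_simps)
  then show "ksz \<eta> (\<phi> \<odot> \<alpha>) Y p = (\<phi> \<odot> ksz \<eta> \<alpha> + sharp \<eta> \<phi> \<odot> \<alpha>) Y p" by simp
qed (intro koszul_FM FM_add FM_scale VF_D(1)[OF poisson_sharp(1)[OF P \<eta>] \<phi>] assms)+

context
  fixes g :: "'a two_tensor"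
  assumes g: "pseudo_riemannian A g"
begin

abbreviation lcg :: "'a form \<Rightarrow> 'a co_two_tensor" where
  "lcg \<equiv> lie_cometric A (cometric A g) P"

lemma lie_cometric_sym: "\<eta> \<in> FM \<Longrightarrow> \<alpha> \<in> FM \<Longrightarrow> \<beta> \<in> FM \<Longrightarrow> lcg \<eta> \<alpha> \<beta> = lcg \<eta> \<beta> \<alpha>"
  unfolding lie_cometric_def
  using cometric_D(2)[OF g, of \<alpha> \<beta>] cometric_D(2)[OF g, of "ksz \<eta> \<alpha>" \<beta>] cometric_D(2)[OF g, of \<alpha> "ksz \<eta> \<beta>"]
  by (simp add: koszul_FM)

text \<open>The derivative of \<open>\<phi>\<close> along the sharp of \<open>\<eta>\<close> appears twice, from the function \<open>g (\<phi> \<alpha>) \<beta>\<close> and from the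
  Leibniz rule of the bracket, with opposite signs.\<close>
lemma lie_cometric_module_map:
  assumes \<eta>: "\<eta> \<in> FM" and \<beta>: "\<beta> \<in> FM"
  shows "module_map sm FM (\<lambda>\<alpha>. lcg \<eta> \<alpha> \<beta>)" "module_map sm FM (lcg \<eta> \<beta>)"
proof -
  note S = poisson_sharp(1)[OF P \<eta>]
  note C = module_mapD[OF cometric_D(3)[OF g \<beta>]] module_mapD[OF cometric_D(3)[OF g koszul_FM[OF \<eta> \<beta>]]]
  show 1: "module_map sm FM (\<lambda>\<alpha>. lcg \<eta> \<alpha> \<beta>)"
    unfolding module_map_def
  proof (intro conjI ballI)
    fix u v assume u: "u \<in> FM" and v: "v \<in> FM"
    show "lcg \<eta> (u + v) \<beta> = lcg \<eta> u \<beta> + lcg \<eta> v \<beta>"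
      by (simp add: lie_cometric_def koszul_add_right u v \<eta> \<beta> C koszul_FM VF_D[OF S] cometric_D[OF g] algebra_simps)
    fix \<phi> assume \<phi>: "\<phi> \<in> sm"
    have "cometric A g (ksz \<eta> (\<phi> \<odot> u)) \<beta> = \<phi> * cometric A g (ksz \<eta> u) \<beta> + sharp \<eta> \<phi> * cometric A g u \<beta>"
      by (simp add: koszul_leibniz \<phi> u \<eta> C FM_scale VF_D[OF S] koszul_FM)
    then show "lcg \<eta> (\<phi> \<odot> u) \<beta> = \<phi> * lcg \<eta> u \<beta>"
      using u \<phi> VF_D(5)[OF S \<phi> cometric_D(1)[OF g u \<beta>]]
      by (simp add: lie_cometric_def C algebra_simps)
  qed
  have "lcg \<eta> \<beta> \<alpha> = lcg \<eta> \<alpha> \<beta>" if "\<alpha> \<in> FM" for \<alpha> using lie_cometric_sym[OF \<eta> \<beta> that] .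
  then show "module_map sm FM (lcg \<eta> \<beta>)"
    using 1 unfolding module_map_def by (simp add: FM_add FM_scale)
qed

end

end

end

section \<open>Product manifolds\<close>

locale product_manifold = M1: smooth_manifold A1 + M2: smooth_manifold A2
  for A1 :: "('a::{t2_space,second_countable_topology}, 'e::euclidean_space) atlas"
    and A2 :: "('b::{t2_space,second_countable_topology}, 'f::euclidean_space) atlas"
begin

lemma map_prod_image: "map_prod c d ` (U \<times> V) = c ` U \<times> d ` V"
  by force

lemma product_chart_inverse:
  assumes "(U, c) \<in> A1" "(V, d) \<in> A2" "y \<in> c ` U" "z \<in> d ` V"
  shows "inv_into (U \<times> V) (map_prod c d) (y, z) = (inv_into U c y, inv_into V d z)"
proof (rule inv_into_f_eq)
  note c = M1.chart[OF assms(1)] and d = M2.chart[OF assms(2)]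
  show "inj_on (map_prod c d) (U \<times> V)"
    using c(5) d(5) by (intro map_prod_inj_on inj_on_inverseI[where g="inv_into _ _"]) auto
  show "(inv_into U c y, inv_into V d z) \<in> U \<times> V" using c(6)[OF assms(3)] d(6)[OF assms(4)] by simp
  show "map_prod c d (inv_into U c y, inv_into V d z) = (y, z)"
    using c(7)[OF assms(3)] d(7)[OF assms(4)] by simp
qed

lemma product_chart: "(U, c) \<in> A1 \<Longrightarrow> (V, d) \<in> A2 \<Longrightarrow> (U \<times> V, map_prod c d) \<in> prod_atlas A1 A2"
  by (auto simp: prod_atlas_def)

lemma product_chartE:
  assumes "(W, e) \<in> prod_atlas A1 A2"
  obtains U c V d where "W = U \<times> V" "e = map_prod c d" "(U, c) \<in> A1" "(V, d) \<in> A2"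
  using assms by (auto simp: prod_atlas_def)

lemma smooth_on_fst:
  fixes h :: "'e \<Rightarrow> 'z::real_normed_vector"
  assumes "open S" "open T" "smooth_on S h"
  shows "smooth_on (S \<times> T) (\<lambda>y::'e \<times> 'f. h (fst y))"
  by (rule smooth_on_compose[OF open_Times[OF assms(1,2)] assms(1) _ smooth_on_linear assms(3)])
    (auto simp: open_Times assms bounded_linear_fst)

lemma smooth_on_snd:
  fixes h :: "'f \<Rightarrow> 'z::real_normed_vector"
  assumes "open S" "open T" "smooth_on T h"
  shows "smooth_on (S \<times> T) (\<lambda>y::'e \<times> 'f. h (snd y))"
  by (rule smooth_on_compose[OF open_Times[OF assms(1,2)] assms(2) _ smooth_on_linear assms(3)])
    (auto simp: open_Times assms bounded_linear_snd)

lemma product_chart_homeomorphism: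
  assumes "(U, c) \<in> A1" "(V, d) \<in> A2"
  shows "homeomorphism (U \<times> V) (map_prod c d ` (U \<times> V)) (map_prod c d) (inv_into (U \<times> V) (map_prod c d))"
  unfolding homeomorphism_def
proof (intro conjI ballI)
  note c = M1.chart[OF assms(1)] and d = M2.chart[OF assms(2)]
  note inv = product_chart_inverse[OF assms]
  let ?i = "inv_into (U \<times> V) (map_prod c d)"
  show left: "?i (map_prod c d x) = x" if "x \<in> U \<times> V" for x
    using that c(5)[of "fst x"] d(5)[of "snd x"] inv[of "c (fst x)" "d (snd x)"]
    by (cases x) auto
  show "map_prod c d (?i y) = y" if "y \<in> map_prod c d ` (U \<times> V)" for y
    using that by (rule f_inv_into_f)
  show "?i ` map_prod c d ` (U \<times> V) = U \<times> V"
    using left by (simp add: image_image)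
  have "continuous_on (U \<times> V) (\<lambda>x. (c (fst x), d (snd x)))"
    by (intro continuous_on_Pair continuous_on_compose2[OF c(3)] continuous_on_compose2[OF d(3)]
        continuous_on_fst continuous_on_snd continuous_on_id) auto
  then show "continuous_on (U \<times> V) (map_prod c d)" by (simp add: map_prod_def case_prod_beta')
  have "continuous_on (c ` U \<times> d ` V) (\<lambda>x. (inv_into U c (fst x), inv_into V d (snd x)))"
    by (intro continuous_on_Pair continuous_on_compose2[OF c(4)] continuous_on_compose2[OF d(4)]
        continuous_on_fst continuous_on_snd continuous_on_id) auto
  then show "continuous_on (map_prod c d ` (U \<times> V)) ?i"
    unfolding map_prod_image by (rule continuous_on_eq) (auto simp: inv)
qed (rule refl)

lemma product_transition_smooth:
  assumes "(U, c) \<in> A1" "(V, d) \<in> A2" "(U', c') \<in> A1" "(V', d') \<in> A2"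
  shows "smooth_on (map_prod c d ` (U \<times> V \<inter> U' \<times> V'))
    (map_prod c' d' \<circ> inv_into (U \<times> V) (map_prod c d))"
proof -
  have eq: "map_prod c d ` (U \<times> V \<inter> U' \<times> V') = c ` (U \<inter> U') \<times> d ` (V \<inter> V')"
    unfolding Times_Int_Times by (rule map_prod_image)
  note o = M1.open_chart_image[OF assms(1) M1.chart(1)[OF assms(3)]]
    M2.open_chart_image[OF assms(2) M2.chart(1)[OF assms(4)]]
  have "smooth_on (c ` (U \<inter> U') \<times> d ` (V \<inter> V'))
      (\<lambda>y. (c' (inv_into U c (fst y)), d' (inv_into V d (snd y))))"
    by (intro smooth_on_Pair open_Times o
        smooth_on_fst[OF o M1.transition_smooth[OF assms(1,3)]]
        smooth_on_snd[OF o M2.transition_smooth[OF assms(2,4)]])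
  then show ?thesis
    unfolding eq
    by (rule smooth_on_cong[OF open_Times[OF o], rotated]) (auto simp: product_chart_inverse[OF assms(1,2)])
qed

lemma smooth_atlas_product: "smooth_atlas (prod_atlas A1 A2)"
  unfolding smooth_atlas_def
proof (intro conjI)
  have "(p, q) \<in> (\<Union>(U, c)\<in>prod_atlas A1 A2. U)" for p q
  proof -
    obtain U c V d where "(U, c) \<in> A1" "p \<in> U" "(V, d) \<in> A2" "q \<in> V"
      using M1.chart_at M2.chart_at by metis
    then show ?thesis using product_chart by (intro UN_I[of "(U \<times> V, map_prod c d)"]) auto
  qed
  then show "(\<Union>(U, c)\<in>prod_atlas A1 A2. U) = UNIV" by auto
  have "open (U \<times> V) \<and> open (map_prod c d ` (U \<times> V)) \<and>
      homeomorphism (U \<times> V) (map_prod c d ` (U \<times> V)) (map_prod c d) (inv_into (U \<times> V) (map_prod c d))"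
    if "(U, c) \<in> A1" "(V, d) \<in> A2" for U c V d
    using product_chart_homeomorphism[OF that] M1.chart(1,2)[OF that(1)] M2.chart(1,2)[OF that(2)]
    by (simp add: map_prod_image open_Times)
  then show "\<forall>(U, c)\<in>prod_atlas A1 A2. open U \<and> open (c ` U) \<and> homeomorphism U (c ` U) c (inv_into U c)"
    by (auto elim!: product_chartE)
  show "\<forall>(U, c)\<in>prod_atlas A1 A2. \<forall>(V, d)\<in>prod_atlas A1 A2. smooth_on (c ` (U \<inter> V)) (d \<circ> inv_into U c)"
    by (auto elim!: product_chartE intro!: product_transition_smooth)
qed

sublocale M: smooth_manifold "prod_atlas A1 A2"
  by unfold_locales (rule smooth_atlas_product)

lemma sm_fst: assumes "\<phi> \<in> M1.sm" shows "\<phi> \<circ> fst \<in> M.sm"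
proof (rule M.smI)
  fix W e assume "(W, e) \<in> prod_atlas A1 A2"
  then obtain U c V d where We: "W = U \<times> V" "e = map_prod c d" and U: "(U, c) \<in> A1" and V: "(V, d) \<in> A2"
    by (rule product_chartE)
  note o = M1.chart(2)[OF U] M2.chart(2)[OF V]
  show "smooth_on (e ` W) (\<lambda>y. (\<phi> \<circ> fst) (inv_into W e y))"
    unfolding We map_prod_image
    by (rule smooth_on_cong[OF open_Times[OF o] _ smooth_on_fst[OF o M1.sm_chart[OF assms U]]])
      (auto simp: product_chart_inverse[OF U V])
qed

lemma sm_snd: assumes "\<phi> \<in> M2.sm" shows "\<phi> \<circ> snd \<in> M.sm"
proof (rule M.smI)
  fix W e assume "(W, e) \<in> prod_atlas A1 A2"
  then obtain U c V d where We: "W = U \<times> V" "e = map_prod c d" and U: "(U, c) \<in> A1" and V: "(V, d) \<in> A2"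
    by (rule product_chartE)
  note o = M1.chart(2)[OF U] M2.chart(2)[OF V]
  show "smooth_on (e ` W) (\<lambda>y. (\<phi> \<circ> snd) (inv_into W e y))"
    unfolding We map_prod_image
    by (rule smooth_on_cong[OF open_Times[OF o] _ smooth_on_snd[OF o M2.sm_chart[OF assms V]]])
      (auto simp: product_chart_inverse[OF U V])
qed

lemma sm_slice1: assumes "F \<in> M.sm" shows "(\<lambda>p. F (p, q)) \<in> M1.sm"
proof (rule M1.smI)
  fix U c assume U: "(U, c) \<in> A1"
  obtain V d where V: "(V, d) \<in> A2" and q: "q \<in> V" by (rule M2.chart_at)
  note o = M1.chart(2)[OF U] M2.chart(2)[OF V]
  have "smooth_on (c ` U) (\<lambda>y. (\<lambda>y. F (inv_into (U \<times> V) (map_prod c d) y)) (y, d q))"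
    by (rule smooth_on_compose[OF o(1) open_Times[OF o] _
          smooth_on_Pair[OF o(1) smooth_on_linear[OF o(1) bounded_linear_ident] smooth_on_const[OF o(1)]]
          M.sm_chart[OF assms product_chart[OF U V], unfolded map_prod_image]])
      (use q in auto)
  then show "smooth_on (c ` U) (\<lambda>y. F (inv_into U c y, q))"
    by (rule smooth_on_cong[OF o(1), rotated]) (use q M2.chart(5)[OF V q] in \<open>auto simp: product_chart_inverse[OF U V]\<close>)
qed

lemma sm_slice2: assumes "F \<in> M.sm" shows "(\<lambda>q. F (p, q)) \<in> M2.sm"
proof (rule M2.smI)
  fix V d assume V: "(V, d) \<in> A2"
  obtain U c where U: "(U, c) \<in> A1" and p: "p \<in> U" by (rule M1.chart_at)
  note o = M1.chart(2)[OF U] M2.chart(2)[OF V]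
  have "smooth_on (d ` V) (\<lambda>y. (\<lambda>y. F (inv_into (U \<times> V) (map_prod c d) y)) (c p, y))"
    by (rule smooth_on_compose[OF o(2) open_Times[OF o] _
          smooth_on_Pair[OF o(2) smooth_on_const[OF o(2)] smooth_on_linear[OF o(2) bounded_linear_ident]]
          M.sm_chart[OF assms product_chart[OF U V], unfolded map_prod_image]])
      (use p in auto)
  then show "smooth_on (d ` V) (\<lambda>y. F (p, inv_into V d y))"
    by (rule smooth_on_cong[OF o(2), rotated]) (use p M1.chart(5)[OF U p] in \<open>auto simp: product_chart_inverse[OF U V]\<close>)
qed

text \<open>Needed in both directions because vector fields are zero on functions that are not smooth.\<close>
lemma sm_fst_iff: "\<phi> \<circ> fst \<in> M.sm \<longleftrightarrow> \<phi> \<in> M1.sm"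
  using sm_fst sm_slice1[of "\<phi> \<circ> fst" undefined] by auto

lemma sm_snd_iff: "\<phi> \<circ> snd \<in> M.sm \<longleftrightarrow> \<phi> \<in> M2.sm"
  using sm_snd sm_slice2[of "\<phi> \<circ> snd" undefined] by auto

lemma slice1_apply: "slice1 q X \<phi> p = X (\<phi> \<circ> fst) (p, q)"
  by (simp add: slice1_def)

lemma slice2_apply: "slice2 p X \<phi> q = X (\<phi> \<circ> snd) (p, q)"
  by (simp add: slice2_def)

lemma comp_arith:
  fixes \<phi> \<psi> :: "'x \<Rightarrow> real"
  shows "(\<phi> + \<psi>) \<circ> h = (\<phi> \<circ> h) + (\<psi> \<circ> h)" "(\<phi> * \<psi>) \<circ> h = (\<phi> \<circ> h) * (\<psi> \<circ> h)"
    "((\<lambda>_. r) * \<phi>) \<circ> h = (\<lambda>_. r) * (\<phi> \<circ> h)"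
  by (intro ext; simp)+

lemma slice1_VF:
  assumes X: "X \<in> M.VF"
  shows "slice1 q X \<in> M1.VF"
proof (rule M1.VF_I)
  note D = M.VF_D[OF X]
  show "slice1 q X \<phi> = 0" if "\<phi> \<notin> M1.sm" for \<phi>
    using D(2)[of "\<phi> \<circ> fst"] that by (intro ext) (simp add: slice1_apply sm_fst_iff)
  fix \<phi> assume \<phi>: "\<phi> \<in> M1.sm"
  show "slice1 q X \<phi> \<in> M1.sm"
    unfolding slice1_def by (rule sm_slice1[OF D(1)[OF sm_fst[OF \<phi>]]])
  show "slice1 q X ((\<lambda>_. r) * \<phi>) = (\<lambda>_. r) * slice1 q X \<phi>" for r
    by (intro ext) (simp add: slice1_apply comp_arith D(4) sm_fst \<phi>)
  fix \<psi> assume \<psi>: "\<psi> \<in> M1.sm"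
  show "slice1 q X (\<phi> + \<psi>) = slice1 q X \<phi> + slice1 q X \<psi>"
    by (intro ext) (simp add: slice1_apply comp_arith D(3) sm_fst \<phi> \<psi>)
  show "slice1 q X (\<phi> * \<psi>) = \<phi> * slice1 q X \<psi> + \<psi> * slice1 q X \<phi>"
    by (intro ext) (simp add: slice1_apply comp_arith D(5) sm_fst \<phi> \<psi>)
qed

lemma slice2_VF:
  assumes X: "X \<in> M.VF"
  shows "slice2 p X \<in> M2.VF"
proof (rule M2.VF_I)
  note D = M.VF_D[OF X]
  show "slice2 p X \<phi> = 0" if "\<phi> \<notin> M2.sm" for \<phi>
    using D(2)[of "\<phi> \<circ> snd"] that by (intro ext) (simp add: slice2_apply sm_snd_iff)
  fix \<phi> assume \<phi>: "\<phi> \<in> M2.sm"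
  show "slice2 p X \<phi> \<in> M2.sm"
    unfolding slice2_def by (rule sm_slice2[OF D(1)[OF sm_snd[OF \<phi>]]])
  show "slice2 p X ((\<lambda>_. r) * \<phi>) = (\<lambda>_. r) * slice2 p X \<phi>" for r
    by (intro ext) (simp add: slice2_apply comp_arith D(4) sm_snd \<phi>)
  fix \<psi> assume \<psi>: "\<psi> \<in> M2.sm"
  show "slice2 p X (\<phi> + \<psi>) = slice2 p X \<phi> + slice2 p X \<psi>"
    by (intro ext) (simp add: slice2_apply comp_arith D(3) sm_snd \<phi> \<psi>)
  show "slice2 p X (\<phi> * \<psi>) = \<phi> * slice2 p X \<psi> + \<psi> * slice2 p X \<phi>"
    by (intro ext) (simp add: slice2_apply comp_arith D(5) sm_snd \<phi> \<psi>)
qed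

lemma slice1_add: "slice1 q (X + Y) = slice1 q X + slice1 q Y"
  and slice2_add: "slice2 p (X + Y) = slice2 p X + slice2 p Y"
  and slice1_scale: "slice1 q (F \<odot> X) = (\<lambda>p. F (p, q)) \<odot> slice1 q X"
  and slice2_scale: "slice2 p (F \<odot> X) = (\<lambda>q. F (p, q)) \<odot> slice2 p X"
  by (intro ext; simp add: slice1_apply slice2_apply)+

lemma has_derivative_fst_comp:
  assumes U: "(U, c) \<in> A1" "p \<in> U" and V: "(V, d) \<in> A2" "q \<in> V" and \<phi>: "\<phi> \<in> M1.sm"
  shows "((\<lambda>y. (\<phi> \<circ> fst) (inv_into (U \<times> V) (map_prod c d) y)) has_derivative
    (\<lambda>v. frechet_derivative (\<lambda>y. \<phi> (inv_into U c y)) (at (c p)) (fst v))) (at (map_prod c d (p, q)))"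
proof -
  note o = M1.chart(2)[OF U(1)] M2.chart(2)[OF V(1)]
  have "((\<lambda>y. \<phi> (inv_into U c y)) has_derivative frechet_derivative (\<lambda>y. \<phi> (inv_into U c y)) (at (c p)))
      (at (fst (c p, d q)))"
    using smooth_on_has_derivative[OF M1.sm_chart[OF \<phi> U(1)]] U(2) by simp
  from has_derivative_compose[OF has_derivative_fst[OF has_derivative_ident] this]
  have "((\<lambda>y. \<phi> (inv_into U c (fst y))) has_derivative
      (\<lambda>v. frechet_derivative (\<lambda>y. \<phi> (inv_into U c y)) (at (c p)) (fst v))) (at (c p, d q))" by simp
  then show ?thesis
    unfolding map_prod_simp
    by (rule has_derivative_transform_within_open[OF _ open_Times[OF o]])
      (use U V in \<open>auto simp: product_chart_inverse\<close>)
qed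

lemma has_derivative_snd_comp:
  assumes U: "(U, c) \<in> A1" "p \<in> U" and V: "(V, d) \<in> A2" "q \<in> V" and \<phi>: "\<phi> \<in> M2.sm"
  shows "((\<lambda>y. (\<phi> \<circ> snd) (inv_into (U \<times> V) (map_prod c d) y)) has_derivative
    (\<lambda>v. frechet_derivative (\<lambda>y. \<phi> (inv_into V d y)) (at (d q)) (snd v))) (at (map_prod c d (p, q)))"
proof -
  note o = M1.chart(2)[OF U(1)] M2.chart(2)[OF V(1)]
  have "((\<lambda>y. \<phi> (inv_into V d y)) has_derivative frechet_derivative (\<lambda>y. \<phi> (inv_into V d y)) (at (d q)))
      (at (snd (c p, d q)))"
    using smooth_on_has_derivative[OF M2.sm_chart[OF \<phi> V(1)]] V(2) by simp
  from has_derivative_compose[OF has_derivative_snd[OF has_derivative_ident] this]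
  have "((\<lambda>y. \<phi> (inv_into V d (snd y))) has_derivative
      (\<lambda>v. frechet_derivative (\<lambda>y. \<phi> (inv_into V d y)) (at (d q)) (snd v))) (at (c p, d q))" by simp
  then show ?thesis
    unfolding map_prod_simp
    by (rule has_derivative_transform_within_open[OF _ open_Times[OF o]])
      (use U V in \<open>auto simp: product_chart_inverse\<close>)
qed

text \<open>A pair of coordinate directions is a direction in the product chart.\<close>
lemma tangent_vectors_lift:
  assumes X1: "X1 \<in> M1.VF" and X2: "X2 \<in> M2.VF"
  obtains Y where "Y \<in> M.VF" "\<And>\<phi>. \<phi> \<in> M1.sm \<Longrightarrow> slice1 q Y \<phi> p = X1 \<phi> p"
    "\<And>\<psi>. \<psi> \<in> M2.sm \<Longrightarrow> slice2 p Y \<psi> q = X2 \<psi> q"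
proof -
  obtain U c where U: "(U, c) \<in> A1" "p \<in> U" by (rule M1.chart_at)
  obtain V d where V: "(V, d) \<in> A2" "q \<in> V" by (rule M2.chart_at)
  obtain v1 where v1: "\<And>\<phi>. \<phi> \<in> M1.sm \<Longrightarrow> X1 \<phi> p = frechet_derivative (\<lambda>y. \<phi> (inv_into U c y)) (at (c p)) v1"
    using M1.tangent_vector_coordinates[OF U X1] by metis
  obtain v2 where v2: "\<And>\<phi>. \<phi> \<in> M2.sm \<Longrightarrow> X2 \<phi> q = frechet_derivative (\<lambda>y. \<phi> (inv_into V d y)) (at (d q)) v2"
    using M2.tangent_vector_coordinates[OF V X2] by metis
  have pq: "(p, q) \<in> U \<times> V" using U V by simp
  obtain Y where Y: "Y \<in> M.VF" "\<And>\<phi>. \<phi> \<in> M.sm \<Longrightarrow> Y \<phi> (p, q) =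
      frechet_derivative (\<lambda>y. \<phi> (inv_into (U \<times> V) (map_prod c d) y)) (at (map_prod c d (p, q))) (v1, v2)"
    using M.tangent_vector_exists[OF product_chart[OF U(1) V(1)] pq, of "(v1, v2)"] by metis
  show thesis
  proof (rule that[OF Y(1)])
    fix \<phi> assume \<phi>: "\<phi> \<in> M1.sm"
    show "slice1 q Y \<phi> p = X1 \<phi> p"
      unfolding slice1_apply Y(2)[OF sm_fst[OF \<phi>]] v1[OF \<phi>]
        frechet_derivative_at[OF has_derivative_fst_comp[OF U V \<phi>], symmetric] by simp
  next
    fix \<psi> assume \<psi>: "\<psi> \<in> M2.sm"
    show "slice2 p Y \<psi> q = X2 \<psi> q"
      unfolding slice2_apply Y(2)[OF sm_snd[OF \<psi>]] v2[OF \<psi>]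
        frechet_derivative_at[OF has_derivative_snd_comp[OF U V \<psi>], symmetric] by simp
  qed
qed

text \<open>In product charts this is additivity of the derivative of \<open>F\<close> in the two components of the direction; the two
  summands are the derivatives of the partial functions of \<open>F\<close>.\<close>
lemma VF_split:
  assumes Y: "Y \<in> M.VF" and F: "F \<in> M.sm"
  shows "Y F (p, q) = slice1 q Y (\<lambda>p. F (p, q)) p + slice2 p Y (\<lambda>q. F (p, q)) q"
proof -
  obtain U c where U: "(U, c) \<in> A1" "p \<in> U" by (rule M1.chart_at)
  obtain V d where V: "(V, d) \<in> A2" "q \<in> V" by (rule M2.chart_at)
  have pq: "(p, q) \<in> U \<times> V" using U V by simp
  note o = M1.chart(2)[OF U(1)] M2.chart(2)[OF V(1)]
  let ?e = "map_prod c d" and ?i = "inv_into (U \<times> V) (map_prod c d)"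
  let ?G = "\<lambda>y. F (?i y)"
  obtain v where v: "\<And>\<phi>. \<phi> \<in> M.sm \<Longrightarrow> Y \<phi> (p, q) = frechet_derivative (\<lambda>y. \<phi> (?i y)) (at (?e (p, q))) v"
    using M.tangent_vector_coordinates[OF product_chart[OF U(1) V(1)] pq Y] by metis
  define D where "D = frechet_derivative ?G (at (c p, d q))"
  have D: "(?G has_derivative D) (at (c p, d q))"
    unfolding D_def using pq
    by (intro smooth_on_has_derivative[OF M.sm_chart[OF F product_chart[OF U(1) V(1)]]]) auto
  then have lin: "linear D" by (auto intro: bounded_linear.linear has_derivative_bounded_linear)
  have "((\<lambda>y. F (?i (y, d q))) has_derivative (\<lambda>w. D (w, 0))) (at (c p))"
    by (rule has_derivative_compose[where f="\<lambda>y. (y, d q)", OF _ D]) (auto intro!: derivative_eq_intros)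
  then have "((\<lambda>y. F (inv_into U c y, q)) has_derivative (\<lambda>w. D (w, 0))) (at (c p))"
    by (rule has_derivative_transform_within_open[OF _ o(1)])
      (use U V M2.chart(5)[OF V] in \<open>auto simp: product_chart_inverse\<close>)
  note D1 = frechet_derivative_at[OF this, symmetric]
  have "((\<lambda>y. F (?i (c p, y))) has_derivative (\<lambda>w. D (0, w))) (at (d q))"
    by (rule has_derivative_compose[where f="\<lambda>y. (c p, y)", OF _ D]) (auto intro!: derivative_eq_intros)
  then have "((\<lambda>y. F (p, inv_into V d y)) has_derivative (\<lambda>w. D (0, w))) (at (d q))"
    by (rule has_derivative_transform_within_open[OF _ o(2)])
      (use U V M1.chart(5)[OF U] in \<open>auto simp: product_chart_inverse\<close>)
  note D2 = frechet_derivative_at[OF this, symmetric]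
  have "slice1 q Y (\<lambda>p. F (p, q)) p = D (fst v, 0)"
    unfolding slice1_apply v[OF sm_fst[OF sm_slice1[OF F]]]
      frechet_derivative_at[OF has_derivative_fst_comp[OF U V sm_slice1[OF F]], symmetric] D1 ..
  moreover have "slice2 p Y (\<lambda>q. F (p, q)) q = D (0, snd v)"
    unfolding slice2_apply v[OF sm_snd[OF sm_slice2[OF F]]]
      frechet_derivative_at[OF has_derivative_snd_comp[OF U V sm_slice2[OF F]], symmetric] D2 ..
  moreover have "Y F (p, q) = D ((fst v, 0) + (0, snd v))"
    unfolding v[OF F] by (simp add: D_def)
  ultimately show ?thesis by (simp only: linear_add[OF lin])
qed

end

section \<open>Lifts of forms and vector fields to the product\<close>

context product_manifold
begin

lemma hlift_apply: "X \<in> M.VF \<Longrightarrow> hlift A1 A2 \<omega> X (p, q) = \<omega> (slice1 q X) p"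
  by (simp add: hlift_def)

lemma hlift_outside: "X \<notin> M.VF \<Longrightarrow> hlift A1 A2 \<omega> X = 0"
  by (simp add: hlift_def)

lemma hlift_add: "hlift A1 A2 (\<omega> + \<eta>) = hlift A1 A2 \<omega> + hlift A1 A2 \<eta>"
  and hlift_diff: "hlift A1 A2 (\<omega> - \<eta>) = hlift A1 A2 \<omega> - hlift A1 A2 \<eta>"
  by (intro ext; auto simp: hlift_def)+

text \<open>Near a point the horizontal lift is a finite sum of products of smooth functions, by expansion in a
  frame of the first factor.\<close>
lemma hlift_FM:
  assumes \<omega>: "\<omega> \<in> M1.FM"
  shows "hlift A1 A2 \<omega> \<in> M.FM"
  unfolding M.FM_iff module_map_def
proof (intro conjI ballI allI impI)
  note mm = module_mapD[OF M1.FM_D(3)[OF \<omega>]]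
  show "hlift A1 A2 \<omega> X = 0" if "X \<notin> M.VF" for X by (rule hlift_outside[OF that])
  fix X assume X: "X \<in> M.VF"
  show "hlift A1 A2 \<omega> X \<in> M.sm"
  proof (rule M.sm_local)
    fix z :: "'a \<times> 'b"
    obtain N x E where F: "M1.dual_frame (fst z) N x E" by (rule M1.dual_frame_exists)
    note F' = M1.dual_frameD[OF F]
    let ?h = "\<Sum>b\<in>Basis. X (x b \<circ> fst) * (\<omega> (E b) \<circ> fst)"
    have "?h \<in> M.sm"
      by (intro M.sm_sum M.sm_mult M.VF_D(1)[OF X] sm_fst M1.FM_D(1)[OF \<omega>] F')
    moreover have "hlift A1 A2 \<omega> X w = ?h w" if w: "w \<in> N \<times> UNIV" for w
    proof -
      obtain p q where pq: "w = (p, q)" "p \<in> N" using w by auto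
      show ?thesis
        using M1.module_map_VF_expand[OF M1.FM_D(3)[OF \<omega>] F slice1_VF[OF X, of q] pq(2)]
        by (simp add: pq(1) hlift_apply[OF X] sum_fun_apply slice1_apply)
    qed
    moreover have "open (N \<times> UNIV)" "z \<in> N \<times> UNIV" using F'(1,2) by (auto intro: open_Times simp: mem_Times_iff)
    ultimately show "\<exists>N k. open N \<and> z \<in> N \<and> k \<in> M.sm \<and> (\<forall>x\<in>N. hlift A1 A2 \<omega> X x = k x)"
      by blast
  qed
  show "hlift A1 A2 \<omega> (X + Y) = hlift A1 A2 \<omega> X + hlift A1 A2 \<omega> Y" if Y: "Y \<in> M.VF" for Y
  proof
    fix z :: "'a \<times> 'b"
    show "hlift A1 A2 \<omega> (X + Y) z = (hlift A1 A2 \<omega> X + hlift A1 A2 \<omega> Y) z"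
      using mm(1)[OF slice1_VF[OF X] slice1_VF[OF Y]]
      by (cases z) (simp add: hlift_apply X Y M.VF_add slice1_add)
  qed
  show "hlift A1 A2 \<omega> (F \<odot> X) = F * hlift A1 A2 \<omega> X" if F: "F \<in> M.sm" for F
  proof
    fix z :: "'a \<times> 'b"
    show "hlift A1 A2 \<omega> (F \<odot> X) z = (F * hlift A1 A2 \<omega> X) z"
      using mm(2)[OF sm_slice1[OF F] slice1_VF[OF X]]
      by (cases z) (simp add: hlift_apply X F M.VF_scale slice1_scale)
  qed
qed

lemma ext_d_fst: "\<phi> \<in> M1.sm \<Longrightarrow> ext_d (prod_atlas A1 A2) (\<phi> \<circ> fst) = hlift A1 A2 (ext_d A1 \<phi>)"
  by (intro ext) (auto simp: ext_d_def hlift_def slice1_VF slice1_apply)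

lemma vlift_apply: "X \<in> M.VF \<Longrightarrow> vlift A1 A2 \<omega> X (p, q) = \<omega> (slice2 p X) q"
  by (simp add: vlift_def)

lemma vlift_outside: "X \<notin> M.VF \<Longrightarrow> vlift A1 A2 \<omega> X = 0"
  by (simp add: vlift_def)

lemma vlift_add: "vlift A1 A2 (\<omega> + \<eta>) = vlift A1 A2 \<omega> + vlift A1 A2 \<eta>"
  and vlift_diff: "vlift A1 A2 (\<omega> - \<eta>) = vlift A1 A2 \<omega> - vlift A1 A2 \<eta>"
  by (intro ext; auto simp: vlift_def)+

lemma vlift_FM:
  assumes \<omega>: "\<omega> \<in> M2.FM"
  shows "vlift A1 A2 \<omega> \<in> M.FM"
  unfolding M.FM_iff module_map_def
proof (intro conjI ballI allI impI)
  note mm = module_mapD[OF M2.FM_D(3)[OF \<omega>]]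
  show "vlift A1 A2 \<omega> X = 0" if "X \<notin> M.VF" for X by (rule vlift_outside[OF that])
  fix X assume X: "X \<in> M.VF"
  show "vlift A1 A2 \<omega> X \<in> M.sm"
  proof (rule M.sm_local)
    fix z :: "'a \<times> 'b"
    obtain N x E where F: "M2.dual_frame (snd z) N x E" by (rule M2.dual_frame_exists)
    note F' = M2.dual_frameD[OF F]
    let ?h = "\<Sum>b\<in>Basis. X (x b \<circ> snd) * (\<omega> (E b) \<circ> snd)"
    have "?h \<in> M.sm"
      by (intro M.sm_sum M.sm_mult M.VF_D(1)[OF X] sm_snd M2.FM_D(1)[OF \<omega>] F')
    moreover have "vlift A1 A2 \<omega> X w = ?h w" if w: "w \<in> UNIV \<times> N" for w
    proof -
      obtain p q where pq: "w = (p, q)" "q \<in> N" using w by auto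
      show ?thesis
        using M2.module_map_VF_expand[OF M2.FM_D(3)[OF \<omega>] F slice2_VF[OF X, of p] pq(2)]
        by (simp add: pq(1) vlift_apply[OF X] sum_fun_apply slice2_apply)
    qed
    moreover have "open (UNIV \<times> N)" "z \<in> UNIV \<times> N" using F'(1,2) by (auto intro: open_Times simp: mem_Times_iff)
    ultimately show "\<exists>N k. open N \<and> z \<in> N \<and> k \<in> M.sm \<and> (\<forall>x\<in>N. vlift A1 A2 \<omega> X x = k x)"
      by blast
  qed
  show "vlift A1 A2 \<omega> (X + Y) = vlift A1 A2 \<omega> X + vlift A1 A2 \<omega> Y" if Y: "Y \<in> M.VF" for Y
  proof
    fix z :: "'a \<times> 'b"
    show "vlift A1 A2 \<omega> (X + Y) z = (vlift A1 A2 \<omega> X + vlift A1 A2 \<omega> Y) z"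
      using mm(1)[OF slice2_VF[OF X] slice2_VF[OF Y]]
      by (cases z) (simp add: vlift_apply X Y M.VF_add slice2_add)
  qed
  show "vlift A1 A2 \<omega> (F \<odot> X) = F * vlift A1 A2 \<omega> X" if F: "F \<in> M.sm" for F
  proof
    fix z :: "'a \<times> 'b"
    show "vlift A1 A2 \<omega> (F \<odot> X) z = (F * vlift A1 A2 \<omega> X) z"
      using mm(2)[OF sm_slice2[OF F] slice2_VF[OF X]]
      by (cases z) (simp add: vlift_apply X F M.VF_scale slice2_scale)
  qed
qed

lemma ext_d_snd: "\<phi> \<in> M2.sm \<Longrightarrow> ext_d (prod_atlas A1 A2) (\<phi> \<circ> snd) = vlift A1 A2 (ext_d A2 \<phi>)"
  by (intro ext) (auto simp: ext_d_def vlift_def slice2_VF slice2_apply)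

text \<open>The horizontal lift of a vector field, as a property of a given field on the product: the sharp of a lifted
  form is already a vector field, so lifts need not be constructed.\<close>
definition horizontal :: "'a vector_field \<Rightarrow> ('a \<times> 'b) vector_field \<Rightarrow> bool" where
  "horizontal X S \<longleftrightarrow> X \<in> M1.VF \<and> S \<in> M.VF \<and> (\<forall>F\<in>M.sm. \<forall>p q. S F (p, q) = X (\<lambda>p. F (p, q)) p)"

lemma horizontalD:
  assumes "horizontal X S"
  shows "X \<in> M1.VF" "S \<in> M.VF" "F \<in> M.sm \<Longrightarrow> S F (p, q) = X (\<lambda>p. F (p, q)) p"
  using assms by (auto simp: horizontal_def)

lemma horizontal_fst:
  assumes S: "horizontal X S" and \<phi>: "\<phi> \<in> M1.sm"
  shows "S (\<phi> \<circ> fst) = X \<phi> \<circ> fst"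
proof
  fix z show "S (\<phi> \<circ> fst) z = (X \<phi> \<circ> fst) z"
    using horizontalD(3)[OF S sm_fst[OF \<phi>], of "fst z" "snd z"] by simp
qed

lemma horizontal_snd:
  assumes S: "horizontal X S" and \<phi>: "\<phi> \<in> M2.sm"
  shows "S (\<phi> \<circ> snd) = 0"
proof
  fix z show "S (\<phi> \<circ> snd) z = 0 z"
    using horizontalD(3)[OF S sm_snd[OF \<phi>], of "fst z" "snd z"]
    by (simp add: M1.VF_const[OF horizontalD(1)[OF S]])
qed

text \<open>A horizontal lift and its field are related under the first projection, and so are brackets with them.\<close>
lemma slice1_bracket_horizontal:
  assumes S: "horizontal X S" and Y: "Y \<in> M.VF"
  shows "slice1 q (lie_bracket S Y) = lie_bracket X (slice1 q Y)"
proof (rule M1.VF_eqI)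
  note H = horizontalD[OF S]
  show "slice1 q (lie_bracket S Y) \<in> M1.VF" by (intro slice1_VF M.lie_bracket_VF H Y)
  show "lie_bracket X (slice1 q Y) \<in> M1.VF" by (intro slice1_VF M1.lie_bracket_VF H Y)
  fix \<phi> p assume \<phi>: "\<phi> \<in> M1.sm"
  have "S (Y (\<phi> \<circ> fst)) (p, q) = X (slice1 q Y \<phi>) p"
    unfolding slice1_def by (rule H(3)[OF M.VF_D(1)[OF Y sm_fst[OF \<phi>]]])
  then show "slice1 q (lie_bracket S Y) \<phi> p = lie_bracket X (slice1 q Y) \<phi> p"
    by (simp add: slice1_apply lie_bracket_def horizontal_fst[OF S \<phi>])
qed

text \<open>The vertical part of the bracket is the derivative of the vertical part of \<open>Y\<close> along the first factor, because
  \<open>S\<close> kills the functions of the second factor.\<close>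
lemma slice2_bracket_horizontal:
  assumes S: "horizontal X S" and Y: "Y \<in> M.VF" and \<psi>: "\<psi> \<in> M2.sm"
  shows "slice2 p (lie_bracket S Y) \<psi> q = X (\<lambda>p. slice2 p Y \<psi> q) p"
proof -
  note H = horizontalD[OF S]
  have "S (Y (\<psi> \<circ> snd)) (p, q) = X (\<lambda>p. slice2 p Y \<psi> q) p"
    unfolding slice2_def by (rule H(3)[OF M.VF_D(1)[OF Y sm_snd[OF \<psi>]]])
  then show ?thesis
    by (simp add: slice2_apply lie_bracket_def horizontal_snd[OF S \<psi>] M.VF_fun_zero[OF Y])
qed

lemma lie_form_horizontal_hlift:
  assumes S: "horizontal X S" and \<eta>: "\<eta> \<in> M1.FM"
  shows "lie_form (prod_atlas A1 A2) S (hlift A1 A2 \<eta>) = hlift A1 A2 (lie_form A1 X \<eta>)"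
proof (intro ext)
  note H = horizontalD[OF S]
  fix Y and z :: "'a \<times> 'b"
  obtain p q where z: "z = (p, q)" by (cases z)
  show "lie_form (prod_atlas A1 A2) S (hlift A1 A2 \<eta>) Y z = hlift A1 A2 (lie_form A1 X \<eta>) Y z"
  proof (cases "Y \<in> M.VF")
    case Y: True
    have "S (hlift A1 A2 \<eta> Y) (p, q) = X (\<eta> (slice1 q Y)) p"
      using H(3)[OF M.FM_D(1)[OF hlift_FM[OF \<eta>] Y]] by (simp add: hlift_apply[OF Y])
    then show ?thesis
      using Y by (simp add: z lie_form_def hlift_apply slice1_VF M.lie_bracket_VF[OF H(2)]
          slice1_bracket_horizontal[OF S])
  qed (simp add: lie_form_def hlift_outside)
qed

text \<open>The vertical lift of a form has coefficients that are constant in the horizontal direction, so the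
  horizontal derivative passes through it; this is checked on the coefficients in a frame.\<close>
lemma lie_form_horizontal_vlift:
  assumes S: "horizontal X S" and \<eta>: "\<eta> \<in> M2.FM"
  shows "lie_form (prod_atlas A1 A2) S (vlift A1 A2 \<eta>) = 0"
proof (intro ext)
  note H = horizontalD[OF S]
  fix Y and z :: "'a \<times> 'b"
  obtain p q where z: "z = (p, q)" by (cases z)
  show "lie_form (prod_atlas A1 A2) S (vlift A1 A2 \<eta>) Y z = 0 Y z"
  proof (cases "Y \<in> M.VF")
    case Y: True
    obtain N y E where F: "M2.dual_frame q N y E" by (rule M2.dual_frame_exists)
    note F' = M2.dual_frameD[OF F]
    have ex: "\<eta> Z q = (\<Sum>b\<in>Basis. Z (y b) q * \<eta> (E b) q)" if "Z \<in> M2.VF" for Z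
      by (rule M2.module_map_VF_expand[OF M2.FM_D(3)[OF \<eta>] F that F'(2)])
    let ?h = "\<lambda>b p. slice2 p Y (y b) q"
    have h: "?h b \<in> M1.sm" for b
      unfolding slice2_apply by (intro sm_slice1 M.VF_D(1)[OF Y] sm_snd F')
    have "S (vlift A1 A2 \<eta> Y) (p, q) = X (\<lambda>p. \<eta> (slice2 p Y) q) p"
      using H(3)[OF M.FM_D(1)[OF vlift_FM[OF \<eta>] Y]] by (simp add: vlift_apply[OF Y])
    also have "(\<lambda>p. \<eta> (slice2 p Y) q) = (\<Sum>b\<in>Basis. (\<lambda>_. \<eta> (E b) q) * ?h b)"
      by (intro ext) (simp add: ex[OF slice2_VF[OF Y]] sum_fun_apply mult.commute)
    also have "X \<dots> = (\<Sum>b\<in>Basis. (\<lambda>_. \<eta> (E b) q) * X (?h b))"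
      by (subst M1.VF_fun_sum[OF H(1)]) (simp_all only: M1.sm_mult M1.sm_const h M1.VF_D(4)[OF H(1)])
    also have "\<dots> p = (\<Sum>b\<in>Basis. slice2 p (lie_bracket S Y) (y b) q * \<eta> (E b) q)"
      by (simp add: sum_fun_apply slice2_bracket_horizontal[OF S Y F'(3)] mult.commute)
    also have "\<dots> = vlift A1 A2 \<eta> (lie_bracket S Y) (p, q)"
      by (simp add: vlift_apply M.lie_bracket_VF[OF H(2) Y] ex slice2_VF)
    finally show ?thesis using Y by (simp add: z lie_form_def)
  qed (simp add: lie_form_def)
qed

definition vertical :: "'b vector_field \<Rightarrow> ('a \<times> 'b) vector_field \<Rightarrow> bool" where
  "vertical X S \<longleftrightarrow> X \<in> M2.VF \<and> S \<in> M.VF \<and> (\<forall>F\<in>M.sm. \<forall>p q. S F (p, q) = X (\<lambda>q. F (p, q)) q)"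

lemma verticalD:
  assumes "vertical X S"
  shows "X \<in> M2.VF" "S \<in> M.VF" "F \<in> M.sm \<Longrightarrow> S F (p, q) = X (\<lambda>q. F (p, q)) q"
  using assms by (auto simp: vertical_def)

lemma vertical_snd:
  assumes S: "vertical X S" and \<phi>: "\<phi> \<in> M2.sm"
  shows "S (\<phi> \<circ> snd) = X \<phi> \<circ> snd"
proof
  fix z show "S (\<phi> \<circ> snd) z = (X \<phi> \<circ> snd) z"
    using verticalD(3)[OF S sm_snd[OF \<phi>], of "fst z" "snd z"] by simp
qed

lemma vertical_fst:
  assumes S: "vertical X S" and \<phi>: "\<phi> \<in> M1.sm"
  shows "S (\<phi> \<circ> fst) = 0"
proof
  fix z show "S (\<phi> \<circ> fst) z = 0 z"
    using verticalD(3)[OF S sm_fst[OF \<phi>], of "fst z" "snd z"]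
    by (simp add: M2.VF_const[OF verticalD(1)[OF S]])
qed

lemma slice2_bracket_vertical:
  assumes S: "vertical X S" and Y: "Y \<in> M.VF"
  shows "slice2 p (lie_bracket S Y) = lie_bracket X (slice2 p Y)"
proof (rule M2.VF_eqI)
  note H = verticalD[OF S]
  show "slice2 p (lie_bracket S Y) \<in> M2.VF" by (intro slice2_VF M.lie_bracket_VF H Y)
  show "lie_bracket X (slice2 p Y) \<in> M2.VF" by (intro slice2_VF M2.lie_bracket_VF H Y)
  fix \<phi> q assume \<phi>: "\<phi> \<in> M2.sm"
  have "S (Y (\<phi> \<circ> snd)) (p, q) = X (slice2 p Y \<phi>) q"
    unfolding slice2_def by (rule H(3)[OF M.VF_D(1)[OF Y sm_snd[OF \<phi>]]])
  then show "slice2 p (lie_bracket S Y) \<phi> q = lie_bracket X (slice2 p Y) \<phi> q"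
    by (simp add: slice2_apply lie_bracket_def vertical_snd[OF S \<phi>])
qed

lemma slice1_bracket_vertical:
  assumes S: "vertical X S" and Y: "Y \<in> M.VF" and \<psi>: "\<psi> \<in> M1.sm"
  shows "slice1 q (lie_bracket S Y) \<psi> p = X (\<lambda>q. slice1 q Y \<psi> p) q"
proof -
  note H = verticalD[OF S]
  have "S (Y (\<psi> \<circ> fst)) (p, q) = X (\<lambda>q. slice1 q Y \<psi> p) q"
    unfolding slice1_def by (rule H(3)[OF M.VF_D(1)[OF Y sm_fst[OF \<psi>]]])
  then show ?thesis
    by (simp add: slice1_apply lie_bracket_def vertical_fst[OF S \<psi>] M.VF_fun_zero[OF Y])
qed

lemma lie_form_vertical_vlift:
  assumes S: "vertical X S" and \<eta>: "\<eta> \<in> M2.FM"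
  shows "lie_form (prod_atlas A1 A2) S (vlift A1 A2 \<eta>) = vlift A1 A2 (lie_form A2 X \<eta>)"
proof (intro ext)
  note H = verticalD[OF S]
  fix Y and z :: "'a \<times> 'b"
  obtain p q where z: "z = (p, q)" by (cases z)
  show "lie_form (prod_atlas A1 A2) S (vlift A1 A2 \<eta>) Y z = vlift A1 A2 (lie_form A2 X \<eta>) Y z"
  proof (cases "Y \<in> M.VF")
    case Y: True
    have "S (vlift A1 A2 \<eta> Y) (p, q) = X (\<eta> (slice2 p Y)) q"
      using H(3)[OF M.FM_D(1)[OF vlift_FM[OF \<eta>] Y]] by (simp add: vlift_apply[OF Y])
    then show ?thesis
      using Y by (simp add: z lie_form_def vlift_apply slice2_VF M.lie_bracket_VF[OF H(2)]
          slice2_bracket_vertical[OF S])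
  qed (simp add: lie_form_def vlift_outside)
qed

lemma lie_form_vertical_hlift:
  assumes S: "vertical X S" and \<eta>: "\<eta> \<in> M1.FM"
  shows "lie_form (prod_atlas A1 A2) S (hlift A1 A2 \<eta>) = 0"
proof (intro ext)
  note H = verticalD[OF S]
  fix Y and z :: "'a \<times> 'b"
  obtain p q where z: "z = (p, q)" by (cases z)
  show "lie_form (prod_atlas A1 A2) S (hlift A1 A2 \<eta>) Y z = 0 Y z"
  proof (cases "Y \<in> M.VF")
    case Y: True
    obtain N y E where F: "M1.dual_frame p N y E" by (rule M1.dual_frame_exists)
    note F' = M1.dual_frameD[OF F]
    have ex: "\<eta> Z p = (\<Sum>b\<in>Basis. Z (y b) p * \<eta> (E b) p)" if "Z \<in> M1.VF" for Z
      by (rule M1.module_map_VF_expand[OF M1.FM_D(3)[OF \<eta>] F that F'(2)])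
    let ?h = "\<lambda>b q. slice1 q Y (y b) p"
    have h: "?h b \<in> M2.sm" for b
      unfolding slice1_apply by (intro sm_slice2 M.VF_D(1)[OF Y] sm_fst F')
    have "S (hlift A1 A2 \<eta> Y) (p, q) = X (\<lambda>q. \<eta> (slice1 q Y) p) q"
      using H(3)[OF M.FM_D(1)[OF hlift_FM[OF \<eta>] Y]] by (simp add: hlift_apply[OF Y])
    also have "(\<lambda>q. \<eta> (slice1 q Y) p) = (\<Sum>b\<in>Basis. (\<lambda>_. \<eta> (E b) p) * ?h b)"
      by (intro ext) (simp add: ex[OF slice1_VF[OF Y]] sum_fun_apply mult.commute)
    also have "X \<dots> = (\<Sum>b\<in>Basis. (\<lambda>_. \<eta> (E b) p) * X (?h b))"
      by (subst M2.VF_fun_sum[OF H(1)]) (simp_all only: M2.sm_mult M2.sm_const h M2.VF_D(4)[OF H(1)])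
    also have "\<dots> q = (\<Sum>b\<in>Basis. slice1 q (lie_bracket S Y) (y b) p * \<eta> (E b) p)"
      by (simp add: sum_fun_apply slice1_bracket_vertical[OF S Y F'(3)] mult.commute)
    also have "\<dots> = hlift A1 A2 \<eta> (lie_bracket S Y) (p, q)"
      by (simp add: hlift_apply M.lie_bracket_VF[OF H(2) Y] ex slice1_VF)
    finally show ?thesis using Y by (simp add: z lie_form_def)
  qed (simp add: lie_form_def)
qed

section \<open>The Koszul bracket of lifts\<close>

context
  fixes P1 :: "'a co_two_tensor" and P2 :: "'b co_two_tensor" and P :: "('a \<times> 'b) co_two_tensor"
  assumes P1: "bivector_field A1 P1" and P2: "bivector_field A2 P2"
    and P: "product_bivector A1 A2 P1 P2 P"
begin

lemma product_D:
  shows "bivector_field (prod_atlas A1 A2) P"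
    "\<omega> \<in> M1.FM \<Longrightarrow> \<omega>' \<in> M1.FM \<Longrightarrow> P (hlift A1 A2 \<omega>) (hlift A1 A2 \<omega>') = P1 \<omega> \<omega>' \<circ> fst"
    "\<omega> \<in> M1.FM \<Longrightarrow> \<eta> \<in> M2.FM \<Longrightarrow> P (hlift A1 A2 \<omega>) (vlift A1 A2 \<eta>) = 0"
    "\<eta> \<in> M2.FM \<Longrightarrow> \<eta>' \<in> M2.FM \<Longrightarrow> P (vlift A1 A2 \<eta>) (vlift A1 A2 \<eta>') = P2 \<eta> \<eta>' \<circ> snd"
    "\<omega> \<in> M1.FM \<Longrightarrow> \<eta> \<in> M2.FM \<Longrightarrow> P (vlift A1 A2 \<eta>) (hlift A1 A2 \<omega>) = 0"
proof -
  show 1: "bivector_field (prod_atlas A1 A2) P" using P by (simp add: product_bivector_def)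
  show "\<omega> \<in> M1.FM \<Longrightarrow> \<omega>' \<in> M1.FM \<Longrightarrow> P (hlift A1 A2 \<omega>) (hlift A1 A2 \<omega>') = P1 \<omega> \<omega>' \<circ> fst"
    using P unfolding product_bivector_def by blast
  show 3: "\<omega> \<in> M1.FM \<Longrightarrow> \<eta> \<in> M2.FM \<Longrightarrow> P (hlift A1 A2 \<omega>) (vlift A1 A2 \<eta>) = 0"
    using P unfolding product_bivector_def by blast
  show "\<eta> \<in> M2.FM \<Longrightarrow> \<eta>' \<in> M2.FM \<Longrightarrow> P (vlift A1 A2 \<eta>) (vlift A1 A2 \<eta>') = P2 \<eta> \<eta>' \<circ> snd"
    using P unfolding product_bivector_def by blast
  show "P (vlift A1 A2 \<eta>) (hlift A1 A2 \<omega>) = 0" if "\<omega> \<in> M1.FM" "\<eta> \<in> M2.FM"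
    unfolding M.bivector_D(2)[OF 1 vlift_FM[OF that(2)] hlift_FM[OF that(1)]] 3[OF that] by simp
qed

text \<open>The splitting of tangent vectors, read as a splitting of the differential.\<close>
lemma ext_d_split:
  assumes F: "F \<in> M.sm" and Y: "Y \<in> M.VF"
  shows "ext_d (prod_atlas A1 A2) F Y (p, q) =
    (hlift A1 A2 (ext_d A1 (\<lambda>p. F (p, q))) + vlift A1 A2 (ext_d A2 (\<lambda>q. F (p, q)))) Y (p, q)"
  using VF_split[OF Y F, of p q]
  by (simp add: M.ext_d_apply[OF Y] hlift_apply[OF Y] vlift_apply[OF Y]
      M1.ext_d_apply[OF slice1_VF[OF Y]] M2.ext_d_apply[OF slice2_VF[OF Y]])

lemma bivector_ext_d_split:
  assumes \<omega>: "\<omega> \<in> M.FM" and F: "F \<in> M.sm"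
  shows "P \<omega> (ext_d (prod_atlas A1 A2) F) (p, q) =
    P \<omega> (hlift A1 A2 (ext_d A1 (\<lambda>p. F (p, q)))) (p, q) + P \<omega> (vlift A1 A2 (ext_d A2 (\<lambda>q. F (p, q)))) (p, q)"
proof -
  note lifts = hlift_FM[OF M1.ext_d_FM[OF sm_slice1[OF F]], of q]
    vlift_FM[OF M2.ext_d_FM[OF sm_slice2[OF F]], of p]
  note mm = M.bivector_D(4)[OF product_D(1) \<omega>]
  have "P \<omega> (ext_d (prod_atlas A1 A2) F) (p, q) =
      P \<omega> (hlift A1 A2 (ext_d A1 (\<lambda>p. F (p, q))) + vlift A1 A2 (ext_d A2 (\<lambda>q. F (p, q)))) (p, q)"
    by (rule M.module_map_FM_cong[OF mm M.ext_d_FM[OF F] M.FM_add[OF lifts] ext_d_split[OF F]])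
  then show ?thesis unfolding module_mapD(1)[OF mm lifts] by (simp only: plus_fun_apply)
qed

text \<open>Split the differential of \<open>F\<close> at \<open>(p, q)\<close> into lifts; the product bivector field pairs a horizontal lift only
  with the horizontal part.\<close>
lemma horizontal_sharp:
  assumes \<omega>: "\<omega> \<in> M1.FM"
  shows "horizontal (poisson_sharp A1 P1 \<omega>) (poisson_sharp (prod_atlas A1 A2) P (hlift A1 A2 \<omega>))"
  unfolding horizontal_def
proof (intro conjI ballI allI)
  note h = hlift_FM[OF \<omega>]
  show "poisson_sharp A1 P1 \<omega> \<in> M1.VF" by (rule M1.poisson_sharp(1)[OF P1 \<omega>])
  show "poisson_sharp (prod_atlas A1 A2) P (hlift A1 A2 \<omega>) \<in> M.VF" by (rule M.poisson_sharp(1)[OF product_D(1) h])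
  fix F p q assume F: "F \<in> M.sm"
  show "poisson_sharp (prod_atlas A1 A2) P (hlift A1 A2 \<omega>) F (p, q) = poisson_sharp A1 P1 \<omega> (\<lambda>p. F (p, q)) p"
    unfolding M.poisson_sharp(3)[OF product_D(1) h F] M1.poisson_sharp(3)[OF P1 \<omega> sm_slice1[OF F]]
      bivector_ext_d_split[OF h F] product_D(2)[OF \<omega> M1.ext_d_FM[OF sm_slice1[OF F]]]
      product_D(3)[OF \<omega> M2.ext_d_FM[OF sm_slice2[OF F]]] by simp
qed

lemma vertical_sharp:
  assumes \<omega>: "\<omega> \<in> M2.FM"
  shows "vertical (poisson_sharp A2 P2 \<omega>) (poisson_sharp (prod_atlas A1 A2) P (vlift A1 A2 \<omega>))"
  unfolding vertical_def
proof (intro conjI ballI allI)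
  note v = vlift_FM[OF \<omega>]
  show "poisson_sharp A2 P2 \<omega> \<in> M2.VF" by (rule M2.poisson_sharp(1)[OF P2 \<omega>])
  show "poisson_sharp (prod_atlas A1 A2) P (vlift A1 A2 \<omega>) \<in> M.VF" by (rule M.poisson_sharp(1)[OF product_D(1) v])
  fix F p q assume F: "F \<in> M.sm"
  show "poisson_sharp (prod_atlas A1 A2) P (vlift A1 A2 \<omega>) F (p, q) = poisson_sharp A2 P2 \<omega> (\<lambda>q. F (p, q)) q"
    unfolding M.poisson_sharp(3)[OF product_D(1) v F] M2.poisson_sharp(3)[OF P2 \<omega> sm_slice2[OF F]]
      bivector_ext_d_split[OF v F] product_D(4)[OF \<omega> M2.ext_d_FM[OF sm_slice2[OF F]]]
      product_D(5)[OF M1.ext_d_FM[OF sm_slice1[OF F]] \<omega>] by simp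
qed

lemma ext_d_zero: "ext_d (prod_atlas A1 A2) 0 = 0"
  by (intro ext) (auto simp: ext_d_def M.VF_fun_zero)

lemma koszul_hh:
  assumes "\<omega> \<in> M1.FM" "\<eta> \<in> M1.FM"
  shows "koszul_bracket (prod_atlas A1 A2) P (hlift A1 A2 \<omega>) (hlift A1 A2 \<eta>) = hlift A1 A2 (koszul_bracket A1 P1 \<omega> \<eta>)"
  unfolding koszul_bracket_def hlift_diff product_D(2)[OF assms]
    lie_form_horizontal_hlift[OF horizontal_sharp[OF assms(1)] assms(2)]
    lie_form_horizontal_hlift[OF horizontal_sharp[OF assms(2)] assms(1)]
    ext_d_fst[OF M1.bivector_D(1)[OF P1 assms]] ..

lemma koszul_vv:
  assumes "\<omega> \<in> M2.FM" "\<eta> \<in> M2.FM"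
  shows "koszul_bracket (prod_atlas A1 A2) P (vlift A1 A2 \<omega>) (vlift A1 A2 \<eta>) = vlift A1 A2 (koszul_bracket A2 P2 \<omega> \<eta>)"
  unfolding koszul_bracket_def vlift_diff product_D(4)[OF assms]
    lie_form_vertical_vlift[OF vertical_sharp[OF assms(1)] assms(2)]
    lie_form_vertical_vlift[OF vertical_sharp[OF assms(2)] assms(1)]
    ext_d_snd[OF M2.bivector_D(1)[OF P2 assms]] ..

text \<open>All three terms of the bracket vanish: both Lie derivatives go across the factors, and the bivector field is
  zero on mixed pairs.\<close>
lemma koszul_hv:
  assumes "\<omega> \<in> M1.FM" "\<eta> \<in> M2.FM"
  shows "koszul_bracket (prod_atlas A1 A2) P (hlift A1 A2 \<omega>) (vlift A1 A2 \<eta>) = 0"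
    "koszul_bracket (prod_atlas A1 A2) P (vlift A1 A2 \<eta>) (hlift A1 A2 \<omega>) = 0"
  unfolding koszul_bracket_def product_D(3)[OF assms] product_D(5)[OF assms] ext_d_zero
    lie_form_horizontal_vlift[OF horizontal_sharp[OF assms(1)] assms(2)]
    lie_form_vertical_hlift[OF vertical_sharp[OF assms(2)] assms(1)] by simp_all

end

section \<open>The cometric of a warped metric\<close>

context
  fixes g1 :: "'a two_tensor" and g2 :: "'b two_tensor" and f :: "'a \<Rightarrow> real"
  assumes g1: "pseudo_riemannian A1 g1" and g2: "pseudo_riemannian A2 g2"
    and f: "f \<in> M1.sm" and fpos: "\<forall>p. f p > 0"
begin

abbreviation w :: "('a \<times> 'b) two_tensor" where "w \<equiv> warped_metric f g1 g2"

lemma warped_apply: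
  "w X Y (p, q) = g1 (slice1 q X) (slice1 q Y) p + (f p)\<^sup>2 * g2 (slice2 p X) (slice2 p Y) q"
  by (simp add: warped_metric_def)

text \<open>Near a point both summands are finite sums of products of smooth functions, by expansion in frames of
  the two factors.\<close>
lemma warped_smooth:
  assumes X: "X \<in> M.VF" and Y: "Y \<in> M.VF"
  shows "w X Y \<in> M.sm"
proof (rule M.sm_local)
  fix z :: "'a \<times> 'b"
  obtain N1 x E where F1: "M1.dual_frame (fst z) N1 x E" by (rule M1.dual_frame_exists)
  obtain N2 y G where F2: "M2.dual_frame (snd z) N2 y G" by (rule M2.dual_frame_exists)
  note D1 = M1.dual_frameD[OF F1] and D2 = M2.dual_frameD[OF F2]
  let ?h = "(\<Sum>b\<in>Basis. X (x b \<circ> fst) * (\<Sum>c\<in>Basis. Y (x c \<circ> fst) * (g1 (E b) (E c) \<circ> fst))) +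
    (f \<circ> fst) * (f \<circ> fst) *
    (\<Sum>b\<in>Basis. X (y b \<circ> snd) * (\<Sum>c\<in>Basis. Y (y c \<circ> snd) * (g2 (G b) (G c) \<circ> snd)))"
  have "?h \<in> M.sm"
    by (intro M.sm_add M.sm_sum M.sm_mult M.VF_D(1)[OF X] M.VF_D(1)[OF Y] sm_fst sm_snd f
        M1.metric_D(1)[OF g1] M2.metric_D(1)[OF g2] D1 D2)
  moreover have "w X Y u = ?h u" if "u \<in> N1 \<times> N2" for u
  proof -
    obtain p q where u: "u = (p, q)" "p \<in> N1" "q \<in> N2" using \<open>u \<in> N1 \<times> N2\<close> by auto
    have "g1 (slice1 q X) (slice1 q Y) p =
        (\<Sum>b\<in>Basis. slice1 q X (x b) p * (\<Sum>c\<in>Basis. slice1 q Y (x c) p * g1 (E b) (E c) p))"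
      using M1.module_map_VF_expand[OF M1.metric_D(3)[OF g1 slice1_VF[OF Y]] F1 slice1_VF[OF X] u(2)]
        M1.module_map_VF_expand[OF M1.metric_D(4)[OF g1 D1(4)] F1 slice1_VF[OF Y] u(2)] by simp
    moreover have "g2 (slice2 p X) (slice2 p Y) q =
        (\<Sum>b\<in>Basis. slice2 p X (y b) q * (\<Sum>c\<in>Basis. slice2 p Y (y c) q * g2 (G b) (G c) q))"
      using M2.module_map_VF_expand[OF M2.metric_D(3)[OF g2 slice2_VF[OF Y]] F2 slice2_VF[OF X] u(3)]
        M2.module_map_VF_expand[OF M2.metric_D(4)[OF g2 D2(4)] F2 slice2_VF[OF Y] u(3)] by simp
    ultimately show ?thesis
      by (simp add: u(1) warped_apply sum_fun_apply slice1_apply slice2_apply power2_eq_square)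
  qed
  moreover have "open (N1 \<times> N2)" "z \<in> N1 \<times> N2"
    using D1(1,2) D2(1,2) by (auto intro: open_Times simp: mem_Times_iff)
  ultimately show "\<exists>N k. open N \<and> z \<in> N \<and> k \<in> M.sm \<and> (\<forall>x\<in>N. w X Y x = k x)" by blast
qed

text \<open>A field \<open>Y\<close> that is tangent to the first factor at \<open>(p, q)\<close> makes the second summand of the warped metric zero.\<close>
lemma warped_test_first:
  assumes X: "X \<in> M.VF" and \<omega>: "\<And>Y. Y \<in> M.VF \<Longrightarrow> w X Y (p, q) = \<omega> (slice1 q Y) p"
    and mm: "module_map M1.sm M1.VF \<omega>" and Y1: "Y1 \<in> M1.VF"
  shows "g1 (slice1 q X) Y1 p = \<omega> Y1 p"
proof -
  obtain Y where Y: "Y \<in> M.VF" "\<And>\<phi>. \<phi> \<in> M1.sm \<Longrightarrow> slice1 q Y \<phi> p = Y1 \<phi> p"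
    "\<And>\<psi>. \<psi> \<in> M2.sm \<Longrightarrow> slice2 p Y \<psi> q = 0 \<psi> q"
    using tangent_vectors_lift[OF Y1 M2.VF_zero] by metis
  have "g1 (slice1 q X) (slice1 q Y) p = g1 (slice1 q X) Y1 p"
    by (rule M1.module_map_VF_cong[OF M1.metric_D(4)[OF g1 slice1_VF[OF X]] slice1_VF[OF Y(1)] Y1 Y(2)])
  moreover have "g2 (slice2 p X) (slice2 p Y) q = g2 (slice2 p X) 0 q"
    by (rule M2.module_map_VF_cong[OF M2.metric_D(4)[OF g2 slice2_VF[OF X]] slice2_VF[OF Y(1)] M2.VF_zero Y(3)])
  moreover have "g2 (slice2 p X) 0 = 0"
    by (rule module_map_zero[OF M2.metric_D(4)[OF g2 slice2_VF[OF X]] M2.sm_zero M2.VF_zero])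
  moreover have "\<omega> (slice1 q Y) p = \<omega> Y1 p"
    by (rule M1.module_map_VF_cong[OF mm slice1_VF[OF Y(1)] Y1 Y(2)])
  ultimately show ?thesis using \<omega>[OF Y(1)] by (simp add: warped_apply)
qed

lemma warped_test_second:
  assumes X: "X \<in> M.VF" and \<omega>: "\<And>Y. Y \<in> M.VF \<Longrightarrow> w X Y (p, q) = \<omega> (slice2 p Y) q"
    and mm: "module_map M2.sm M2.VF \<omega>" and Y2: "Y2 \<in> M2.VF"
  shows "(f p)\<^sup>2 * g2 (slice2 p X) Y2 q = \<omega> Y2 q"
proof -
  obtain Y where Y: "Y \<in> M.VF" "\<And>\<phi>. \<phi> \<in> M1.sm \<Longrightarrow> slice1 q Y \<phi> p = 0 \<phi> p"
    "\<And>\<psi>. \<psi> \<in> M2.sm \<Longrightarrow> slice2 p Y \<psi> q = Y2 \<psi> q"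
    using tangent_vectors_lift[OF M1.VF_zero Y2] by metis
  have "g2 (slice2 p X) (slice2 p Y) q = g2 (slice2 p X) Y2 q"
    by (rule M2.module_map_VF_cong[OF M2.metric_D(4)[OF g2 slice2_VF[OF X]] slice2_VF[OF Y(1)] Y2 Y(3)])
  moreover have "g1 (slice1 q X) (slice1 q Y) p = g1 (slice1 q X) 0 p"
    by (rule M1.module_map_VF_cong[OF M1.metric_D(4)[OF g1 slice1_VF[OF X]] slice1_VF[OF Y(1)] M1.VF_zero Y(2)])
  moreover have "g1 (slice1 q X) 0 = 0"
    by (rule module_map_zero[OF M1.metric_D(4)[OF g1 slice1_VF[OF X]] M1.sm_zero M1.VF_zero])
  moreover have "\<omega> (slice2 p Y) q = \<omega> Y2 q"
    by (rule M2.module_map_VF_cong[OF mm slice2_VF[OF Y(1)] Y2 Y(3)])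
  ultimately show ?thesis using \<omega>[OF Y(1)] by (simp add: warped_apply)
qed

lemma vertical_part_zero:
  assumes X: "X \<in> M.VF" and zero: "\<And>Y2. Y2 \<in> M2.VF \<Longrightarrow> (f p)\<^sup>2 * g2 (slice2 p X) Y2 q = 0"
    and \<psi>: "\<psi> \<in> M2.sm"
  shows "slice2 p X \<psi> q = 0"
proof -
  have fp: "f p \<noteq> 0" using fpos by (metis less_irrefl)
  have "g2 (slice2 p X) Y2 q = 0" if "Y2 \<in> M2.VF" for Y2
    using zero[OF that] fp by simp
  then show ?thesis by (rule M2.metric_D(5)[OF g2 slice2_VF[OF X] _ \<psi>])
qed

lemma pseudo_riemannian_warped: "pseudo_riemannian (prod_atlas A1 A2) w"
  unfolding pseudo_riemannian_def
proof (intro conjI ballI allI impI)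
  fix X assume X: "X \<in> M.VF"
  fix Y assume Y: "Y \<in> M.VF"
  show "w X Y \<in> M.sm" by (rule warped_smooth[OF X Y])
  show "w X Y = w Y X"
  proof
    fix z :: "'a \<times> 'b"
    show "w X Y z = w Y X z"
      using M1.metric_D(2)[OF g1 slice1_VF[OF X] slice1_VF[OF Y]]
        M2.metric_D(2)[OF g2 slice2_VF[OF X] slice2_VF[OF Y]]
      by (cases z) (simp add: warped_apply)
  qed
  fix Z assume Z: "Z \<in> M.VF"
  show "w (X + Y) Z = w X Z + w Y Z"
  proof
    fix z :: "'a \<times> 'b"
    show "w (X + Y) Z z = (w X Z + w Y Z) z"
      using module_mapD(1)[OF M1.metric_D(3)[OF g1 slice1_VF[OF Z]] slice1_VF[OF X] slice1_VF[OF Y]]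
        module_mapD(1)[OF M2.metric_D(3)[OF g2 slice2_VF[OF Z]] slice2_VF[OF X] slice2_VF[OF Y]]
      by (cases z) (simp add: warped_apply slice1_add slice2_add algebra_simps)
  qed
next
  fix F X Y assume F: "F \<in> M.sm" and X: "X \<in> M.VF" and Y: "Y \<in> M.VF"
  show "w (F \<odot> X) Y = F * w X Y"
  proof
    fix z :: "'a \<times> 'b"
    show "w (F \<odot> X) Y z = (F * w X Y) z"
      using module_mapD(2)[OF M1.metric_D(3)[OF g1 slice1_VF[OF Y]] sm_slice1[OF F] slice1_VF[OF X]]
        module_mapD(2)[OF M2.metric_D(3)[OF g2 slice2_VF[OF Y]] sm_slice2[OF F] slice2_VF[OF X]]
      by (cases z) (simp add: warped_apply slice1_scale slice2_scale algebra_simps)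
  qed
next
  fix z :: "'a \<times> 'b" and X F
  assume X: "X \<in> M.VF" and zero: "\<forall>Y\<in>M.VF. w X Y z = 0" and F: "F \<in> M.sm"
  obtain p q where z: "z = (p, q)" by (cases z)
  have mm1: "module_map M1.sm M1.VF 0" and mm2: "module_map M2.sm M2.VF 0"
    by (simp_all add: module_map_def)
  have "g1 (slice1 q X) Y1 p = 0" if "Y1 \<in> M1.VF" for Y1
    using warped_test_first[OF X _ mm1 that, of p q] zero by (simp add: z)
  then have "slice1 q X \<phi> p = 0" if "\<phi> \<in> M1.sm" for \<phi>
    by (rule M1.metric_D(5)[OF g1 slice1_VF[OF X] _ that])
  moreover have "(f p)\<^sup>2 * g2 (slice2 p X) Y2 q = 0" if "Y2 \<in> M2.VF" for Y2
    using warped_test_second[OF X _ mm2 that, of p q] zero by (simp add: z)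
  then have "slice2 p X \<psi> q = 0" if "\<psi> \<in> M2.sm" for \<psi>
    by (rule vertical_part_zero[OF X _ that])
  ultimately show "X F z = 0"
    unfolding z VF_split[OF X F] by (simp add: sm_slice1[OF F] sm_slice2[OF F])
qed

abbreviation gs :: "('a \<times> 'b) form \<Rightarrow> ('a \<times> 'b) vector_field" where "gs \<equiv> metric_sharp (prod_atlas A1 A2) w"

text \<open>Testing with fields tangent to one factor identifies the two parts of the sharp: the first is the sharp on
  the first factor, the second is orthogonal to everything.\<close>
lemma sharp_hlift:
  assumes \<omega>: "\<omega> \<in> M1.FM"
  shows "\<phi> \<in> M1.sm \<Longrightarrow> slice1 q (gs (hlift A1 A2 \<omega>)) \<phi> p = metric_sharp A1 g1 \<omega> \<phi> p"
    "\<psi> \<in> M2.sm \<Longrightarrow> slice2 p (gs (hlift A1 A2 \<omega>)) \<psi> q = 0"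
proof -
  note X = M.metric_sharp[OF pseudo_riemannian_warped hlift_FM[OF \<omega>]]
  let ?X = "gs (hlift A1 A2 \<omega>)"
  have "g1 (slice1 q ?X) Y1 p = \<omega> Y1 p" if "Y1 \<in> M1.VF" for Y1
    by (rule warped_test_first[OF X(1) _ M1.FM_D(3)[OF \<omega>] that]) (simp add: X(2) hlift_apply)
  then show "\<phi> \<in> M1.sm \<Longrightarrow> slice1 q ?X \<phi> p = metric_sharp A1 g1 \<omega> \<phi> p"
    by (rule_tac M1.metric_cancel[OF g1 slice1_VF[OF X(1)] M1.metric_sharp(1)[OF g1 \<omega>]])
      (simp_all add: M1.metric_sharp(2)[OF g1 \<omega>])
  have "(f p)\<^sup>2 * g2 (slice2 p ?X) Y2 q = 0" if Y2: "Y2 \<in> M2.VF" for Y2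
  proof -
    obtain Y where Y: "Y \<in> M.VF" "\<And>\<phi>. \<phi> \<in> M1.sm \<Longrightarrow> slice1 q Y \<phi> p = 0 \<phi> p"
      "\<And>\<psi>. \<psi> \<in> M2.sm \<Longrightarrow> slice2 p Y \<psi> q = Y2 \<psi> q"
      using tangent_vectors_lift[OF M1.VF_zero Y2] by metis
    have "\<omega> (slice1 q Y) p = \<omega> 0 p"
      by (rule M1.module_map_VF_cong[OF M1.FM_D(3)[OF \<omega>] slice1_VF[OF Y(1)] M1.VF_zero Y(2)])
    moreover have "\<omega> 0 = 0" by (rule module_map_zero[OF M1.FM_D(3)[OF \<omega>] M1.sm_zero M1.VF_zero])
    moreover have "g1 (slice1 q ?X) (slice1 q Y) p = g1 (slice1 q ?X) 0 p"
      by (rule M1.module_map_VF_cong[OF M1.metric_D(4)[OF g1 slice1_VF[OF X(1)]] slice1_VF[OF Y(1)] M1.VF_zero Y(2)])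
    moreover have "g1 (slice1 q ?X) 0 = 0"
      by (rule module_map_zero[OF M1.metric_D(4)[OF g1 slice1_VF[OF X(1)]] M1.sm_zero M1.VF_zero])
    moreover have "g2 (slice2 p ?X) (slice2 p Y) q = g2 (slice2 p ?X) Y2 q"
      by (rule M2.module_map_VF_cong[OF M2.metric_D(4)[OF g2 slice2_VF[OF X(1)]] slice2_VF[OF Y(1)] Y2 Y(3)])
    ultimately show ?thesis using X(2)[OF Y(1)] warped_apply[of ?X Y p q] by (simp add: hlift_apply[OF Y(1)])
  qed
  then show "\<psi> \<in> M2.sm \<Longrightarrow> slice2 p ?X \<psi> q = 0" by (rule vertical_part_zero[OF X(1)])
qed

text \<open>The weight \<open>f\<^sup>2\<close> of the second metric is divided out of the sharp; it is kept on the left, as a factor that is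
  constant along the second factor.\<close>
lemma sharp_vlift:
  assumes \<omega>: "\<omega> \<in> M2.FM" and \<psi>: "\<psi> \<in> M2.sm"
  shows "(f p)\<^sup>2 * slice2 p (gs (vlift A1 A2 \<omega>)) \<psi> q = metric_sharp A2 g2 \<omega> \<psi> q"
proof -
  note X = M.metric_sharp[OF pseudo_riemannian_warped vlift_FM[OF \<omega>]]
  let ?X = "gs (vlift A1 A2 \<omega>)"
  let ?Z = "(\<lambda>_. (f p)\<^sup>2) \<odot> slice2 p ?X"
  have Z: "?Z \<in> M2.VF" by (rule M2.VF_scale[OF M2.sm_const slice2_VF[OF X(1)]])
  have "g2 ?Z Y2 q = \<omega> Y2 q" if Y2: "Y2 \<in> M2.VF" for Y2
  proof -
    have "(f p)\<^sup>2 * g2 (slice2 p ?X) Y2 q = \<omega> Y2 q"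
      by (rule warped_test_second[OF X(1) _ M2.FM_D(3)[OF \<omega>] Y2]) (simp add: X(2) vlift_apply)
    then show ?thesis
      using module_mapD(2)[OF M2.metric_D(3)[OF g2 Y2] M2.sm_const slice2_VF[OF X(1)]] by simp
  qed
  then have "?Z \<psi> q = metric_sharp A2 g2 \<omega> \<psi> q"
    by (rule_tac M2.metric_cancel[OF g2 Z M2.metric_sharp(1)[OF g2 \<omega>] _ \<psi>])
      (simp add: M2.metric_sharp(2)[OF g2 \<omega>])
  then show ?thesis by simp
qed

abbreviation cg :: "('a \<times> 'b) co_two_tensor" where "cg \<equiv> cometric (prod_atlas A1 A2) w"

lemma cometric_hh:
  assumes \<omega>: "\<omega> \<in> M1.FM" and \<eta>: "\<eta> \<in> M1.FM"
  shows "cg (hlift A1 A2 \<omega>) (hlift A1 A2 \<eta>) = cometric A1 g1 \<omega> \<eta> \<circ> fst"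
proof
  fix z :: "'a \<times> 'b"
  obtain p q where z: "z = (p, q)" by (cases z)
  note X = M.metric_sharp(1)[OF pseudo_riemannian_warped hlift_FM[OF \<eta>]]
  have "\<omega> (slice1 q (gs (hlift A1 A2 \<eta>))) p = \<omega> (metric_sharp A1 g1 \<eta>) p"
    by (rule M1.module_map_VF_cong[OF M1.FM_D(3)[OF \<omega>] slice1_VF[OF X] M1.metric_sharp(1)[OF g1 \<eta>] sharp_hlift(1)[OF \<eta>]])
  then show "cg (hlift A1 A2 \<omega>) (hlift A1 A2 \<eta>) z = (cometric A1 g1 \<omega> \<eta> \<circ> fst) z"
    by (simp add: z M.cometric_eq[OF pseudo_riemannian_warped hlift_FM[OF \<omega>] hlift_FM[OF \<eta>]]
        hlift_apply[OF X] M1.cometric_eq[OF g1 \<omega> \<eta>])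
qed

lemma cometric_vh:
  assumes \<omega>: "\<omega> \<in> M2.FM" and \<eta>: "\<eta> \<in> M1.FM"
  shows "cg (vlift A1 A2 \<omega>) (hlift A1 A2 \<eta>) = 0"
proof
  fix z :: "'a \<times> 'b"
  obtain p q where z: "z = (p, q)" by (cases z)
  note X = M.metric_sharp(1)[OF pseudo_riemannian_warped hlift_FM[OF \<eta>]]
  have "\<omega> (slice2 p (gs (hlift A1 A2 \<eta>))) q = \<omega> 0 q"
    by (rule M2.module_map_VF_cong[OF M2.FM_D(3)[OF \<omega>] slice2_VF[OF X] M2.VF_zero])
      (simp add: sharp_hlift(2)[OF \<eta>])
  moreover have "\<omega> 0 = 0" by (rule module_map_zero[OF M2.FM_D(3)[OF \<omega>] M2.sm_zero M2.VF_zero])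
  ultimately show "cg (vlift A1 A2 \<omega>) (hlift A1 A2 \<eta>) z = 0 z"
    by (simp add: z M.cometric_eq[OF pseudo_riemannian_warped vlift_FM[OF \<omega>] hlift_FM[OF \<eta>]] vlift_apply[OF X])
qed

lemma cometric_hv:
  assumes \<omega>: "\<omega> \<in> M1.FM" and \<eta>: "\<eta> \<in> M2.FM"
  shows "cg (hlift A1 A2 \<omega>) (vlift A1 A2 \<eta>) = 0"
  using cometric_vh[OF \<eta> \<omega>] M.cometric_D(2)[OF pseudo_riemannian_warped hlift_FM[OF \<omega>] vlift_FM[OF \<eta>]] by simp

text \<open>The inverse weight \<open>1 / f\<^sup>2\<close> of the cometric comes from the sharp of the vertical lift.\<close>
lemma cometric_vv:
  assumes \<omega>: "\<omega> \<in> M2.FM" and \<eta>: "\<eta> \<in> M2.FM"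
  shows "(f p)\<^sup>2 * cg (vlift A1 A2 \<omega>) (vlift A1 A2 \<eta>) (p, q) = cometric A2 g2 \<omega> \<eta> q"
proof -
  note X = M.metric_sharp(1)[OF pseudo_riemannian_warped vlift_FM[OF \<eta>]]
  let ?Z = "(\<lambda>_. (f p)\<^sup>2) \<odot> slice2 p (gs (vlift A1 A2 \<eta>))"
  have "\<omega> ?Z q = \<omega> (metric_sharp A2 g2 \<eta>) q"
    by (rule M2.module_map_VF_cong[OF M2.FM_D(3)[OF \<omega>] M2.VF_scale[OF M2.sm_const slice2_VF[OF X]]
        M2.metric_sharp(1)[OF g2 \<eta>]]) (simp add: sharp_vlift[OF \<eta>])
  moreover have "\<omega> ?Z = (\<lambda>_. (f p)\<^sup>2) * \<omega> (slice2 p (gs (vlift A1 A2 \<eta>)))"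
    by (rule module_mapD(2)[OF M2.FM_D(3)[OF \<omega>] M2.sm_const slice2_VF[OF X]])
  ultimately show ?thesis
    by (simp add: M.cometric_eq[OF pseudo_riemannian_warped vlift_FM[OF \<omega>] vlift_FM[OF \<eta>]]
        vlift_apply[OF X] M2.cometric_eq[OF g2 \<omega> \<eta>])
qed

section \<open>Killing forms on the warped product\<close>

context
  fixes P1 :: "'a co_two_tensor" and P2 :: "'b co_two_tensor" and P :: "('a \<times> 'b) co_two_tensor"
    and \<eta>1 :: "'a form" and \<eta>2 :: "'b form"
  assumes P1: "bivector_field A1 P1" and P2: "bivector_field A2 P2"
    and P: "product_bivector A1 A2 P1 P2 P" and cas: "casimir A1 P1 f"
    and \<eta>1: "\<eta>1 \<in> M1.FM" and \<eta>2: "\<eta>2 \<in> M2.FM"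
begin

abbreviation \<eta> :: "('a \<times> 'b) form" where "\<eta> \<equiv> hlift A1 A2 \<eta>1 + vlift A1 A2 \<eta>2"
abbreviation L :: "('a \<times> 'b) co_two_tensor" where "L \<equiv> lie_cometric (prod_atlas A1 A2) cg P \<eta>"
abbreviation S1 :: "'a vector_field" where "S1 \<equiv> poisson_sharp A1 P1 \<eta>1"
abbreviation S2 :: "'b vector_field" where "S2 \<equiv> poisson_sharp A2 P2 \<eta>2"

lemma \<eta>_FM: "\<eta> \<in> M.FM"
  by (intro M.FM_add hlift_FM vlift_FM \<eta>1 \<eta>2)

lemma koszul_\<eta>_hlift:
  assumes "\<alpha> \<in> M1.FM"
  shows "koszul_bracket (prod_atlas A1 A2) P \<eta> (hlift A1 A2 \<alpha>) = hlift A1 A2 (koszul_bracket A1 P1 \<eta>1 \<alpha>)"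
  using M.koszul_add_left[OF product_D(1)[OF P1 P2 P] hlift_FM[OF \<eta>1] vlift_FM[OF \<eta>2] hlift_FM[OF assms]]
    koszul_hh[OF P1 P2 P \<eta>1 assms] koszul_hv(2)[OF P1 P2 P assms \<eta>2] by simp

lemma koszul_\<eta>_vlift:
  assumes "\<alpha> \<in> M2.FM"
  shows "koszul_bracket (prod_atlas A1 A2) P \<eta> (vlift A1 A2 \<alpha>) = vlift A1 A2 (koszul_bracket A2 P2 \<eta>2 \<alpha>)"
  using M.koszul_add_left[OF product_D(1)[OF P1 P2 P] hlift_FM[OF \<eta>1] vlift_FM[OF \<eta>2] vlift_FM[OF assms]]
    koszul_vv[OF P1 P2 P \<eta>2 assms] koszul_hv(1)[OF P1 P2 P \<eta>1 assms] by simp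

lemma sharp_\<eta>:
  assumes F: "F \<in> M.sm"
  shows "poisson_sharp (prod_atlas A1 A2) P \<eta> F (p, q) = S1 (\<lambda>p. F (p, q)) p + S2 (\<lambda>q. F (p, q)) q"
  using M.poisson_sharp_add[OF product_D(1)[OF P1 P2 P] hlift_FM[OF \<eta>1] vlift_FM[OF \<eta>2]]
    horizontalD(3)[OF horizontal_sharp[OF P1 P2 P \<eta>1] F, of p q]
    verticalD(3)[OF vertical_sharp[OF P1 P2 P \<eta>2] F, of p q] by simp

lemma lie_cometric_hh:
  assumes \<alpha>: "\<alpha> \<in> M1.FM" and \<beta>: "\<beta> \<in> M1.FM"
  shows "L (hlift A1 A2 \<alpha>) (hlift A1 A2 \<beta>) (p, q) = lie_cometric A1 (cometric A1 g1) P1 \<eta>1 \<alpha> \<beta> p"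
  using sharp_\<eta>[OF sm_fst[OF M1.cometric_D(1)[OF g1 \<alpha> \<beta>]], of p q]
    M2.VF_const[OF M2.poisson_sharp(1)[OF P2 \<eta>2], of "cometric A1 g1 \<alpha> \<beta> p"]
  by (simp add: lie_cometric_def koszul_\<eta>_hlift \<alpha> \<beta> cometric_hh M1.koszul_FM[OF P1 \<eta>1] comp_def)

lemma lie_cometric_hv:
  assumes \<alpha>: "\<alpha> \<in> M1.FM" and \<beta>: "\<beta> \<in> M2.FM"
  shows "L (hlift A1 A2 \<alpha>) (vlift A1 A2 \<beta>) = 0"
  using M.VF_fun_zero[OF M.poisson_sharp(1)[OF product_D(1)[OF P1 P2 P] \<eta>_FM]]
  by (simp add: lie_cometric_def koszul_\<eta>_hlift koszul_\<eta>_vlift \<alpha> \<beta> cometric_hv M1.koszul_FM[OF P1 \<eta>1]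
      M2.koszul_FM[OF P2 \<eta>2])

text \<open>The hypothesis speaks of exact forms only, but these span the cotangent spaces.\<close>
lemma casimir_sharp: "S1 f = 0"
proof
  fix p
  obtain N x E where F: "M1.dual_frame p N x E" by (rule M1.dual_frame_exists)
  note F' = M1.dual_frameD[OF F]
  have "P1 (ext_d A1 (x b)) (ext_d A1 f) = 0" for b using cas F'(3) by (simp add: casimir_def)
  then show "S1 f p = 0 p"
    using M1.module_map_FM_expand[OF M1.bivector_D(3)[OF P1 M1.ext_d_FM[OF f]] F \<eta>1 F'(2)]
    by (simp add: M1.poisson_sharp(3)[OF P1 \<eta>1 f])
qed

text \<open>Here the Casimir property enters. The function \<open>u\<close> is a multiple of \<open>1 / f\<^sup>2\<close>, and the sharp of \<open>\<eta>1\<close>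
  kills \<open>f\<close>; the Leibniz rule for \<open>f\<^sup>2 u\<close> avoids the derivative of a reciprocal.\<close>
lemma casimir_quotient:
  assumes u: "u \<in> M1.sm" and const: "\<And>p. (f p)\<^sup>2 * u p = c"
  shows "S1 u p = 0"
proof -
  note D = M1.VF_D[OF M1.poisson_sharp(1)[OF P1 \<eta>1]]
  have "f * f * u = (\<lambda>_. c)" using const by (auto simp: power2_eq_square)
  then have "S1 (f * f * u) = 0" by (simp only: M1.VF_const[OF M1.poisson_sharp(1)[OF P1 \<eta>1]])
  moreover have "S1 (f * f) = 0" unfolding D(5)[OF f f] casimir_sharp by simp
  ultimately have "f * f * S1 u = 0"
    unfolding D(5)[OF M1.sm_mult[OF f f] u] by simp
  from fun_cong[OF this, of p] show ?thesis using fpos[rule_format, of p] by simp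
qed

text \<open>For fixed \<open>q\<close> the function to be differentiated by \<open>S1\<close> is a multiple of \<open>1 / f\<^sup>2\<close>, so that only the
  derivative along the second factor remains.\<close>
lemma lie_cometric_vv:
  assumes \<alpha>: "\<alpha> \<in> M2.FM" and \<beta>: "\<beta> \<in> M2.FM"
  shows "(f p)\<^sup>2 * L (vlift A1 A2 \<alpha>) (vlift A1 A2 \<beta>) (p, q) = lie_cometric A2 (cometric A2 g2) P2 \<eta>2 \<alpha> \<beta> q"
proof -
  let ?c = "cg (vlift A1 A2 \<alpha>) (vlift A1 A2 \<beta>)"
  have c: "?c \<in> M.sm"
    by (rule M.cometric_D(1)[OF pseudo_riemannian_warped vlift_FM[OF \<alpha>] vlift_FM[OF \<beta>]])
  have "S1 (\<lambda>p. ?c (p, q)) p = 0"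
    by (rule casimir_quotient[OF sm_slice1[OF c] cometric_vv[OF \<alpha> \<beta>]])
  moreover have "(f p)\<^sup>2 * S2 (\<lambda>q. ?c (p, q)) q = S2 (cometric A2 g2 \<alpha> \<beta>) q"
  proof -
    have "(\<lambda>_. (f p)\<^sup>2) * (\<lambda>q. ?c (p, q)) = cometric A2 g2 \<alpha> \<beta>"
      by (intro ext) (simp add: cometric_vv[OF \<alpha> \<beta>])
    then show ?thesis
      using M2.VF_D(4)[OF M2.poisson_sharp(1)[OF P2 \<eta>2] sm_slice2[OF c], of "(f p)\<^sup>2" p]
      by simp
  qed
  ultimately have 1: "(f p)\<^sup>2 * poisson_sharp (prod_atlas A1 A2) P \<eta> ?c (p, q) = S2 (cometric A2 g2 \<alpha> \<beta>) q"
    by (simp add: sharp_\<eta>[OF c])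
  note K = M2.koszul_FM[OF P2 \<eta>2 \<alpha>] M2.koszul_FM[OF P2 \<eta>2 \<beta>]
  show ?thesis
    unfolding lie_cometric_def koszul_\<eta>_vlift[OF \<alpha>] koszul_\<eta>_vlift[OF \<beta>] minus_apply right_diff_distrib
      1 cometric_vv[OF K(1) \<beta>] cometric_vv[OF \<alpha> K(2)] ..
qed

text \<open>The coefficients of \<open>\<alpha>\<close> in a frame at \<open>(p, q)\<close> are frozen to constants, and the differentials of the dual frame
  are split into those of their partial functions.\<close>
lemma form_split:
  assumes \<alpha>: "\<alpha> \<in> M.FM"
  obtains \<alpha>1 \<alpha>2 where "\<alpha>1 \<in> M1.FM" "\<alpha>2 \<in> M2.FM"
    "\<And>X. X \<in> M.VF \<Longrightarrow> \<alpha> X (p, q) = (hlift A1 A2 \<alpha>1 + vlift A1 A2 \<alpha>2) X (p, q)"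
proof -
  obtain N x E where F: "M.dual_frame (p, q) N x E" by (rule M.dual_frame_exists)
  note F' = M.dual_frameD[OF F]
  let ?a1 = "\<Sum>b\<in>Basis. (\<lambda>_. \<alpha> (E b) (p, q)) \<odot> ext_d A1 (\<lambda>p. x b (p, q))"
  let ?a2 = "\<Sum>b\<in>Basis. (\<lambda>_. \<alpha> (E b) (p, q)) \<odot> ext_d A2 (\<lambda>q. x b (p, q))"
  show thesis
  proof (rule that)
    show "?a1 \<in> M1.FM" by (intro M1.FM_sum M1.FM_scale M1.sm_const M1.ext_d_FM sm_slice1 F')
    show "?a2 \<in> M2.FM" by (intro M2.FM_sum M2.FM_scale M2.sm_const M2.ext_d_FM sm_slice2 F')
    fix X assume X: "X \<in> M.VF"
    show "\<alpha> X (p, q) = (hlift A1 A2 ?a1 + vlift A1 A2 ?a2) X (p, q)"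
      using M.module_map_VF_expand[OF M.FM_D(3)[OF \<alpha>] F X F'(2)] VF_split[OF X F'(3), of _ p q]
      by (simp add: hlift_apply[OF X] vlift_apply[OF X] sum_fun_apply M1.ext_d_apply[OF slice1_VF[OF X]]
          M2.ext_d_apply[OF slice2_VF[OF X]] sum.distrib algebra_simps)
  qed
qed

text \<open>From left to right the equation is tested on lifts, from right to left every pair of forms is replaced by
  lifts at the point considered.\<close>
lemma killing_warped_iff:
  "killing_form (prod_atlas A1 A2) cg P \<eta> \<longleftrightarrow>
    killing_form A1 (cometric A1 g1) P1 \<eta>1 \<and> killing_form A2 (cometric A2 g2) P2 \<eta>2"
proof (intro iffI conjI)
  assume K: "killing_form (prod_atlas A1 A2) cg P \<eta>"
  then have L: "L \<alpha> \<beta> = 0" if "\<alpha> \<in> M.FM" "\<beta> \<in> M.FM" for \<alpha> \<beta> using that by (simp add: killing_form_def)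
  show "killing_form A1 (cometric A1 g1) P1 \<eta>1"
    unfolding killing_form_def
  proof (intro conjI ballI ext)
    fix \<alpha> \<beta> p assume ab: "\<alpha> \<in> M1.FM" "\<beta> \<in> M1.FM"
    show "lie_cometric A1 (cometric A1 g1) P1 \<eta>1 \<alpha> \<beta> p = 0 p"
      using lie_cometric_hh[OF ab, of p undefined] L[OF hlift_FM[OF ab(1)] hlift_FM[OF ab(2)]] by simp
  qed (rule \<eta>1)
  show "killing_form A2 (cometric A2 g2) P2 \<eta>2"
    unfolding killing_form_def
  proof (intro conjI ballI ext)
    fix \<alpha> \<beta> q assume ab: "\<alpha> \<in> M2.FM" "\<beta> \<in> M2.FM"
    show "lie_cometric A2 (cometric A2 g2) P2 \<eta>2 \<alpha> \<beta> q = 0 q"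
      using lie_cometric_vv[OF ab, of undefined q] L[OF vlift_FM[OF ab(1)] vlift_FM[OF ab(2)]] by simp
  qed (rule \<eta>2)
next
  assume K: "killing_form A1 (cometric A1 g1) P1 \<eta>1 \<and> killing_form A2 (cometric A2 g2) P2 \<eta>2"
  note PP = product_D(1)[OF P1 P2 P]
  note mm = M.lie_cometric_module_map[OF PP pseudo_riemannian_warped \<eta>_FM]
  show "killing_form (prod_atlas A1 A2) cg P \<eta>"
    unfolding killing_form_def
  proof (intro conjI ballI ext)
    show "\<eta> \<in> M.FM" by (rule \<eta>_FM)
    fix \<alpha> \<beta> and z :: "'a \<times> 'b" assume \<alpha>: "\<alpha> \<in> M.FM" and \<beta>: "\<beta> \<in> M.FM"
    obtain p q where z: "z = (p, q)" by (cases z)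
    obtain a1 a2 where a: "a1 \<in> M1.FM" "a2 \<in> M2.FM"
      "\<And>X. X \<in> M.VF \<Longrightarrow> \<alpha> X (p, q) = (hlift A1 A2 a1 + vlift A1 A2 a2) X (p, q)"
      by (rule form_split[OF \<alpha>, of p q]) blast
    obtain b1 b2 where b: "b1 \<in> M1.FM" "b2 \<in> M2.FM"
      "\<And>X. X \<in> M.VF \<Longrightarrow> \<beta> X (p, q) = (hlift A1 A2 b1 + vlift A1 A2 b2) X (p, q)"
      by (rule form_split[OF \<beta>, of p q]) blast
    note ha = hlift_FM[OF a(1)] and va = vlift_FM[OF a(2)] and hb = hlift_FM[OF b(1)] and vb = vlift_FM[OF b(2)]
    note sa = M.FM_add[OF ha va] and sb = M.FM_add[OF hb vb]
    have "L \<alpha> \<beta> (p, q) = L (hlift A1 A2 a1 + vlift A1 A2 a2) \<beta> (p, q)"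
      by (rule M.module_map_FM_cong[OF mm(1)[OF \<beta>] \<alpha> sa a(3)])
    also have "\<dots> = L (hlift A1 A2 a1 + vlift A1 A2 a2) (hlift A1 A2 b1 + vlift A1 A2 b2) (p, q)"
      by (rule M.module_map_FM_cong[OF mm(2)[OF sa] \<beta> sb b(3)])
    also have "\<dots> = L (hlift A1 A2 a1) (hlift A1 A2 b1) (p, q) + L (hlift A1 A2 a1) (vlift A1 A2 b2) (p, q)
        + (L (vlift A1 A2 a2) (hlift A1 A2 b1) (p, q) + L (vlift A1 A2 a2) (vlift A1 A2 b2) (p, q))"
      using module_mapD(1)[OF mm(1)[OF sb] ha va] module_mapD(1)[OF mm(2)[OF ha] hb vb]
        module_mapD(1)[OF mm(2)[OF va] hb vb] by simp
    finally have sum: "L \<alpha> \<beta> (p, q) = L (hlift A1 A2 a1) (hlift A1 A2 b1) (p, q) + L (hlift A1 A2 a1) (vlift A1 A2 b2) (p, q)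
        + (L (vlift A1 A2 a2) (hlift A1 A2 b1) (p, q) + L (vlift A1 A2 a2) (vlift A1 A2 b2) (p, q))" .
    have "L (vlift A1 A2 a2) (hlift A1 A2 b1) = L (hlift A1 A2 b1) (vlift A1 A2 a2)"
      by (rule M.lie_cometric_sym[OF PP pseudo_riemannian_warped \<eta>_FM va hb])
    then have vh: "L (vlift A1 A2 a2) (hlift A1 A2 b1) (p, q) = 0"
      unfolding lie_cometric_hv[OF b(1) a(2)] by (simp only: zero_fun_apply)
    have hv: "L (hlift A1 A2 a1) (vlift A1 A2 b2) (p, q) = 0"
      unfolding lie_cometric_hv[OF a(1) b(2)] by (rule zero_fun_apply)
    have "lie_cometric A1 (cometric A1 g1) P1 \<eta>1 a1 b1 p = 0"
      using K a(1) b(1) by (simp add: killing_form_def)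
    then have hh: "L (hlift A1 A2 a1) (hlift A1 A2 b1) (p, q) = 0"
      unfolding lie_cometric_hh[OF a(1) b(1)] .
    have "lie_cometric A2 (cometric A2 g2) P2 \<eta>2 a2 b2 q = 0"
      using K a(2) b(2) by (simp add: killing_form_def)
    then have "(f p)\<^sup>2 * L (vlift A1 A2 a2) (vlift A1 A2 b2) (p, q) = 0"
      unfolding lie_cometric_vv[OF a(2) b(2)] .
    then have vv: "L (vlift A1 A2 a2) (vlift A1 A2 b2) (p, q) = 0"
      using fpos[rule_format, of p] by (simp only: mult_eq_0_iff power_eq_0_iff) simp
    show "L \<alpha> \<beta> z = 0 z"
      unfolding z sum hh hv vh vv by simp
  qed
qed

end

end

end

theorem theorem3p6:
  fixes A1 :: "('a::{t2_space,second_countable_topology}, 'e::euclidean_space) atlas"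
    and A2 :: "('b::{t2_space,second_countable_topology}, 'f::euclidean_space) atlas"
    and g1 :: "'a two_tensor" and g2 :: "'b two_tensor"
    and P1 :: "'a co_two_tensor" and P2 :: "'b co_two_tensor"
    and P :: "('a \<times> 'b) co_two_tensor"
    and f :: "'a \<Rightarrow> real"
    and \<eta>1 :: "'a form" and \<eta>2 :: "'b form"
  assumes "smooth_atlas A1" and "smooth_atlas A2"
    and "pseudo_riemannian A1 g1" and "pseudo_riemannian A2 g2"
    and "poisson_tensor A1 P1" and "poisson_tensor A2 P2"
    and "f \<in> smooth_functions A1" and "\<forall>p. f p > 0"
    and "product_bivector A1 A2 P1 P2 P"
    and "riemannian_poisson (prod_atlas A1 A2)
           (cometric (prod_atlas A1 A2) (warped_metric f g1 g2)) P"
    and "casimir A1 P1 f"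
    and "\<eta>1 \<in> one_forms A1" and "\<eta>2 \<in> one_forms A2"
  shows "killing_form (prod_atlas A1 A2)
           (cometric (prod_atlas A1 A2) (warped_metric f g1 g2)) P
           (hlift A1 A2 \<eta>1 + vlift A1 A2 \<eta>2)
         \<longleftrightarrow>
         killing_form A1 (cometric A1 g1) P1 \<eta>1 \<and>
         killing_form A2 (cometric A2 g2) P2 \<eta>2"
proof -
  interpret product_manifold A1 A2
    using assms(1,2) by (intro product_manifold.intro smooth_manifold.intro)
  have "bivector_field A1 P1" "bivector_field A2 P2"
    using assms(5,6) by (simp_all add: poisson_tensor_def)
  then show ?thesis
    by (rule killing_warped_iff[OF assms(3,4,7,8) _ _ assms(9,11,12,13)])
qed

end
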